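(* Let $\mathcal R$ be a restrained expansion of the ordered field of real numbers, and let $D \subseteq \mathbb{R}^n$ be a nonempty $\mathcal D_\Sigma$ set. The following are equivalent: (1) $D$ has empty interior; (2) $D$ is nowhere dense; (3) $D$ has Lebesgue measure $0$. Moreover, $\dim_{\mathcal H}(D) = \dim(D)$.
   Context: "Definable" means definable in $\mathcal R$ with parameters. $\mathcal R$ is restrained if for every definable discrete set $E\subseteq\mathbb{R}^k$ and every definable function $g:E\to\mathbb{R}$, the set $g(E)$ is nowhere dense in $\mathbb{R}$. A definable set $X\subseteq\mathbb{R}^n$ is a $\mathcal D_\Sigma$ set if there is a definable closed $Y\subseteq\mathbb{R}^{n+1}$ whose projection onto the first $n$ coordinates is $X$. $\dim_{\mathcal H}$ is Hausdorff dimension. $\dim(X)$ is the maximum $e$ such that some coordinate subspace $L$ of linear dimension $e$ has the orthogonal projection of $X$ onto $L$ with nonempty interior in $L$. *)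

theory Defs
  imports "HOL-Analysis.Analysis"
begin

text \<open>
  Real space of dimension \<open>n\<close> is the library topology \<^const>\<open>Euclidean_space\<close> \<open>n\<close>, whose points
  are the sequences \<open>nat \<Rightarrow> real\<close> vanishing from index \<open>n\<close> on. Restrainedness quantifies over all
  dimensions, and projections relate dimensions \<open>n + 1\<close> and \<open>n\<close>, so dimensions cannot be types.
\<close>

subsection \<open>Expansions of the ordered real field and definable sets\<close>

text \<open>
  An expansion is given by its additional function and relation symbols, with arities and
  interpretations. An interpretation is only ever applied to lists of the length given by the arity
  (see \<open>wf_trm\<close>, \<open>wf_fm\<close>); constants are function symbols of arity 0.
\<close>

record ('f, 'r) expansion =
  fun_arity :: "'f \<Rightarrow> nat"
  rel_arity :: "'r \<Rightarrow> nat"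
  fun_interp :: "'f \<Rightarrow> real list \<Rightarrow> real"
  rel_interp :: "'r \<Rightarrow> real list \<Rightarrow> bool"

datatype 'f trm =
    Var nat
  | Zero
  | One
  | Plus "'f trm" "'f trm"
  | Minus "'f trm"
  | Times "'f trm" "'f trm"
  | Fun 'f "'f trm list"

datatype ('f, 'r) fm =
    Eq "'f trm" "'f trm"
  | Less "'f trm" "'f trm"
  | Rel 'r "'f trm list"
  | Neg "('f, 'r) fm"
  | Conj "('f, 'r) fm" "('f, 'r) fm"
  | Exi nat "('f, 'r) fm"

fun wf_trm :: "('f, 'r) expansion \<Rightarrow> 'f trm \<Rightarrow> bool" where
  "wf_trm R (Var i) = True"
| "wf_trm R Zero = True"
| "wf_trm R One = True"
| "wf_trm R (Plus s t) = (wf_trm R s \<and> wf_trm R t)"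
| "wf_trm R (Minus t) = wf_trm R t"
| "wf_trm R (Times s t) = (wf_trm R s \<and> wf_trm R t)"
| "wf_trm R (Fun f ts) = (length ts = fun_arity R f \<and> (\<forall>t \<in> set ts. wf_trm R t))"

fun wf_fm :: "('f, 'r) expansion \<Rightarrow> ('f, 'r) fm \<Rightarrow> bool" where
  "wf_fm R (Eq s t) = (wf_trm R s \<and> wf_trm R t)"
| "wf_fm R (Less s t) = (wf_trm R s \<and> wf_trm R t)"
| "wf_fm R (Rel r ts) = (length ts = rel_arity R r \<and> (\<forall>t \<in> set ts. wf_trm R t))"
| "wf_fm R (Neg \<phi>) = wf_fm R \<phi>"
| "wf_fm R (Conj \<phi> \<psi>) = (wf_fm R \<phi> \<and> wf_fm R \<psi>)"
| "wf_fm R (Exi i \<phi>) = wf_fm R \<phi>"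

fun val :: "('f, 'r) expansion \<Rightarrow> (nat \<Rightarrow> real) \<Rightarrow> 'f trm \<Rightarrow> real" where
  "val R v (Var i) = v i"
| "val R v Zero = 0"
| "val R v One = 1"
| "val R v (Plus s t) = val R v s + val R v t"
| "val R v (Minus t) = - val R v t"
| "val R v (Times s t) = val R v s * val R v t"
| "val R v (Fun f ts) = fun_interp R f (map (val R v) ts)"

fun sat :: "('f, 'r) expansion \<Rightarrow> (nat \<Rightarrow> real) \<Rightarrow> ('f, 'r) fm \<Rightarrow> bool" where
  "sat R v (Eq s t) = (val R v s = val R v t)"
| "sat R v (Less s t) = (val R v s < val R v t)"
| "sat R v (Rel r ts) = rel_interp R r (map (val R v) ts)"
| "sat R v (Neg \<phi>) = (\<not> sat R v \<phi>)"
| "sat R v (Conj \<phi> \<psi>) = (sat R v \<phi> \<and> sat R v \<psi>)"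
| "sat R v (Exi i \<phi>) = (\<exists>a. sat R (v(i := a)) \<phi>)"

text \<open>
  The variables with index below \<open>n\<close> stand for the coordinates; all remaining free variables are
  filled with the real parameters \<open>p\<close>.
\<close>

definition definable :: "('f, 'r) expansion \<Rightarrow> nat \<Rightarrow> (nat \<Rightarrow> real) set \<Rightarrow> bool" where
  "definable R n X \<longleftrightarrow>
     (\<exists>\<phi> p. wf_fm R \<phi> \<and>
       X = {x \<in> topspace (Euclidean_space n). sat R (\<lambda>i. if i < n then x i else p i) \<phi>})"

definition definable_fun ::
    "('f, 'r) expansion \<Rightarrow> nat \<Rightarrow> (nat \<Rightarrow> real) set \<Rightarrow> ((nat \<Rightarrow> real) \<Rightarrow> real) \<Rightarrow> bool" where
  "definable_fun R k E g \<longleftrightarrow>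
     definable R k E \<and> definable R (Suc k) ((\<lambda>x. x(k := g x)) ` E)"

definition D_Sigma :: "('f, 'r) expansion \<Rightarrow> nat \<Rightarrow> (nat \<Rightarrow> real) set \<Rightarrow> bool" where
  "D_Sigma R n X \<longleftrightarrow>
     definable R n X \<and>
     (\<exists>Y. definable R (Suc n) Y \<and> closedin (Euclidean_space (Suc n)) Y \<and>
          (\<lambda>y. y(n := 0)) ` Y = X)"

definition nowhere_dense_in :: "'a topology \<Rightarrow> 'a set \<Rightarrow> bool" where
  "nowhere_dense_in T S \<longleftrightarrow> T interior_of (T closure_of S) = {}"

definition restrained :: "('f, 'r) expansion \<Rightarrow> bool" where
  "restrained R \<longleftrightarrow>
     (\<forall>k E g. definable R k E \<and> subtopology (Euclidean_space k) E = discrete_topology E \<and>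
              definable_fun R k E g \<longrightarrow>
              nowhere_dense_in euclideanreal (g ` E))"


subsection \<open>Lebesgue null sets and dimensions\<close>

text \<open>
  The product measure lives on functions that are \<^const>\<open>undefined\<close> outside \<open>{..<n}\<close>, whereas points
  of \<^const>\<open>Euclidean_space\<close> \<open>n\<close> are 0 there; restriction translates between the two.
\<close>

definition lebesgue_null :: "nat \<Rightarrow> (nat \<Rightarrow> real) set \<Rightarrow> bool" where
  "lebesgue_null n X \<longleftrightarrow>
     (\<lambda>x. restrict x {..<n}) ` X \<in> null_sets (completion (Pi\<^sub>M {..<n} (\<lambda>_. lborel)))"

definition coord_subspace :: "nat set \<Rightarrow> (nat \<Rightarrow> real) set" where
  "coord_subspace I = {x. \<forall>i. i \<notin> I \<longrightarrow> x i = 0}"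

definition coord_proj :: "nat set \<Rightarrow> (nat \<Rightarrow> real) \<Rightarrow> (nat \<Rightarrow> real)" where
  "coord_proj I x = (\<lambda>i. if i \<in> I then x i else 0)"

text \<open>The set below is nonempty exactly if \<open>X\<close> is, by taking \<open>I = {}\<close>.\<close>

definition top_dim :: "nat \<Rightarrow> (nat \<Rightarrow> real) set \<Rightarrow> nat" where
  "top_dim n X =
     Max {card I |I. I \<subseteq> {..<n} \<and>
            subtopology (Euclidean_space n) (coord_subspace I) interior_of (coord_proj I ` X) \<noteq> {}}"

text \<open>
  The metric \<^const>\<open>dist\<close> on the type \<open>nat \<Rightarrow> real\<close> is a weighted product metric, which is not
  the Euclidean one.
\<close>

definition euclid_dist :: "nat \<Rightarrow> (nat \<Rightarrow> real) \<Rightarrow> (nat \<Rightarrow> real) \<Rightarrow> real" where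
  "euclid_dist n x y = L2_set (\<lambda>i. x i - y i) {..<n}"

definition euclid_diam :: "nat \<Rightarrow> (nat \<Rightarrow> real) set \<Rightarrow> real" where
  "euclid_diam n U = (if U = {} then 0 else SUP (x, y) \<in> U \<times> U. euclid_dist n x y)"

text \<open>
  The \<open>s\<close>-th power of the diameter. The case \<open>s = 0\<close> (counting measure) is separate because
  \<open>0 powr 0 = 0\<close> in the library.
\<close>

definition diam_power :: "nat \<Rightarrow> real \<Rightarrow> (nat \<Rightarrow> real) set \<Rightarrow> ennreal" where
  "diam_power n s U =
     (if U = {} then 0 else if s = 0 then 1 else ennreal (euclid_diam n U powr s))"

text \<open>
  Requiring all distances in \<open>U i\<close> to be at most \<open>\<delta>\<close> says that its diameter is at most \<open>\<delta>\<close>, and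
  ensures that the supremum in \<open>euclid_diam\<close> is one of a bounded set.
\<close>

definition hausdorff_premeasure ::
    "nat \<Rightarrow> real \<Rightarrow> real \<Rightarrow> (nat \<Rightarrow> real) set \<Rightarrow> ennreal" where
  "hausdorff_premeasure n s \<delta> X =
     (INF U \<in> {U :: nat \<Rightarrow> (nat \<Rightarrow> real) set.
                 X \<subseteq> (\<Union>i. U i) \<and>
                 (\<forall>i. U i \<subseteq> topspace (Euclidean_space n) \<and>
                      (\<forall>x \<in> U i. \<forall>y \<in> U i. euclid_dist n x y \<le> \<delta>))}.
        \<Sum>i. diam_power n s (U i))"

definition hausdorff_measure :: "nat \<Rightarrow> real \<Rightarrow> (nat \<Rightarrow> real) set \<Rightarrow> ennreal" where
  "hausdorff_measure n s X = (SUP \<delta> \<in> {0<..}. hausdorff_premeasure n s \<delta> X)"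

definition hausdorff_dim :: "nat \<Rightarrow> (nat \<Rightarrow> real) set \<Rightarrow> ennreal" where
  "hausdorff_dim n X = Inf {ennreal s |s. 0 \<le> s \<and> hausdorff_measure n s X = 0}"

end

theory Submission
  imports Defs
begin

text \<open>
  The hypothesis enters only through the projection of a discrete set built from a family of
  separated points (\<open>restrained_gauge_family\<close>). Applied to left endpoints of gaps it shows that
  \<open>A + t B\<close> has empty interior for compact definable \<open>A, B \<subseteq> \<real>\<close> with empty interior; applied to
  lexicographically first points of a definable exhaustion by compact sets it shows that a
  \<open>D\<^sub>\<Sigma>\<close> subset of the line with empty interior is nowhere dense. Baire category and Fubini
  arguments on fibres carry this to higher dimensions: empty interior implies nowhere dense and
  null, and linear maps do not raise the topological dimension.

  For the Hausdorff dimension, let \<open>W\<close> be compact of topological dimension \<open>d\<close> and suppose it had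
  positive \<open>s\<close>-content for some \<open>s > d\<close>. Choose \<open>m\<close> with \<open>m s > m d + 1\<close>. The power \<open>W\<^sup>m\<close> has
  topological dimension \<open>m d\<close>, so all of its linear images in dimension \<open>m d + 1\<close> are null. But a
  discrete Frostman measure on \<open>W\<^sup>m\<close> has bounded \<open>(m d + 1)\<close>-energy, so by averaging over linear
  maps some image has positive measure.
\<close>

subsection \<open>Definable predicates on environments\<close>

text \<open>All dimensions share the one space \<open>nat \<Rightarrow> real\<close> with the
  product topology. A projection to the coordinates \<open>I\<close> is represented by the cylinder
  \<open>proj I W\<close>, so "interior in the coordinates \<open>I\<close>" is plain
  \<open>interior\<close>, and a single Baire theorem serves every dimension.

  A linear map is a composition of shears. A shear changes one coordinate, so over a fixed base
  point it only produces a sum A + t B of two fibres; this is how the statement about the line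
  reaches linear images. Null sets come from the case t = -1: by Steinhaus, differences of a set of
  positive measure fill an interval.

  The power \<open>W^m\<close> bridges a gap of one dimension. Smallness in dimension D makes images
  in D + 1 coordinates null, while bounded (D + 1)-energy needs an exponent above D + 1. From s > d
  alone the exponent may miss this by almost one; for the m-th power the surplus is m (s - d).

  No measure is constructed on the fractal side: there are only weights on finite sets, one for each
  scale 2^-k, with constants independent of k. Limits are taken at the very end, of matrices and
  points and of Lebesgue measurable sets.\<close>

inductive tm :: "('f, 'r) expansion \<Rightarrow> ((nat \<Rightarrow> real) \<Rightarrow> real) \<Rightarrow> bool" for R where
  var: "tm R (\<lambda>v. v i)"
| const: "tm R (\<lambda>v. c)"
| plus: "tm R s \<Longrightarrow> tm R t \<Longrightarrow> tm R (\<lambda>v. s v + t v)"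
| uminus: "tm R t \<Longrightarrow> tm R (\<lambda>v. - t v)"
| times: "tm R s \<Longrightarrow> tm R t \<Longrightarrow> tm R (\<lambda>v. s v * t v)"
| func: "length ts = fun_arity R f \<Longrightarrow> (\<forall>t \<in> set ts. tm R t) \<Longrightarrow>
    tm R (\<lambda>v. fun_interp R f (map (\<lambda>t. t v) ts))"

text \<open>The rule \<open>const\<close> of \<open>tm\<close> admits every real number, so
  parameters are built in and need no bookkeeping until predicates are turned back into
  formulas.\<close>

inductive dfn :: "('f, 'r) expansion \<Rightarrow> ((nat \<Rightarrow> real) \<Rightarrow> bool) \<Rightarrow> bool" for R where
  eq: "tm R s \<Longrightarrow> tm R t \<Longrightarrow> dfn R (\<lambda>v. s v = t v)"
| less: "tm R s \<Longrightarrow> tm R t \<Longrightarrow> dfn R (\<lambda>v. s v < t v)"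
| rel: "length ts = rel_arity R r \<Longrightarrow> (\<forall>t \<in> set ts. tm R t) \<Longrightarrow>
    dfn R (\<lambda>v. rel_interp R r (map (\<lambda>t. t v) ts))"
| neg: "dfn R P \<Longrightarrow> dfn R (\<lambda>v. \<not> P v)"
| conj: "dfn R P \<Longrightarrow> dfn R Q \<Longrightarrow> dfn R (\<lambda>v. P v \<and> Q v)"
| exi: "dfn R P \<Longrightarrow> dfn R (\<lambda>v. \<exists>a. P (v(i := a)))"

lemma dfn_cong:
  assumes "dfn R P" and "\<And>v. P v = Q v"
  shows "dfn R Q"
proof -
  have "P = Q" using assms(2) by (rule ext)
  then show ?thesis using assms(1) by simp
qed

text \<open>A bound on the relevant variables is what provides fresh variables when substituting
  under a quantifier.\<close>

definition supported :: "nat \<Rightarrow> ((nat \<Rightarrow> real) \<Rightarrow> 'a) \<Rightarrow> bool" where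
  "supported N f \<longleftrightarrow> (\<forall>v w. (\<forall>i<N. v i = w i) \<longrightarrow> f v = f w)"

lemma supportedD: "supported N f \<Longrightarrow> (\<And>i. i < N \<Longrightarrow> v i = w i) \<Longrightarrow> f v = f w"
  by (simp add: supported_def)

lemma supported_mono: "supported M f \<Longrightarrow> M \<le> N \<Longrightarrow> supported N f"
  by (simp add: supported_def)

lemma supported_binary:
  assumes "\<exists>N. supported N f" "\<exists>N. supported N g"
  shows "\<exists>N. supported N (\<lambda>v. h (f v) (g v))"
proof -
  obtain M N where "supported M f" "supported N g" using assms by blast
  then have "supported (max M N) f" "supported (max M N) g"
    by (auto elim: supported_mono)
  then have "supported (max M N) (\<lambda>v. h (f v) (g v))"
    unfolding supported_def by metis
  then show ?thesis by (rule exI)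
qed

lemma supported_unary: "\<exists>N. supported N f \<Longrightarrow> \<exists>N. supported N (\<lambda>v. h (f v))"
  unfolding supported_def by metis

lemma supported_list:
  assumes "\<And>t. t \<in> set ts \<Longrightarrow> \<exists>N. supported N t"
  shows "\<exists>N. supported N (\<lambda>v. map (\<lambda>t. t v) ts)"
  using assms
proof (induction ts)
  case Nil
  show ?case by (simp add: supported_def)
next
  case (Cons t ts)
  have "\<exists>N. supported N t" "\<exists>N. supported N (\<lambda>v. map (\<lambda>t. t v) ts)"
    using Cons by auto
  from supported_binary[OF this, of "(#)"] show ?case by simp
qed

lemma tm_finite_support:
  assumes "tm R t"
  shows "\<exists>N. supported N t"
  using assms
proof induction
  case (var i)
  have "supported (Suc i) (\<lambda>v. v i)" by (simp add: supported_def)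
  then show ?case by (rule exI)
next
  case (const c)
  show ?case by (simp add: supported_def)
next
  case (plus s t)
  show ?case by (rule supported_binary[OF plus.IH])
next
  case (uminus t)
  show ?case by (rule supported_unary[OF uminus.IH])
next
  case (times s t)
  show ?case by (rule supported_binary[OF times.IH])
next
  case (func ts f)
  then have "\<exists>N. supported N (\<lambda>v. map (\<lambda>t. t v) ts)" by (intro supported_list) blast
  then show ?case by (rule supported_unary)
qed

lemma dfn_finite_support:
  assumes "dfn R P"
  shows "\<exists>N. supported N P"
  using assms
proof induction
  case (eq s t)
  show ?case by (rule supported_binary[OF eq[THEN tm_finite_support]])
next
  case (less s t)
  show ?case by (rule supported_binary[OF less[THEN tm_finite_support]])
next
  case (rel ts r)
  then have "\<exists>N. supported N (\<lambda>v. map (\<lambda>t. t v) ts)"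
    using tm_finite_support by (intro supported_list) blast
  then show ?case by (rule supported_unary)
next
  case (neg P)
  show ?case by (rule supported_unary[OF neg.IH])
next
  case (conj P Q)
  show ?case by (rule supported_binary[OF conj.IH])
next
  case (exi P i)
  then obtain N where N: "supported N P" by blast
  have "P (v(i := a)) = P (w(i := a))" if "\<forall>j<N. v j = w j" for v w a
    by (rule supportedD[OF N]) (use that in simp)
  then have "supported N (\<lambda>v. \<exists>a. P (v(i := a)))"
    unfolding supported_def by blast
  then show ?case by (rule exI)
qed

lemma tm_subst:
  assumes "tm R t" and "\<And>i. tm R (\<lambda>v. \<tau> v i)"
  shows "tm R (\<lambda>v. t (\<tau> v))"
  using assms(1)
proof induction
  case (func ts f)
  have "tm R (\<lambda>v. fun_interp R f (map (\<lambda>t. t v) (map (\<lambda>t v. t (\<tau> v)) ts)))"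
    using func by (intro tm.func) auto
  then show ?case by (simp add: o_def)
qed (auto intro: tm.intros assms(2))

text \<open>The last assumption provides variables that \<open>\<tau>\<close> ignores. Such a
  variable can take over the role of a bound one, which makes the substitution capture-free.\<close>

lemma dfn_subst_aux:
  assumes "dfn R P" and "\<And>i. tm R (\<lambda>v. \<tau> v i)" and "\<exists>K. \<forall>k\<ge>K. \<forall>v a. \<tau> (v(k := a)) = \<tau> v"
  shows "dfn R (\<lambda>v. P (\<tau> v))"
  using assms
proof (induction arbitrary: \<tau>)
  case (rel ts r)
  have "tm R (\<lambda>v. t (\<tau> v))" if "tm R t" for t
    by (rule tm_subst[OF that rel.prems(1)])
  then have "dfn R (\<lambda>v. rel_interp R r (map (\<lambda>t. t v) (map (\<lambda>t v. t (\<tau> v)) ts)))"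
    using rel.hyps by (intro dfn.rel) auto
  then show ?case by (simp add: o_def)
next
  case (exi P i)
  then obtain K where K: "\<forall>k\<ge>K. \<forall>v a. \<tau> (v(k := a)) = \<tau> v" by blast
  \<comment> \<open>The bound variable \<open>i\<close> is read from the fresh variable
    \<open>K\<close>. The modified substitution ignores everything from \<open>Suc K\<close> on, so
    the induction hypothesis applies to it.\<close>
  have "dfn R (\<lambda>v. P ((\<tau> v)(i := v K)))"
  proof (rule exi.IH)
    fix j
    show "tm R (\<lambda>v. ((\<tau> v)(i := v K)) j)"
      using exi.prems(1) tm.var[of R K] by (cases "j = i") auto
    show "\<exists>K'. \<forall>k\<ge>K'. \<forall>v a. (\<tau> (v(k := a)))(i := (v(k := a)) K) = (\<tau> v)(i := v K)"
      using K by (intro exI[of _ "Suc K"]) auto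
  qed
  from dfn.exi[OF this, of K] show ?case using K by simp
next
  case (eq s t)
  note tm_subst[OF eq(1) eq(3)] tm_subst[OF eq(2) eq(3)]
  then show ?case by (rule dfn.eq)
next
  case (less s t)
  note tm_subst[OF less(1) less(3)] tm_subst[OF less(2) less(3)]
  then show ?case by (rule dfn.less)
next
  case (neg P)
  note neg.IH[OF neg.prems]
  then show ?case by (rule dfn.neg)
next
  case (conj P Q)
  note conj.IH(1)[OF conj.prems] conj.IH(2)[OF conj.prems]
  then show ?case by (rule dfn.conj)
qed

text \<open>\<open>P\<close> sees only finitely many values of \<open>\<tau>\<close>. Replacing the
  others by 0 yields \<open>\<sigma>\<close>, which depends on finitely many variables and so meets
  the extra assumption of \<open>dfn_subst_aux\<close>.\<close>

lemma dfn_subst: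
  assumes P: "dfn R P" and \<tau>: "\<And>i. tm R (\<lambda>v. \<tau> v i)"
  shows "dfn R (\<lambda>v. P (\<tau> v))"
proof -
  obtain N where N: "supported N P"
    using dfn_finite_support[OF P] by blast
  have "\<forall>i. \<exists>N. supported N (\<lambda>v. \<tau> v i)"
    using tm_finite_support[OF \<tau>] by blast
  then obtain M where M: "\<And>i. supported (M i) (\<lambda>v. \<tau> v i)"
    by metis
  define K where "K = Max (insert 0 (M ` {..<N}))"
  have K: "M i \<le> K" if "i < N" for i
    unfolding K_def using that by (intro Max_ge) auto
  define \<sigma> where "\<sigma> v i = (if i < N then \<tau> v i else 0)" for v i
  have \<sigma>_tm: "tm R (\<lambda>v. \<sigma> v i)" for i
  proof (cases "i < N")
    case True
    then show ?thesis using \<tau>[of i] by (simp add: \<sigma>_def)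
  next
    case False
    then show ?thesis using tm.const[of R 0] by (simp add: \<sigma>_def)
  qed
  have "\<sigma> (v(k := a)) i = \<sigma> v i" if "k \<ge> K" for v k a i
  proof (cases "i < N")
    case True
    then have "\<tau> (v(k := a)) i = \<tau> v i"
      using that K[OF True] by (intro supportedD[OF M]) auto
    then show ?thesis by (simp add: \<sigma>_def)
  qed (simp add: \<sigma>_def)
  then have \<sigma>_fin: "\<exists>K. \<forall>k\<ge>K. \<forall>v a. \<sigma> (v(k := a)) = \<sigma> v"
    by blast
  have "P (\<sigma> v) = P (\<tau> v)" for v
    by (rule supportedD[OF N]) (simp add: \<sigma>_def)
  with dfn_subst_aux[OF P \<sigma>_tm \<sigma>_fin] show ?thesis
    by (rule dfn_cong)
qed

text \<open>The bound variable becomes variable 0 and all others are shifted by one.\<close>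

lemma dfn_ex:
  assumes "dfn R (\<lambda>w. Q (\<lambda>i. w (Suc i)) (w 0))"
  shows "dfn R (\<lambda>v. \<exists>a. Q v a)"
proof -
  obtain N where N: "supported N (\<lambda>w. Q (\<lambda>i. w (Suc i)) (w 0))"
    using dfn_finite_support[OF assms] by blast
  let ?\<tau> = "\<lambda>v i. case i of 0 \<Rightarrow> v N | Suc j \<Rightarrow> v j"
  have *: "dfn R (\<lambda>v. Q (\<lambda>i. ?\<tau> v (Suc i)) (?\<tau> v 0))"
  proof (rule dfn_subst[OF assms, of ?\<tau>])
    show "tm R (\<lambda>v. ?\<tau> v i)" for i
      by (cases i) (simp_all add: tm.var)
  qed
  have eq: "Q (\<lambda>i. ?\<tau> (v(N := a)) (Suc i)) (?\<tau> (v(N := a)) 0) = Q v a" for v a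
    using supportedD[OF N, of "?\<tau> (v(N := a))" "case_nat a v"] by (auto split: nat.split)
  show ?thesis
    by (rule dfn_cong[OF dfn.exi[OF *, of N]], rule arg_cong[of _ _ Ex], rule ext, rule eq)
qed

lemma dfn_const: "dfn R (\<lambda>v. B)"
proof (cases B)
  case True
  then show ?thesis by (intro dfn_cong[OF dfn.eq[OF tm.const[of R 0] tm.const[of R 0]]]) simp
next
  case False
  then show ?thesis by (intro dfn_cong[OF dfn.eq[OF tm.const[of R 0] tm.const[of R 1]]]) simp
qed

lemma dfn_disj:
  assumes "dfn R P" "dfn R Q"
  shows "dfn R (\<lambda>v. P v \<or> Q v)"
  by (rule dfn_cong[OF dfn.neg[OF dfn.conj[OF dfn.neg[OF assms(1)] dfn.neg[OF assms(2)]]]]) simp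

lemma dfn_imp:
  assumes "dfn R P" "dfn R Q"
  shows "dfn R (\<lambda>v. P v \<longrightarrow> Q v)"
  by (rule dfn_cong[OF dfn_disj[OF dfn.neg[OF assms(1)] assms(2)]]) simp

lemma dfn_le:
  assumes "tm R s" "tm R t"
  shows "dfn R (\<lambda>v. s v \<le> t v)"
  by (rule dfn_cong[OF dfn.neg[OF dfn.less[OF assms(2,1)]]]) (simp add: not_less)

lemma dfn_all:
  assumes "dfn R (\<lambda>w. Q (\<lambda>i. w (Suc i)) (w 0))"
  shows "dfn R (\<lambda>v. \<forall>a. Q v a)"
proof -
  note * = dfn_ex[of R "\<lambda>v a. \<not> Q v a", OF dfn.neg[OF assms]]
  show ?thesis by (rule dfn_cong[OF dfn.neg[OF *]]) simp
qed

lemma tm_diff: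
  assumes "tm R s" "tm R t"
  shows "tm R (\<lambda>v. s v - t v)"
  using tm.plus[OF assms(1) tm.uminus[OF assms(2)]] by simp

lemma dfn_abs_less:
  assumes "tm R s" "tm R t"
  shows "dfn R (\<lambda>v. \<bar>s v\<bar> < t v)"
  by (rule dfn_cong[OF dfn.conj[OF dfn.less[OF assms] dfn.less[OF tm.uminus[OF assms(1)] assms(2)]]])
    (simp add: abs_less_iff)

lemma dfn_abs_le:
  assumes "tm R s" "tm R t"
  shows "dfn R (\<lambda>v. \<bar>s v\<bar> \<le> t v)"
  by (rule dfn_cong[OF dfn.conj[OF dfn_le[OF assms] dfn_le[OF tm.uminus[OF assms(1)] assms(2)]]])
    (simp add: abs_le_iff)

lemma dfn_ball_finite:
  assumes "finite A" "\<And>x. x \<in> A \<Longrightarrow> dfn R (P x)"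
  shows "dfn R (\<lambda>v. \<forall>x\<in>A. P x v)"
  using assms
proof (induction A rule: finite_induct)
  case empty
  then show ?case by (simp add: dfn_const)
next
  case (insert x A)
  then show ?case using dfn.conj[of R "P x" "\<lambda>v. \<forall>x\<in>A. P x v"] by simp
qed

lemmas dfn_intros = dfn_ex dfn_all dfn_imp dfn.conj dfn_disj dfn.neg dfn_le dfn.less dfn.eq
  dfn_abs_less dfn_abs_le tm.var tm.const tm.plus tm_diff tm.uminus tm.times dfn_const

definition trunc :: "nat \<Rightarrow> (nat \<Rightarrow> real) \<Rightarrow> nat \<Rightarrow> real" where
  "trunc n v = (\<lambda>i. if i < n then v i else 0)"

lemma tm_if: "(b \<Longrightarrow> tm R s) \<Longrightarrow> (\<not> b \<Longrightarrow> tm R t) \<Longrightarrow> tm R (\<lambda>v. if b then s v else t v)"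
  by (cases b) auto

lemma dfn_ex_vec:
  assumes "dfn R (\<lambda>w. Q (\<lambda>i. w (i + n)) (trunc n w))"
  shows "dfn R (\<lambda>v. \<exists>w. (\<forall>i\<ge>n. w i = 0) \<and> Q v w)"
  using assms
proof (induction n arbitrary: Q)
  case 0
  have "trunc 0 w = (\<lambda>i. 0)" for w by (simp add: trunc_def)
  moreover have "(\<exists>w. (\<forall>i\<ge>0. w i = 0) \<and> Q v w) = Q v (\<lambda>i. 0)" for v
  proof -
    have "(\<forall>i\<ge>0. w i = 0) = (w = (\<lambda>i. 0))" for w :: "nat \<Rightarrow> real" by auto
    then show ?thesis by simp
  qed
  ultimately show ?case using 0 by simp
next
  case (Suc n)
  let ?c = "\<lambda>a w i. case i of 0 \<Rightarrow> a | Suc j \<Rightarrow> w j"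
  have eq: "(\<exists>w. (\<forall>i\<ge>Suc n. w i = 0) \<and> Q v w) =
    (\<exists>a. \<exists>w. (\<forall>i\<ge>n. w i = 0) \<and> Q v (case_nat a w))" for v
  proof
    assume "\<exists>w. (\<forall>i\<ge>Suc n. w i = 0) \<and> Q v w"
    then obtain w where w: "\<forall>i\<ge>Suc n. w i = 0" "Q v w" by blast
    have "case_nat (w 0) (\<lambda>i. w (Suc i)) = w" by (auto split: nat.split)
    then show "\<exists>a. \<exists>w. (\<forall>i\<ge>n. w i = 0) \<and> Q v (case_nat a w)"
      using w by (intro exI[of _ "w 0"] exI[of _ "\<lambda>i. w (Suc i)"]) auto
  next
    assume "\<exists>a. \<exists>w. (\<forall>i\<ge>n. w i = 0) \<and> Q v (case_nat a w)"
    then obtain a w where w: "\<forall>i\<ge>n. w i = 0" "Q v (case_nat a w)" by blast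
    then show "\<exists>w. (\<forall>i\<ge>Suc n. w i = 0) \<and> Q v w"
      by (intro exI[of _ "case_nat a w"]) (auto split: nat.split)
  qed
  have "dfn R (\<lambda>v. \<exists>a. \<exists>w. (\<forall>i\<ge>n. w i = 0) \<and> Q v (case_nat a w))"
  proof (rule dfn_ex, rule Suc.IH)
    \<comment> \<open>The head \<open>a\<close> is quantified outside the remaining \<open>n\<close>
      coordinates and therefore sits at index \<open>n\<close>; \<open>?\<tau>\<close> moves it to
      the front, where the vector expects it.\<close>
    let ?\<tau> = "\<lambda>w i. if i = 0 then w n else if i < Suc n then w (i - 1) else w i"
    have "dfn R (\<lambda>w. Q (\<lambda>i. ?\<tau> w (i + Suc n)) (trunc (Suc n) (?\<tau> w)))"
      by (rule dfn_subst[OF Suc.prems, of ?\<tau>]) (auto intro!: dfn_intros tm_if)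
    moreover have "trunc (Suc n) (?\<tau> w) = case_nat (w n) (trunc n w)" for w
      by (auto simp: trunc_def split: nat.split)
    ultimately show "dfn R (\<lambda>w. Q (\<lambda>i. w (Suc i + n)) (case_nat (w (0 + n)) (trunc n w)))"
      by simp
  qed
  then show ?case unfolding eq .
qed

subsection \<open>Definable predicates and definable sets\<close>

lemma tm_val: "wf_trm R t \<Longrightarrow> tm R (\<lambda>v. val R v t)"
proof (induction t)
  case (Fun f ts)
  have "tm R (\<lambda>v. fun_interp R f (map (\<lambda>t. t v) (map (\<lambda>t v. val R v t) ts)))"
    using Fun by (intro tm.func) auto
  then show ?case by (simp add: o_def)
qed (auto intro: tm.intros)

lemma dfn_sat: "wf_fm R \<phi> \<Longrightarrow> dfn R (\<lambda>v. sat R v \<phi>)"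
proof (induction \<phi>)
  case (Rel r ts)
  have "dfn R (\<lambda>v. rel_interp R r (map (\<lambda>t. t v) (map (\<lambda>t v. val R v t) ts)))"
    using Rel by (intro dfn.rel) (auto intro: tm_val)
  then show ?case by (simp add: o_def)
qed (auto intro!: dfn.intros tm_val)

lemma dfn_definable:
  assumes "definable R n X"
  shows "dfn R (\<lambda>v. trunc n v \<in> X)" "X \<subseteq> {x. \<forall>i\<ge>n. x i = 0}"
proof -
  obtain \<phi> p where \<phi>: "wf_fm R \<phi>"
    and X: "X = {x \<in> topspace (Euclidean_space n). sat R (\<lambda>i. if i < n then x i else p i) \<phi>}"
    using assms unfolding definable_def by blast
  have "dfn R (\<lambda>v. sat R (\<lambda>i. if i < n then v i else p i) \<phi>)"
    by (rule dfn_subst[OF dfn_sat[OF \<phi>], of "\<lambda>v i. if i < n then v i else p i"])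
      (intro tm_if tm.var tm.const)
  moreover have "(trunc n v \<in> X) = sat R (\<lambda>i. if i < n then v i else p i) \<phi>" for v
    by (simp add: X topspace_Euclidean_space trunc_def cong: if_cong)
  ultimately show "dfn R (\<lambda>v. trunc n v \<in> X)" by simp
  show "X \<subseteq> {x. \<forall>i\<ge>n. x i = 0}" by (auto simp: X topspace_Euclidean_space)
qed

section \<open>Renaming of variables and the return from predicates to formulas\<close>

fun ren :: "(nat \<Rightarrow> nat) \<Rightarrow> 'f trm \<Rightarrow> 'f trm" where
  "ren h (Var i) = Var (h i)"
| "ren h Zero = Zero"
| "ren h One = One"
| "ren h (Plus s t) = Plus (ren h s) (ren h t)"
| "ren h (Minus t) = Minus (ren h t)"
| "ren h (Times s t) = Times (ren h s) (ren h t)"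
| "ren h (Fun f ts) = Fun f (map (ren h) ts)"

fun renf :: "(nat \<Rightarrow> nat) \<Rightarrow> ('f, 'r) fm \<Rightarrow> ('f, 'r) fm" where
  "renf h (Eq s t) = Eq (ren h s) (ren h t)"
| "renf h (Less s t) = Less (ren h s) (ren h t)"
| "renf h (Rel r ts) = Rel r (map (ren h) ts)"
| "renf h (Neg \<phi>) = Neg (renf h \<phi>)"
| "renf h (Conj \<phi> \<psi>) = Conj (renf h \<phi>) (renf h \<psi>)"
| "renf h (Exi i \<phi>) = Exi (h i) (renf h \<phi>)"

lemma wf_ren: "wf_trm R t \<Longrightarrow> wf_trm R (ren h t)"
  by (induction t) auto

lemma val_ren: "val R v (ren h t) = val R (v \<circ> h) t"
proof (induction t)
  case (Fun f ts)
  then have "map (val R v \<circ> ren h) ts = map (val R (v \<circ> h)) ts"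
    unfolding map_eq_conv by (metis comp_apply)
  then show ?case by (metis list.map_comp ren.simps(7) val.simps(7))
qed auto

lemma wf_renf: "wf_fm R \<phi> \<Longrightarrow> wf_fm R (renf h \<phi>)"
  by (induction \<phi>) (auto intro: wf_ren)

text \<open>Injectivity ensures that updating the renamed bound variable touches no other
  variable.\<close>

lemma sat_renf:
  assumes "inj h"
  shows "sat R v (renf h \<phi>) = sat R (v \<circ> h) \<phi>"
proof (induction \<phi> arbitrary: v)
  case (Rel r ts)
  have "map (val R v \<circ> ren h) ts = map (val R (v \<circ> h)) ts" by (auto simp: val_ren)
  then show ?case by (metis list.map_comp renf.simps(3) sat.simps(3))
next
  case (Exi i \<phi>)
  have "v(h i := a) \<circ> h = (v \<circ> h)(i := a)" for a
    using assms by (auto simp: inj_def)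
  then show ?case by (simp only: renf.simps sat.simps Exi)
qed (auto simp: val_ren)

text \<open>Even variables are coordinates, odd variables hold parameters.\<close>

definition mix :: "(nat \<Rightarrow> real) \<Rightarrow> (nat \<Rightarrow> real) \<Rightarrow> nat \<Rightarrow> real" where
  "mix v p i = (if even i then v (i div 2) else p (i div 2))"

text \<open>Two formulas with parameter sequences \<open>p\<close> and \<open>q\<close> get the
  common sequence \<open>mix p q\<close>. Parameter \<open>j\<close> of the left formula moves from
  variable 2j + 1 to 4j + 1, that of the right one to 4j + 3; coordinates stay in place.\<close>

definition left_par :: "nat \<Rightarrow> nat" where
  "left_par i = (if even i then i else 2 * (i - 1) + 1)"

definition right_par :: "nat \<Rightarrow> nat" where
  "right_par i = (if even i then i else 2 * i + 1)"

lemma mix_left: "mix v (mix p q) \<circ> left_par = mix v p"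
  by (rule ext) (auto simp: mix_def left_par_def elim!: oddE)

lemma mix_right: "mix v (mix p q) \<circ> right_par = mix v q"
  by (rule ext) (auto simp: mix_def right_par_def elim!: oddE)

lemma val_ren_left: "val R (mix v (mix p q)) (ren left_par u) = val R (mix v p) u"
  by (simp add: val_ren mix_left)

lemma val_ren_right: "val R (mix v (mix p q)) (ren right_par u) = val R (mix v q) u"
  by (simp add: val_ren mix_right)

lemma inj_left: "inj left_par"
  unfolding inj_def left_par_def by (auto elim!: oddE)

lemma inj_right: "inj right_par"
  unfolding inj_def right_par_def by auto

lemma tm_combine:
  assumes "wf_trm R s" "wf_trm R u"
  obtains s' u' r where "wf_trm R s'" "wf_trm R u'"
    "\<And>v. val R (mix v r) s' = val R (mix v p) s" "\<And>v. val R (mix v r) u' = val R (mix v q) u"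
  using assms that[of "ren left_par s" "ren right_par u" "mix p q"]
  by (simp add: wf_ren val_ren_left val_ren_right)

lemma tm_list_formal:
  assumes "\<And>t. t \<in> set ts \<Longrightarrow> \<exists>u p. wf_trm R u \<and> (\<forall>v. t v = val R (mix v p) u)"
  shows "\<exists>us p. (\<forall>u \<in> set us. wf_trm R u) \<and> (\<forall>v. map (\<lambda>t. t v) ts = map (val R (mix v p)) us)"
  using assms
proof (induction ts)
  case Nil
  show ?case by (rule exI[of _ "[]"]) simp
next
  case (Cons t ts)
  obtain u p where u: "wf_trm R u" "\<forall>v. t v = val R (mix v p) u"
    using Cons.prems[of t] by auto
  obtain us q where us: "\<forall>u \<in> set us. wf_trm R u" "\<forall>v. map (\<lambda>t. t v) ts = map (val R (mix v q)) us"
    using Cons by fastforce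
  show ?case
  proof (intro exI conjI)
    show "\<forall>u \<in> set (ren left_par u # map (ren right_par) us). wf_trm R u"
      using u us by (auto intro: wf_ren)
    show "\<forall>v. map (\<lambda>t. t v) (t # ts) = map (val R (mix v (mix p q))) (ren left_par u # map (ren right_par) us)"
      using u us by (simp add: val_ren_left val_ren_right comp_def)
  qed
qed

lemma tm_formal:
  assumes "tm R t"
  shows "\<exists>u p. wf_trm R u \<and> (\<forall>v. t v = val R (mix v p) u)"
  using assms
proof induction
  case (var i)
  show ?case by (rule exI[of _ "Var (2 * i)"]) (simp add: mix_def)
next
  case (const c)
  show ?case by (rule exI[of _ "Var 1"], rule exI[of _ "\<lambda>i. c"]) (simp add: mix_def)
next
  case (plus s t)
  then obtain u p u' q where "wf_trm R u" "\<forall>v. s v = val R (mix v p) u" "wf_trm R u'" "\<forall>v. t v = val R (mix v q) u'"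
    by blast
  then show ?case by (metis tm_combine val.simps(4) wf_trm.simps(4))
next
  case (uminus t)
  then show ?case by (metis val.simps(5) wf_trm.simps(5))
next
  case (times s t)
  then obtain u p u' q where "wf_trm R u" "\<forall>v. s v = val R (mix v p) u" "wf_trm R u'" "\<forall>v. t v = val R (mix v q) u'"
    by blast
  then show ?case by (metis tm_combine val.simps(6) wf_trm.simps(6))
next
  case (func ts f)
  obtain us p where "\<forall>u \<in> set us. wf_trm R u" "\<forall>v. map (\<lambda>t. t v) ts = map (val R (mix v p)) us"
    using tm_list_formal[of ts R] func by blast
  moreover from this have "length us = length ts" by (metis length_map)
  ultimately show ?case using func by (metis val.simps(7) wf_trm.simps(7))
qed

lemma dfn_formal:
  assumes "dfn R P"
  shows "\<exists>\<phi> p. wf_fm R \<phi> \<and> (\<forall>v. P v = sat R (mix v p) \<phi>)"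
  using assms
proof induction
  case (eq s t)
  then obtain u p u' q where "wf_trm R u" "\<forall>v. s v = val R (mix v p) u" "wf_trm R u'" "\<forall>v. t v = val R (mix v q) u'"
    using tm_formal by metis
  then show ?case by (metis tm_combine sat.simps(1) wf_fm.simps(1))
next
  case (less s t)
  then obtain u p u' q where "wf_trm R u" "\<forall>v. s v = val R (mix v p) u" "wf_trm R u'" "\<forall>v. t v = val R (mix v q) u'"
    using tm_formal by metis
  then show ?case by (metis tm_combine sat.simps(2) wf_fm.simps(2))
next
  case (rel ts r)
  obtain us p where "\<forall>u \<in> set us. wf_trm R u" "\<forall>v. map (\<lambda>t. t v) ts = map (val R (mix v p)) us"
    using tm_list_formal[of ts R] tm_formal rel by blast
  moreover from this have "length us = length ts" by (metis length_map)
  ultimately show ?case using rel by (metis sat.simps(3) wf_fm.simps(3))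
next
  case (neg P)
  then show ?case by (metis sat.simps(4) wf_fm.simps(4))
next
  case (conj P Q)
  then obtain \<phi> p \<psi> q where *: "wf_fm R \<phi>" "\<forall>v. P v = sat R (mix v p) \<phi>" "wf_fm R \<psi>" "\<forall>v. Q v = sat R (mix v q) \<psi>"
    by blast
  show ?case
    by (rule exI[of _ "Conj (renf left_par \<phi>) (renf right_par \<psi>)"], rule exI[of _ "mix p q"])
      (simp add: * wf_renf sat_renf inj_left inj_right mix_left mix_right)
next
  case (exi P i)
  then obtain \<phi> p where *: "wf_fm R \<phi>" "\<forall>v. P v = sat R (mix v p) \<phi>" by blast
  have "(mix v p)(2 * i := a) = mix (v(i := a)) p" for v a
    by (rule ext) (auto simp: mix_def)
  then show ?case by (intro exI[of _ "Exi (2 * i) \<phi>"] exI[of _ p]) (simp add: *)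
qed

lemma definable_dfn:
  assumes "dfn R P"
  shows "definable R n {x. (\<forall>i\<ge>n. x i = 0) \<and> P x}"
proof -
  obtain \<phi> p where \<phi>: "wf_fm R \<phi>" "\<And>v. P v = sat R (mix v p) \<phi>"
    using dfn_formal[OF assms] by blast
  \<comment> \<open>The even variables of the first \<open>n\<close> coordinates return to 0, ..., n
    - 1, and everything else moves beyond them. There \<open>p'\<close> holds 0 for coordinates from
    \<open>n\<close> on, which vanish on the space, and the old parameters at the odd
    places.\<close>
  define h where "h j = (if even j \<and> j div 2 < n then j div 2 else n + j)" for j :: nat
  define p' where "p' i = (if even (i - n) then 0 else p ((i - n) div 2))" for i
  have "inj h" unfolding inj_def h_def by (auto elim!: evenE)
  have "(\<lambda>i. if i < n then x i else p' i) \<circ> h = mix x p" if "\<forall>i\<ge>n. x i = 0" for x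
    by (rule ext) (use that in \<open>auto simp: h_def p'_def mix_def\<close>)
  then have "{x. (\<forall>i\<ge>n. x i = 0) \<and> P x} =
    {x \<in> topspace (Euclidean_space n). sat R (\<lambda>i. if i < n then x i else p' i) (renf h \<phi>)}"
    by (auto simp: topspace_Euclidean_space sat_renf[OF \<open>inj h\<close>] \<phi>(2))
  then show ?thesis
    unfolding definable_def using wf_renf[OF \<phi>(1)] by blast
qed

subsection \<open>Separated families and subsets of the line\<close>

lemma dfn_subst1:
  assumes "dfn R (\<lambda>v. Q (v 0))" "tm R s"
  shows "dfn R (\<lambda>v. Q (s v))"
  by (rule dfn_subst[OF assms(1), of "\<lambda>v i. s v"]) (rule assms(2))

lemma dfn_subst2:
  assumes "dfn R (\<lambda>v. Q (v 0) (v 1))" "tm R s" "tm R t"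
  shows "dfn R (\<lambda>v. Q (s v) (t v))"
proof -
  have "tm R (\<lambda>v. if i = 0 then s v else t v)" for i :: nat
    using assms(2,3) by (intro tm_if)
  from dfn_subst[OF assms(1), of "\<lambda>v i. if i = 0 then s v else t v", OF this]
  show ?thesis by simp
qed

lemma continuous_on_coordinate [continuous_intros]:
  "continuous_on A (\<lambda>x :: nat \<Rightarrow> real. x i)"
  by (rule continuous_on_subset[OF continuous_on_product_coordinates]) simp

text \<open>\<open>G t e\<close> reads: \<open>t\<close> is visible at scale \<open>e\<close>.
  Closure under smaller scales and under increasing limits, with the bound 1, makes a largest scale
  exist. Points visible at a common scale are separated by it, although the family as a whole may
  accumulate.\<close>

definition gauge_family :: "('f, 'r) expansion \<Rightarrow> (real \<Rightarrow> real \<Rightarrow> bool) \<Rightarrow> bool" where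
  "gauge_family R G \<longleftrightarrow> dfn R (\<lambda>v. G (v 0) (v 1)) \<and> (\<forall>t e. G t e \<longrightarrow> 0 < e \<and> e \<le> 1)
    \<and> (\<forall>t e e'. G t e \<and> 0 < e' \<and> e' \<le> e \<longrightarrow> G t e')
    \<and> (\<forall>t e. 0 < e \<and> e \<le> 1 \<and> (\<forall>e'. 0 < e' \<and> e' < e \<longrightarrow> G t e') \<longrightarrow> G t e)
    \<and> (\<forall>t t' e. G t e \<and> G t' e \<and> t \<noteq> t' \<longrightarrow> e \<le> \<bar>t - t'\<bar>)"

definition max_gauge :: "(real \<Rightarrow> real \<Rightarrow> bool) \<Rightarrow> real \<Rightarrow> real \<Rightarrow> bool" where
  "max_gauge G t e \<longleftrightarrow> G t e \<and> (\<forall>e'. G t e' \<longrightarrow> e' \<le> e)"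

lemma gauge_familyD:
  assumes "gauge_family R G"
  shows "dfn R (\<lambda>v. G (v 0) (v 1))"
    and "G t e \<Longrightarrow> 0 < e" and "G t e \<Longrightarrow> e \<le> 1"
    and "G t e \<Longrightarrow> 0 < e' \<Longrightarrow> e' \<le> e \<Longrightarrow> G t e'"
    and "0 < e \<Longrightarrow> e \<le> 1 \<Longrightarrow> (\<And>e'. 0 < e' \<Longrightarrow> e' < e \<Longrightarrow> G t e') \<Longrightarrow> G t e"
    and "G t e \<Longrightarrow> G t' e \<Longrightarrow> t \<noteq> t' \<Longrightarrow> e \<le> \<bar>t - t'\<bar>"
  using assms unfolding gauge_family_def by blast+

lemma max_gauge_exists:
  assumes G: "gauge_family R G" and "G t e"
  shows "\<exists>e. max_gauge G t e"
proof -
  define s where "s = Sup {e. G t e}"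
  have bdd: "bdd_above {e. G t e}"
    by (rule bdd_aboveI[of _ 1]) (simp add: gauge_familyD(3)[OF G])
  have s: "e' \<le> s" if "G t e'" for e'
    unfolding s_def by (rule cSup_upper[OF _ bdd]) (simp add: that)
  have "0 < s" using s[OF \<open>G t e\<close>] gauge_familyD(2)[OF G \<open>G t e\<close>] by simp
  moreover have "s \<le> 1" unfolding s_def
    by (rule cSup_least) (use \<open>G t e\<close> gauge_familyD(3)[OF G] in auto)
  moreover have "G t e'" if "0 < e'" "e' < s" for e'
  proof -
    have "{e. G t e} \<noteq> {}" using \<open>G t e\<close> by blast
    then obtain e'' where "e'' \<in> {e. G t e}" "e' < e''"
      using less_cSup_iff[OF _ bdd] \<open>e' < s\<close> unfolding s_def by blast
    then show ?thesis using gauge_familyD(4)[OF G _ \<open>0 < e'\<close>, of t e''] by simp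
  qed
  ultimately have "G t s" by (rule gauge_familyD(5)[OF G])
  then show ?thesis unfolding max_gauge_def using s by blast
qed

lemma max_gauge_pos: "gauge_family R G \<Longrightarrow> max_gauge G t e \<Longrightarrow> 0 < e"
  unfolding max_gauge_def by (blast dest: gauge_familyD(2))

text \<open>Both points are visible at scale \<open>e / 2\<close>, so they cannot be closer than
  that unless equal. The two inequalities describe an open neighbourhood of (t, e) in the plane that
  contains no other pair.\<close>

lemma max_gauge_isolated:
  assumes G: "gauge_family R G" and "max_gauge G t e" "max_gauge G t' e'"
    and "\<bar>t' - t\<bar> < e / 2" "e / 2 < e'"
  shows "t' = t" "e' = e"
proof -
  have "0 < e" by (rule max_gauge_pos[OF assms(1,2)])
  have "G t e" "G t' e'" using assms unfolding max_gauge_def by auto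
  then have h: "G t (e / 2)" "G t' (e / 2)"
    using \<open>0 < e\<close> assms(5) gauge_familyD(4)[OF G, of t e "e / 2"] gauge_familyD(4)[OF G, of t' e' "e / 2"]
    by simp_all
  from gauge_familyD(6)[OF G this] show "t' = t"
    using assms(4) by (cases "t = t'") (auto simp: abs_minus_commute)
  then have "e' \<le> e" "e \<le> e'" using assms(2,3) unfolding max_gauge_def by auto
  then show "e' = e" by simp
qed

lemma dfn_max_gauge:
  assumes "gauge_family R G" "tm R s" "tm R t"
  shows "dfn R (\<lambda>v. max_gauge G (s v) (t v))"
proof -
  note G = gauge_familyD(1)[OF assms(1)]
  have "dfn R (\<lambda>v. G (v 0) (v 1) \<and> (\<forall>e'. G (v 0) e' \<longrightarrow> e' \<le> v 1))"
    by (intro dfn_intros G dfn_subst2[OF G])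
  then have "dfn R (\<lambda>v. max_gauge G (v 0) (v 1))" unfolding max_gauge_def .
  then show ?thesis using assms(2,3) by (rule dfn_subst2)
qed

text \<open>Pairing a point with its maximal gauge makes the family discrete in the plane, so that
  restrainedness applies to its projection.\<close>

lemma restrained_gauge_family:
  assumes R: "restrained R" and G: "gauge_family R G" and H: "gauge_family R H"
  shows "interior (closure {s + a * t |s t. (\<exists>e. G s e) \<and> (\<exists>e. H t e)}) = {}"
proof -
  \<comment> \<open>Coordinates 0 and 2 carry the two points, 1 and 3 their maximal gauges; the
    product of two discrete sets is discrete in dimension 4.\<close>
  define E where "E = {x :: nat \<Rightarrow> real. (\<forall>i\<ge>4. x i = 0) \<and> max_gauge G (x 0) (x 1) \<and> max_gauge H (x 2) (x 3)}"
  define g where "g x = x 0 + a * x 2" for x :: "nat \<Rightarrow> real"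
  have E: "definable R 4 E"
    unfolding E_def by (intro definable_dfn dfn_intros dfn_max_gauge[OF G] dfn_max_gauge[OF H])
  have "(\<lambda>x. x(4 := g x)) ` E =
    {x. (\<forall>i\<ge>5. x i = 0) \<and> (max_gauge G (x 0) (x 1) \<and> max_gauge H (x 2) (x 3)) \<and> x 4 = x 0 + a * x 2}"
    (is "?L = ?R")
  proof
    show "?L \<subseteq> ?R" by (auto simp: E_def g_def)
    show "?R \<subseteq> ?L"
    proof
      fix x assume x: "x \<in> ?R"
      show "x \<in> ?L"
      proof (rule image_eqI)
        show "x = (x(4 := 0))(4 := g (x(4 := 0)))" using x by (auto simp: g_def fun_eq_iff)
        show "x(4 := 0) \<in> E" using x by (auto simp: E_def)
      qed
    qed
  qed
  moreover have "definable R 5 ?R"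
    by (intro definable_dfn dfn_intros dfn_max_gauge[OF G] dfn_max_gauge[OF H])
  ultimately have g: "definable_fun R 4 E g"
    unfolding definable_fun_def using E by (simp add: eval_nat_numeral)
  have "openin (subtopology (Euclidean_space 4) E) {x}" if x: "x \<in> E" for x
  proof -
    define U where "U = {y :: nat \<Rightarrow> real. \<bar>y 0 - x 0\<bar> < x 1 / 2 \<and> x 1 / 2 < y 1 \<and>
      \<bar>y 2 - x 2\<bar> < x 3 / 2 \<and> x 3 / 2 < y 3}"
    have "open U" unfolding U_def
      by (intro open_Collect_conj open_Collect_less continuous_intros)
    have eq: "y = x" if "y \<in> E" "y \<in> U" for y
    proof
      fix i :: nat
      have "y 0 = x 0" "y 1 = x 1"
        using max_gauge_isolated[OF G, of "x 0" "x 1" "y 0" "y 1"] that x by (auto simp: E_def U_def)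
      moreover have "y 2 = x 2" "y 3 = x 3"
        using max_gauge_isolated[OF H, of "x 2" "x 3" "y 2" "y 3"] that x by (auto simp: E_def U_def)
      moreover have "i = 0 \<or> i = 1 \<or> i = 2 \<or> i = 3 \<or> 4 \<le> i" by arith
      moreover have "4 \<le> i \<Longrightarrow> y i = 0 \<and> x i = 0"
        using that x by (simp add: E_def)
      ultimately show "y i = x i" by metis
    qed
    have "x \<in> U"
      using x max_gauge_pos[OF G, of "x 0" "x 1"] max_gauge_pos[OF H, of "x 2" "x 3"]
      by (simp add: E_def U_def)
    moreover have "E \<subseteq> {x. \<forall>i\<ge>4. x i = 0}" by (auto simp: E_def)
    ultimately have "{x} = ({x. \<forall>i\<ge>4. x i = 0} \<inter> E) \<inter> U" using x eq by blast
    then show ?thesis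
      unfolding Euclidean_space_def subtopology_subtopology euclidean_product_topology
      by (simp only: openin_open_Int[OF \<open>open U\<close>])
  qed
  moreover have "topspace (subtopology (Euclidean_space 4) E) = E"
    by (auto simp: topspace_Euclidean_space E_def)
  ultimately have "discrete_topology E = subtopology (Euclidean_space 4) E"
    unfolding discrete_topology_unique by blast
  then have "nowhere_dense_in euclideanreal (g ` E)"
    using R[unfolded restrained_def, rule_format, of 4 E g] E g by simp
  then have 1: "interior (closure (g ` E)) = {}"
    unfolding nowhere_dense_in_def by simp
  have "{s + a * t |s t. (\<exists>e. G s e) \<and> (\<exists>e. H t e)} \<subseteq> g ` E"
  proof clarify
    fix s t e e' assume "G s e" "H t e'"
    obtain d where d1: "max_gauge G s d" using max_gauge_exists[OF G \<open>G s e\<close>] by blast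
    obtain d' where d2: "max_gauge H t d'" using max_gauge_exists[OF H \<open>H t e'\<close>] by blast
    let ?x = "(\<lambda>i. 0)(0 := s, 1 := d, 2 := t, 3 := d')"
    show "s + a * t \<in> g ` E"
    proof (rule image_eqI)
      show "?x \<in> E" using d1 d2 by (auto simp: E_def)
      show "s + a * t = g ?x" by (simp add: g_def)
    qed
  qed
  from interior_mono[OF closure_mono[OF this]] show ?thesis by (simp only: 1 subset_empty)
qed

text \<open>As \<open>A\<close> contains no interval, it misses some \<open>z\<close> just after
  \<open>x\<close>. The last point \<open>p\<close> of \<open>A\<close> before \<open>z\<close> is
  the left end of a gap reaching at least to \<open>z\<close>.\<close>

lemma closed_gap_point:
  fixes A :: "real set"
  assumes "closed A" "interior A = {}" "x \<in> A" "0 < h"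
  obtains p e where "p \<in> A" "x \<le> p" "p < x + h" "0 < e" "e \<le> 1" "\<And>s. p < s \<Longrightarrow> s < p + e \<Longrightarrow> s \<notin> A"
proof -
  have "\<not> {x<..<x + h} \<subseteq> A"
    using assms(2,4) by (metis interior_maximal open_greaterThanLessThan subset_empty greaterThanLessThan_empty_iff not_le less_add_same_cancel1)
  then obtain z where z: "x < z" "z < x + h" "z \<notin> A"
    by (meson greaterThanLessThan_iff subsetI)
  have "compact (A \<inter> {x..z})" using assms(1) by (simp add: closed_Int_compact)
  moreover have "A \<inter> {x..z} \<noteq> {}" using assms(3) z by auto
  ultimately obtain p where p: "p \<in> A \<inter> {x..z}" "\<And>t. t \<in> A \<inter> {x..z} \<Longrightarrow> t \<le> p"
    using compact_attains_sup by metis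
  show ?thesis
  proof (rule that[of p "min 1 (z - p)"])
    show "0 < min 1 (z - p)" using p z by (cases "p = z") auto
    show "s \<notin> A" if "p < s" "s < p + min 1 (z - p)" for s
    proof -
      have "s < z" using that by linarith
      then show ?thesis using p(2)[of s] p(1) that(1) by auto
    qed
  qed (use p z in auto)
qed

text \<open>Separation holds because the later of two left endpoints must lie beyond the gap that
  follows the earlier one.\<close>

lemma gauge_family_gap:
  assumes A: "dfn R (\<lambda>v. v 0 \<in> A)"
  shows "gauge_family R (\<lambda>t e. t \<in> A \<and> 0 < e \<and> e \<le> 1 \<and> (\<forall>s. t < s \<and> s < t + e \<longrightarrow> s \<notin> A))"
  unfolding gauge_family_def
proof (intro conjI allI impI)
  show "dfn R (\<lambda>v. v 0 \<in> A \<and> 0 < v 1 \<and> v 1 \<le> 1 \<and> (\<forall>s. v 0 < s \<and> s < v 0 + v 1 \<longrightarrow> s \<notin> A))"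
    by (intro dfn_intros A dfn_subst1[OF A])
next
  fix t e s assume *: "0 < e \<and> e \<le> 1 \<and> (\<forall>e'. 0 < e' \<and> e' < e \<longrightarrow>
    t \<in> A \<and> 0 < e' \<and> e' \<le> 1 \<and> (\<forall>s. t < s \<and> s < t + e' \<longrightarrow> s \<notin> A))"
  then have "0 < e / 2 \<and> e / 2 < e" by auto
  then show "t \<in> A" using * by blast
  assume s: "t < s \<and> s < t + e"
  then have "0 < (s - t + e) / 2 \<and> (s - t + e) / 2 < e" "s < t + (s - t + e) / 2" by (auto simp: field_simps)
  then show "s \<notin> A" using * s by blast
next
  fix t t' e
  assume "(t \<in> A \<and> 0 < e \<and> e \<le> 1 \<and> (\<forall>s. t < s \<and> s < t + e \<longrightarrow> s \<notin> A)) \<and>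
       (t' \<in> A \<and> 0 < e \<and> e \<le> 1 \<and> (\<forall>s. t' < s \<and> s < t' + e \<longrightarrow> s \<notin> A)) \<and> t \<noteq> t'"
  then show "e \<le> \<bar>t - t'\<bar>" by (smt (verit))
qed auto

text \<open>Left endpoints of gaps are dense in \<open>A\<close> and in \<open>B\<close>, so all of
  A + a B lies in the closure of the sums that \<open>restrained_gauge_family\<close>
  controls.\<close>

lemma restrained_linear_image:
  fixes A B :: "real set"
  assumes R: "restrained R" and A: "closed A" "dfn R (\<lambda>v. v 0 \<in> A)" "interior A = {}"
    and B: "closed B" "dfn R (\<lambda>v. v 0 \<in> B)" "interior B = {}"
  shows "interior {x + a * y |x y. x \<in> A \<and> y \<in> B} = {}"
proof -
  let ?G = "\<lambda>A t e. t \<in> A \<and> 0 < e \<and> e \<le> 1 \<and> (\<forall>s. t < s \<and> s < t + e \<longrightarrow> s \<notin> A)"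
  let ?S = "{s + a * t |s t. (\<exists>e. ?G A s e) \<and> (\<exists>e. ?G B t e)}"
  have "{x + a * y |x y. x \<in> A \<and> y \<in> B} \<subseteq> closure ?S"
  proof clarify
    fix x y assume "x \<in> A" "y \<in> B"
    show "x + a * y \<in> closure ?S"
      unfolding closure_approachable
    proof (intro allI impI)
      fix h :: real assume "0 < h"
      \<comment> \<open>Chosen so that an error \<open>h'\<close> in both summands causes an error
        of at most (1 + \<bar>a\<bar>) h' = h / 2 in the sum.\<close>
      define h' where "h' = h / (2 * (1 + \<bar>a\<bar>))"
      have "0 < h'" using \<open>0 < h\<close> by (simp add: h'_def add_pos_nonneg)
      obtain p e where p: "p \<in> A" "x \<le> p" "p < x + h'" "0 < e" "e \<le> 1" "\<And>s. p < s \<Longrightarrow> s < p + e \<Longrightarrow> s \<notin> A"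
        using closed_gap_point[OF A(1,3) \<open>x \<in> A\<close> \<open>0 < h'\<close>] by metis
      obtain q d where q: "q \<in> B" "y \<le> q" "q < y + h'" "0 < d" "d \<le> 1" "\<And>s. q < s \<Longrightarrow> s < q + d \<Longrightarrow> s \<notin> B"
        using closed_gap_point[OF B(1,3) \<open>y \<in> B\<close> \<open>0 < h'\<close>] by metis
      have "\<bar>(p + a * q) - (x + a * y)\<bar> = \<bar>(p - x) + a * (q - y)\<bar>" by (simp add: algebra_simps)
      also have "\<dots> \<le> \<bar>p - x\<bar> + \<bar>a\<bar> * \<bar>q - y\<bar>" by (metis abs_mult abs_triangle_ineq)
      also have "\<dots> \<le> h' + \<bar>a\<bar> * h'" using p q by (intro add_mono mult_left_mono) auto
      also have "\<dots> = (1 + \<bar>a\<bar>) * h'" by (simp add: algebra_simps)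
      also have "\<dots> = h / 2" unfolding h'_def using abs_ge_zero[of a] by (simp add: field_simps add_nonneg_eq_0_iff)
      also have "\<dots> < h" using \<open>0 < h\<close> by simp
      finally have "dist (p + a * q) (x + a * y) < h" by (simp add: dist_real_def)
      moreover have "p + a * q \<in> ?S" using p q by blast
      ultimately show "\<exists>z\<in>?S. dist z (x + a * y) < h" by blast
    qed
  qed
  from interior_mono[OF this] show ?thesis
    by (simp only: restrained_gauge_family[OF R gauge_family_gap[OF A(2)] gauge_family_gap[OF B(2)]]
        subset_empty)
qed

text \<open>The lexicographically first points of \<open>P\<close> over a neighbourhood form a separated family; they
  are dense in the projection, because its complement is dense.\<close>

lemma gauge_family_lex:
  fixes P :: "(real \<times> real) set"
  assumes P: "dfn R (\<lambda>v. (v 0, v 1) \<in> P)"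
  shows "gauge_family R (\<lambda>t e. 0 < e \<and> e \<le> 1 \<and> (\<exists>r. (r, t) \<in> P \<and>
    (\<forall>r' t'. (r', t') \<in> P \<and> \<bar>t' - t\<bar> < e \<longrightarrow> r < r' \<or> r = r' \<and> t \<le> t')))"
    (is "gauge_family R ?G")
  unfolding gauge_family_def
proof (intro conjI)
  note P' = dfn_subst2[of R "\<lambda>r t. (r, t) \<in> P", OF P]
  show "dfn R (\<lambda>v. ?G (v 0) (v 1))"
    by (intro dfn_intros P')
  show "\<forall>t e. ?G t e \<longrightarrow> 0 < e \<and> e \<le> 1" by blast
  show "\<forall>t e e'. ?G t e \<and> 0 < e' \<and> e' \<le> e \<longrightarrow> ?G t e'"
    by (meson order_less_le_trans order_trans)
  show "\<forall>t e. 0 < e \<and> e \<le> 1 \<and> (\<forall>e'. 0 < e' \<and> e' < e \<longrightarrow> ?G t e') \<longrightarrow> ?G t e"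
  proof (intro allI impI)
    fix t e assume *: "0 < e \<and> e \<le> 1 \<and> (\<forall>e'. 0 < e' \<and> e' < e \<longrightarrow> ?G t e')"
    define F where "F r e \<longleftrightarrow> (r, t) \<in> P \<and>
      (\<forall>r' t'. (r', t') \<in> P \<and> \<bar>t' - t\<bar> < e \<longrightarrow> r < r' \<or> r = r' \<and> t \<le> t')" for r e
    have FG: "\<exists>r. F r e'" if "0 < e'" "e' < e" for e'
      using * that unfolding F_def by blast
    \<comment> \<open>The first coordinate \<open>r\<close> might depend on the scale. It does not:
      \<open>t\<close> itself competes in the minimum at every scale, so the values for two scales
      bound each other.\<close>
    have F_le: "r \<le> r'" if "F r e1" "0 < e1" "F r' e2" for r r' e1 e2
      using that unfolding F_def by force
    obtain r where r: "F r (e / 2)" using FG[of "e / 2"] * by auto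
    have "r < r' \<or> r = r' \<and> t \<le> t'" if "(r', t') \<in> P" "\<bar>t' - t\<bar> < e" for r' t'
    proof -
      let ?d = "(\<bar>t' - t\<bar> + e) / 2"
      have d: "0 < ?d" "?d < e" "\<bar>t' - t\<bar> < ?d" using that * by auto
      then obtain r2 where r2: "F r2 ?d" using FG by blast
      have "r = r2" using F_le[OF r _ r2] F_le[OF r2 d(1) r] * by fastforce
      then show ?thesis using r2 that(1) d(3) unfolding F_def by blast
    qed
    moreover have "(r, t) \<in> P" using r unfolding F_def by blast
    ultimately show "?G t e" using * by blast
  qed
  show "\<forall>t t' e. ?G t e \<and> ?G t' e \<and> t \<noteq> t' \<longrightarrow> e \<le> \<bar>t - t'\<bar>"
  proof (intro allI impI)
    fix t t' e assume *: "?G t e \<and> ?G t' e \<and> t \<noteq> t'"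
    then obtain r r' where "(r, t) \<in> P" "(r', t') \<in> P"
      "\<forall>r' t'. (r', t') \<in> P \<and> \<bar>t' - t\<bar> < e \<longrightarrow> r < r' \<or> r = r' \<and> t \<le> t'"
      "\<forall>r t. (r, t) \<in> P \<and> \<bar>t - t'\<bar> < e \<longrightarrow> r' < r \<or> r' = r \<and> t' \<le> t" by blast
    then show "e \<le> \<bar>t - t'\<bar>" using * by (smt (verit))
  qed
qed

text \<open>The bound \<bar>t\<bar> \<le> r makes the part of \<open>P\<close> below any height
  compact, so lexicographic minima over closed intervals exist. Gaps of the projection on both sides
  of a point keep such a minimum in the open interval, where it belongs to the family of
  \<open>gauge_family_lex\<close>.\<close>

lemma strong_Baire_line:
  fixes P :: "(real \<times> real) set"
  assumes R: "restrained R" and P: "dfn R (\<lambda>v. (v 0, v 1) \<in> P)" "closed P"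
    and bnd: "\<And>r t. (r, t) \<in> P \<Longrightarrow> \<bar>t\<bar> \<le> r"
    and "interior (snd ` P) = {}"
  shows "interior (closure (snd ` P)) = {}"
proof -
  let ?G = "\<lambda>t e. 0 < e \<and> e \<le> 1 \<and> (\<exists>r. (r, t) \<in> P \<and>
    (\<forall>r' t'. (r', t') \<in> P \<and> \<bar>t' - t\<bar> < e \<longrightarrow> r < r' \<or> r = r' \<and> t \<le> t'))"
  have gap: "\<exists>z. z \<notin> snd ` P \<and> c < z \<and> z < d" if "c < d" for c d
  proof -
    have "\<not> {c<..<d} \<subseteq> snd ` P"
      using assms(5) that by (metis interior_maximal open_greaterThanLessThan subset_empty greaterThanLessThan_empty_iff not_le)
    then show ?thesis by auto
  qed
  have "snd ` P \<subseteq> closure {t. \<exists>e. ?G t e}"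
  proof
    fix x assume "x \<in> snd ` P"
    then obtain r0 where r0: "(r0, x) \<in> P" by auto
    show "x \<in> closure {t. \<exists>e. ?G t e}"
      unfolding closure_approachable
    proof (intro allI impI)
      fix h :: real assume "0 < h"
      obtain c where c: "c \<notin> snd ` P" "x - h < c" "c < x" using gap[of "x - h" x] \<open>0 < h\<close> by auto
      obtain d where d: "d \<notin> snd ` P" "x < d" "d < x + h" using gap[of x "x + h"] \<open>0 < h\<close> by auto
      \<comment> \<open>Points above height \<open>r0\<close> lose against the minimum
        \<open>r1 \<le> r0\<close> and may be discarded; \<open>{0..r0}\<close> is no loss since
        heights are nonnegative.\<close>
      let ?Q = "P \<inter> ({0..r0} \<times> {c..d})"
      have "compact ?Q" using P(2) by (intro closed_Int_compact compact_Times) auto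
      then have "compact (fst ` ?Q)" by (intro compact_continuous_image continuous_intros)
      moreover have x: "(r0, x) \<in> ?Q" using r0 bnd[OF r0] c d by auto
      ultimately obtain r1 where r1: "r1 \<in> fst ` ?Q" "\<And>r. r \<in> fst ` ?Q \<Longrightarrow> r1 \<le> r"
        using compact_attains_inf[of "fst ` ?Q"] by blast
      have "compact (snd ` (?Q \<inter> ({r1} \<times> UNIV)))"
        using compact_Int_closed[OF \<open>compact ?Q\<close> closed_Times[OF closed_singleton closed_UNIV]]
        by (intro compact_continuous_image continuous_intros)
      moreover have "snd ` (?Q \<inter> ({r1} \<times> UNIV)) \<noteq> {}" using r1(1) by force
      ultimately obtain t1 where t1: "t1 \<in> snd ` (?Q \<inter> ({r1} \<times> UNIV))"
        "\<And>t. t \<in> snd ` (?Q \<inter> ({r1} \<times> UNIV)) \<Longrightarrow> t1 \<le> t"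
        using compact_attains_inf[of "snd ` (?Q \<inter> ({r1} \<times> UNIV))"] by blast
      have t1P: "(r1, t1) \<in> P" "c \<le> t1" "t1 \<le> d" "r1 \<le> r0" using t1(1) by auto
      moreover have "t1 \<in> snd ` P" using t1P(1) by force
      ultimately have t1cd: "c < t1" "t1 < d" using c d by (metis order_le_less)+
      have "r1 < r' \<or> r1 = r' \<and> t1 \<le> t'"
        if "(r', t') \<in> P" "\<bar>t' - t1\<bar> < min 1 (min (t1 - c) (d - t1))" for r' t'
      proof (cases "r' \<le> r0")
        case True
        then have "(r', t') \<in> ?Q" using that bnd[OF that(1)] by auto
        moreover from this have "r1 \<le> r'" using r1(2) by force
        ultimately show ?thesis using t1(2)[of t'] by force
      next
        case False
        then show ?thesis using t1P by auto
      qed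
      then have "?G t1 (min 1 (min (t1 - c) (d - t1)))" using t1P t1cd by auto
      moreover have "dist t1 x < h" using t1cd c d by (auto simp: dist_real_def)
      ultimately show "\<exists>y\<in>{t. \<exists>e. ?G t e}. dist y x < h" by blast
    qed
  qed
  \<comment> \<open>The second summand has coefficient 0. It is taken from the same family, so it
    exists whenever the first does.\<close>
  moreover have "{t. \<exists>e. ?G t e} = {s + 0 * t |s t. (\<exists>e. ?G s e) \<and> (\<exists>e. ?G t e)}" by auto
  ultimately have "closure (snd ` P) \<subseteq> closure {s + 0 * t |s t. (\<exists>e. ?G s e) \<and> (\<exists>e. ?G t e)}"
    by (simp only: closure_minimal closed_closure)
  from interior_mono[OF this] show ?thesis
    by (simp only: restrained_gauge_family[OF R gauge_family_lex[OF P(1)] gauge_family_lex[OF P(1)]]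
        subset_empty)
qed

subsection \<open>Coordinate projections of compact sets\<close>

text \<open>A cylinder: coordinates outside \<open>I\<close> are free, so interior in the full
  product space means interior of the projection to \<open>I\<close>.\<close>

definition proj :: "nat set \<Rightarrow> (nat \<Rightarrow> real) set \<Rightarrow> (nat \<Rightarrow> real) set" where
  "proj I W = {v. \<exists>w\<in>W. \<forall>i\<in>I. w i = v i}"

definition fibre :: "nat set \<Rightarrow> nat \<Rightarrow> (nat \<Rightarrow> real) set \<Rightarrow> (nat \<Rightarrow> real) \<Rightarrow> real set" where
  "fibre u i W v = {w i |w. w \<in> W \<and> (\<forall>j\<in>u. w j = v j)}"

text \<open>Topological dimension at most \<open>d\<close>. The test is confined to
  \<open>Suc d\<close> coordinates because projections to more coordinates map onto these
  (\<open>smallD\<close>), and it does not mention the ambient dimension.\<close>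

definition small :: "nat \<Rightarrow> (nat \<Rightarrow> real) set \<Rightarrow> bool" where
  "small d W \<longleftrightarrow> (\<forall>I. finite I \<and> card I = Suc d \<longrightarrow> interior (proj I W) = {})"

definition dset :: "('f, 'r) expansion \<Rightarrow> nat \<Rightarrow> (nat \<Rightarrow> real) set \<Rightarrow> bool" where
  "dset R M W \<longleftrightarrow> (\<forall>w\<in>W. \<forall>i\<ge>M. w i = 0) \<and> dfn R (\<lambda>v. trunc M v \<in> W)"

lemma trunc_id: "\<forall>i\<ge>M. w i = 0 \<Longrightarrow> trunc M w = w"
  by (rule ext) (simp add: trunc_def)

lemma tm_trunc: "tm R (\<lambda>v. \<tau> v i) \<Longrightarrow> tm R (\<lambda>v. trunc M (\<tau> v) i)"
  unfolding trunc_def by (intro tm_if tm.const)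

lemma dset_mem:
  assumes "dset R M W" "\<And>i. tm R (\<lambda>v. \<tau> v i)"
  shows "dfn R (\<lambda>v. trunc M (\<tau> v) \<in> W)"
proof -
  have "dfn R (\<lambda>v. trunc M v \<in> W)" using assms(1) by (simp add: dset_def)
  from dfn_subst[OF this, of \<tau>, OF assms(2)] show ?thesis .
qed

lemma dset_ex:
  assumes W: "dset R M W" and Q: "dfn R (\<lambda>w. Q (\<lambda>i. w (i + M)) (trunc M w))"
  shows "dfn R (\<lambda>v. \<exists>w\<in>W. Q v w)"
proof -
  have t: "trunc M w = w" if "w \<in> W" for w
    using W that by (intro trunc_id) (simp add: dset_def)
  have "trunc M (trunc M w) = trunc M w" for w by (simp add: trunc_def fun_eq_iff)
  then have "dfn R (\<lambda>w. trunc M (trunc M w) \<in> W \<and> Q (\<lambda>i. w (i + M)) (trunc M w))"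
    using W Q by (simp add: dset_def dfn.conj)
  then have "dfn R (\<lambda>v. \<exists>w. (\<forall>i\<ge>M. w i = 0) \<and> trunc M w \<in> W \<and> Q v w)"
    by (rule dfn_ex_vec[of R "\<lambda>v w. trunc M w \<in> W \<and> Q v w" M])
  moreover have "(\<exists>w. (\<forall>i\<ge>M. w i = 0) \<and> trunc M w \<in> W \<and> Q v w) = (\<exists>w\<in>W. Q v w)" for v
    using W t trunc_id unfolding dset_def by metis
  ultimately show ?thesis by (rule dfn_cong)
qed

lemma dset_mono:
  assumes W: "dset R M W" and "M \<le> N"
  shows "dset R N W"
  unfolding dset_def
proof
  show "\<forall>w\<in>W. \<forall>i\<ge>N. w i = 0" using assms by (auto simp: dset_def)
  have "dfn R (\<lambda>v. (\<forall>j\<in>{M..<N}. v j = 0) \<and> trunc M v \<in> W)"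
    using W by (intro dfn.conj dfn_ball_finite dfn.eq tm.var tm.const) (auto simp: dset_def)
  moreover have "((\<forall>j\<in>{M..<N}. v j = 0) \<and> trunc M v \<in> W) = (trunc N v \<in> W)" for v
  proof
    assume *: "(\<forall>j\<in>{M..<N}. v j = 0) \<and> trunc M v \<in> W"
    then have "trunc N v = trunc M v" using \<open>M \<le> N\<close> by (auto simp: trunc_def fun_eq_iff)
    then show "trunc N v \<in> W" using * by simp
  next
    assume *: "trunc N v \<in> W"
    then have "\<forall>i\<ge>M. trunc N v i = 0" using W by (auto simp: dset_def)
    then have v: "\<forall>j\<in>{M..<N}. v j = 0" by (auto simp: trunc_def split: if_splits)
    then have "trunc N v = trunc M v" using \<open>M \<le> N\<close> by (auto simp: trunc_def fun_eq_iff)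
    then show "(\<forall>j\<in>{M..<N}. v j = 0) \<and> trunc M v \<in> W" using * v by simp
  qed
  ultimately show "dfn R (\<lambda>v. trunc N v \<in> W)" by (rule dfn_cong)
qed

lemma dset_Collect:
  assumes W: "dset R M W" and P: "dfn R P"
  shows "dset R M {w\<in>W. P w}"
  unfolding dset_def
proof
  show "\<forall>w\<in>{w\<in>W. P w}. \<forall>i\<ge>M. w i = 0" using W by (simp add: dset_def)
  have "dfn R (\<lambda>v. P (trunc M v))"
    by (rule dfn_subst[OF P]) (rule tm_trunc, rule tm.var)
  then show "dfn R (\<lambda>v. trunc M v \<in> {w\<in>W. P w})"
    using W by (simp add: dset_def dfn.conj)
qed

lemma dfn_fibre:
  assumes W: "dset R M W" and "finite u"
  shows "dfn R (\<lambda>x. x 0 \<in> fibre u i W v)"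
proof -
  have "dfn R (\<lambda>x. \<exists>w\<in>W. (\<forall>j\<in>u. w j = v j) \<and> w i = x 0)"
    by (rule dset_ex[OF W]) (intro dfn.conj dfn_ball_finite[OF \<open>finite u\<close>] dfn.eq tm_trunc tm.var tm.const)
  moreover have "(\<exists>w\<in>W. (\<forall>j\<in>u. w j = v j) \<and> w i = x 0) = (x 0 \<in> fibre u i W v)" for x :: "nat \<Rightarrow> real"
    unfolding fibre_def mem_Collect_eq by metis
  ultimately show ?thesis by (rule dfn_cong)
qed

section \<open>Continuity, compactness and category in the product topology\<close>

lemma continuous_on_if_const:
  "(b \<Longrightarrow> continuous_on A f) \<Longrightarrow> (\<not> b \<Longrightarrow> continuous_on A g) \<Longrightarrow>
    continuous_on A (\<lambda>x. if b then f x else g x)"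
  by (cases b) auto

lemma continuous_on_coord_proj: "continuous_on A (coord_proj I)"
  unfolding coord_proj_def
  by (intro continuous_on_coordinatewise_then_product continuous_on_if_const continuous_intros)

lemma continuous_on_trunc: "continuous_on A (trunc n)"
  unfolding trunc_def
  by (intro continuous_on_coordinatewise_then_product continuous_on_if_const continuous_intros)

lemma continuous_on_fun_upd:
  assumes "continuous_on A f"
  shows "continuous_on A (\<lambda>v :: nat \<Rightarrow> real. v(i := f v))"
proof -
  have "continuous_on A (\<lambda>v. if j = i then f v else v j)" for j
    by (intro continuous_on_if_const assms continuous_intros)
  then show ?thesis
    by (intro continuous_on_coordinatewise_then_product) (simp add: fun_upd_def)
qed

lemma continuous_on_coordinate_update: "continuous_on A (\<lambda>t :: real. v(i :: nat := t))"
  by (intro continuous_on_coordinatewise_then_product) (simp add: fun_upd_def continuous_on_if_const)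

lemma closed_proj:
  assumes "compact W"
  shows "closed (proj I W)"
proof -
  have "proj I W = coord_proj I -` (coord_proj I ` W)"
  proof (intro set_eqI iffI)
    fix v assume "v \<in> proj I W"
    then obtain w where "w \<in> W" "\<forall>i\<in>I. w i = v i" by (auto simp: proj_def)
    then show "v \<in> coord_proj I -` (coord_proj I ` W)"
      by (auto simp: coord_proj_def fun_eq_iff intro!: rev_image_eqI[of w])
  next
    fix v assume "v \<in> coord_proj I -` (coord_proj I ` W)"
    then obtain w where w: "w \<in> W" "coord_proj I v = coord_proj I w" by auto
    have "w i = v i" if "i \<in> I" for i
      using fun_cong[OF w(2), of i] that by (simp add: coord_proj_def)
    then show "v \<in> proj I W" using w(1) by (auto simp: proj_def)
  qed
  moreover have "closed (coord_proj I ` W)"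
    by (intro compact_imp_closed compact_continuous_image assms continuous_on_coord_proj)
  ultimately show ?thesis
    using continuous_on_coord_proj by (metis closed_vimage)
qed

lemma compact_box: "compact {w :: nat \<Rightarrow> real. \<forall>i. \<bar>w i\<bar> \<le> b}"
proof -
  have "compactin (powertop_real UNIV) (\<Pi>\<^sub>E i\<in>UNIV. {-b..b})"
    by (simp add: compactin_PiE)
  then have "compact (\<Pi>\<^sub>E i\<in>(UNIV :: nat set). {-b..b})"
    by (simp only: euclidean_product_topology compactin_euclidean_iff)
  moreover have "(\<Pi>\<^sub>E i\<in>UNIV. {-b..b}) = {w :: nat \<Rightarrow> real. \<forall>i. \<bar>w i\<bar> \<le> b}"
    by (auto simp: PiE_def Pi_def abs_le_iff minus_le_iff)
  ultimately show ?thesis by (simp only:)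
qed

lemma compact_fibre:
  assumes "compact W"
  shows "compact (fibre u i W v)"
proof -
  have "compact (W \<inter> (\<Inter>j\<in>u. {w. w j = v j}))"
    by (intro compact_Int_closed assms closed_INT ballI closed_Collect_eq continuous_intros)
  moreover have "fibre u i W v = (\<lambda>w. w i) ` (W \<inter> (\<Inter>j\<in>u. {w. w j = v j}))"
    unfolding fibre_def by auto
  ultimately show ?thesis by (auto intro!: compact_continuous_image continuous_intros)
qed

lemma Baire_functions:
  fixes \<G> :: "(nat \<Rightarrow> real) set set"
  assumes "countable \<G>" "\<And>T. T \<in> \<G> \<Longrightarrow> closed T \<and> interior T = {}"
  shows "interior (\<Union>\<G>) = {}"
proof -
  have "completely_metrizable_space (powertop_real (UNIV :: nat set))"
    by (simp add: completely_metrizable_space_product_topology completely_metrizable_space_euclidean)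
  then have "completely_metrizable_space (euclidean :: (nat \<Rightarrow> real) topology)"
    by (simp only: euclidean_product_topology)
  then show ?thesis
    using Baire_category_alt[of "euclidean :: (nat \<Rightarrow> real) topology" \<G>] assms by simp
qed

text \<open>A fibre with interior contains a rational interval, so countably many of these sets
  collect all base points with a fat fibre. This is the category substitute for Fubini.\<close>

definition interval_base :: "nat set \<Rightarrow> nat \<Rightarrow> (nat \<Rightarrow> real) set \<Rightarrow> real \<Rightarrow> real \<Rightarrow> (nat \<Rightarrow> real) set" where
  "interval_base u i W q r = {v. {q..r} \<subseteq> fibre u i W v}"

text \<open>Over no coordinates, the cylinder of a nonempty set is the whole space.\<close>

lemma interior_proj_empty_index: "interior (proj {} V) = {} \<Longrightarrow> V = {}"
  by (auto simp: proj_def split: if_splits)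

lemma closed_interval_base:
  assumes "compact W"
  shows "closed (interval_base u i W q r)"
proof -
  have "interval_base u i W q r = (\<Inter>t\<in>{q..r}. proj u (W \<inter> {w. w i = t}))"
    unfolding interval_base_def fibre_def proj_def by blast
  moreover have "compact (W \<inter> {w. w i = t})" for t
    by (intro compact_Int_closed assms closed_Collect_eq continuous_intros)
  ultimately show ?thesis by (auto intro!: closed_INT closed_proj)
qed

text \<open>An open set of base points times the open interval from \<open>q\<close> to
  \<open>r\<close> would be an open part of the projection to \<open>insert i u\<close>.\<close>

lemma interior_interval_base:
  assumes "interior (proj (insert i u) W) = {}" "i \<notin> u" "q < r"
  shows "interior (interval_base u i W q r) = {}"
proof (rule ccontr)
  let ?G = "interior (interval_base u i W q r)"
  assume "?G \<noteq> {}"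
  then obtain g where g: "g \<in> ?G" by blast
  \<comment> \<open>Being a base point does not depend on coordinate \<open>i\<close>; freezing it
    at \<open>g i\<close> inside the membership test leaves \<open>v i\<close> free to run through
    the interval.\<close>
  let ?H = "(\<lambda>v. v(i := g i)) -` ?G \<inter> {v. q < v i} \<inter> {v. v i < r}"
  have "open ?H"
    by (intro open_Int open_vimage open_Collect_less continuous_intros continuous_on_fun_upd open_interior)
  moreover have "?H \<subseteq> proj (insert i u) W"
  proof
    fix v assume v: "v \<in> ?H"
    then have "v(i := g i) \<in> interval_base u i W q r" using interior_subset by blast
    then have "v i \<in> fibre u i W (v(i := g i))" using v by (auto simp: interval_base_def)
    then obtain w where "w \<in> W" "\<forall>j\<in>u. w j = (v(i := g i)) j" "w i = v i"
      unfolding fibre_def by auto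
    then show "v \<in> proj (insert i u) W"
      using \<open>i \<notin> u\<close> unfolding proj_def by (auto intro!: bexI[of _ w])
  qed
  ultimately have "?H = {}" using assms(1) by (metis interior_maximal subset_empty)
  moreover have "g(i := (q + r) / 2) \<in> ?H" using g \<open>q < r\<close> by simp
  ultimately show False by blast
qed

lemma rational_subinterval:
  fixes S :: "real set"
  assumes "interior S \<noteq> {}"
  obtains q r where "q \<in> \<rat>" "r \<in> \<rat>" "q < r" "{q..r} \<subseteq> S"
proof -
  obtain x e where "0 < e" "ball x e \<subseteq> S"
    using assms by (metis ex_in_conv mem_interior)
  obtain q where q: "q \<in> \<rat>" "x < q" "q < x + e" using Rats_dense_in_real[of x "x + e"] \<open>0 < e\<close> by auto
  obtain r where r: "r \<in> \<rat>" "q < r" "r < x + e" using Rats_dense_in_real[of q "x + e"] q by auto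
  have "{q..r} \<subseteq> ball x e" using q r by (auto simp: dist_real_def)
  then show ?thesis using that[of q r] q r \<open>ball x e \<subseteq> S\<close> by blast
qed

lemma countable_rational_pairs: "countable {(q :: real, r). q \<in> \<rat> \<and> r \<in> \<rat> \<and> q < r}"
  by (rule countable_subset[of _ "\<rat> \<times> \<rat>"]) (auto intro: countable_rat)

definition interval_bases :: "nat set \<Rightarrow> nat \<Rightarrow> (nat \<Rightarrow> real) set \<Rightarrow> (nat \<Rightarrow> real) set set" where
  "interval_bases u i W = (\<lambda>(q, r). interval_base u i W q r) ` {(q, r). q \<in> \<rat> \<and> r \<in> \<rat> \<and> q < r}"

lemma countable_interval_bases: "countable (interval_bases u i W)"
  unfolding interval_bases_def by (intro countable_image countable_rational_pairs)

lemma fibre_interior_interval_bases: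
  assumes "interior (fibre u i W v) \<noteq> {}"
  shows "v \<in> \<Union>(interval_bases u i W)"
  using rational_subinterval[OF assms] unfolding interval_bases_def interval_base_def by fastforce

lemma interval_bases_nowhere_dense:
  assumes "compact W" "interior (proj (insert i u) W) = {}" "i \<notin> u" "T \<in> interval_bases u i W"
  shows "closed T \<and> interior T = {}"
  using assms(4) closed_interval_base[OF assms(1)] interior_interval_base[OF assms(2,3)]
  unfolding interval_bases_def by auto

subsection \<open>Shears preserve smallness\<close>

definition shear :: "nat \<Rightarrow> nat \<Rightarrow> real \<Rightarrow> (nat \<Rightarrow> real) \<Rightarrow> nat \<Rightarrow> real" where
  "shear i k a w = w(i := w i + a * w k)"

lemma shear_inverse: "i \<noteq> k \<Longrightarrow> shear i k (- a) (shear i k a w) = w"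
  by (auto simp: shear_def)

lemma continuous_on_shear: "continuous_on A (shear i k a)"
  unfolding shear_def by (intro continuous_on_fun_upd continuous_intros)

lemma compact_shear: "compact W \<Longrightarrow> compact (shear i k a ` W)"
  by (intro compact_continuous_image continuous_on_shear)

lemma dset_shear:
  assumes W: "dset R M W" and "i < M" "k < M" "i \<noteq> k"
  shows "dset R M (shear i k a ` W)"
  unfolding dset_def
proof
  show "\<forall>w\<in>shear i k a ` W. \<forall>j\<ge>M. w j = 0" using W \<open>i < M\<close> by (auto simp: dset_def shear_def)
  have "tm R (\<lambda>v. shear i k (- a) v j)" for j
    by (cases "j = i") (simp_all add: shear_def tm.var tm.times tm_diff tm.const)
  then have "dfn R (\<lambda>v. trunc M (shear i k (- a) v) \<in> W)" by (rule dset_mem[OF W])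
  moreover have "(trunc M (shear i k (- a) v) \<in> W) = (trunc M v \<in> shear i k a ` W)" for v
  proof -
    have *: "trunc M (shear i k (- a) v) = shear i k (- a) (trunc M v)"
      using \<open>i < M\<close> \<open>k < M\<close> by (auto simp: shear_def trunc_def)
    show ?thesis unfolding *
      using shear_inverse[OF \<open>i \<noteq> k\<close>, of a] shear_inverse[OF \<open>i \<noteq> k\<close>, of "- a"]
      by (metis (no_types, lifting) image_iff minus_minus)
  qed
  ultimately show "dfn R (\<lambda>v. trunc M v \<in> shear i k a ` W)" by (rule dfn_cong)
qed

text \<open>The essential case is that \<open>I\<close> contains \<open>i\<close> but not
  \<open>k\<close>. Over a base point, the fibre of the image in direction \<open>i\<close> lies in
  A + a B, with A and B the fibres of \<open>W\<close> in directions \<open>i\<close> and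
  \<open>k\<close>. Both \<open>I\<close> and \<open>I\<close> with \<open>k\<close> in place of
  \<open>i\<close> have \<open>Suc d\<close> elements, so generic A and B have empty interior and
  \<open>restrained_linear_image\<close> applies.\<close>

lemma small_shear:
  assumes R: "restrained R" and W: "dset R M W" "compact W" "small d W" and "i \<noteq> k"
  shows "small d (shear i k a ` W)"
  unfolding small_def
proof (intro allI impI)
  fix I :: "nat set" assume I: "finite I \<and> card I = Suc d"
  then have I0: "interior (proj I W) = {}" using W(3) by (simp add: small_def)
  consider "i \<notin> I" | "i \<in> I" "k \<in> I" | "i \<in> I" "k \<notin> I" by blast
  then show "interior (proj I (shear i k a ` W)) = {}"
  proof cases
    case 1
    then have "proj I (shear i k a ` W) = proj I W"
      by (auto simp: proj_def shear_def)
    then show ?thesis using I0 by simp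
  next
    case 2
    \<comment> \<open>Here the shear acts on the coordinates in \<open>I\<close> alone, and its
      inverse carries an open part of the new projection to one of the old.\<close>
    let ?G = "interior (proj I (shear i k a ` W))"
    have "open (shear i k a -` ?G)"
      by (intro open_vimage continuous_on_shear open_interior)
    moreover have "shear i k a -` ?G \<subseteq> proj I W"
    proof
      fix v assume "v \<in> shear i k a -` ?G"
      then have "shear i k a v \<in> proj I (shear i k a ` W)" using interior_subset by blast
      then obtain w where w: "w \<in> W" "\<forall>j\<in>I. shear i k a w j = shear i k a v j"
        unfolding proj_def by auto
      have "w j = v j" if "j \<in> I" for j
        using w(2) that 2 \<open>i \<noteq> k\<close> unfolding shear_def by (metis add_right_cancel fun_upd_apply)
      then show "v \<in> proj I W" using w(1) unfolding proj_def by blast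
    qed
    ultimately have "shear i k a -` ?G = {}" using I0 by (metis interior_maximal subset_empty)
    moreover have "g \<in> ?G \<Longrightarrow> shear i k (- a) g \<in> shear i k a -` ?G" for g
      using shear_inverse[OF \<open>i \<noteq> k\<close>, of "- a" g] by simp
    ultimately show ?thesis by blast
  next
    case 3
    let ?u = "I - {i}"
    have ins: "insert i ?u = I" using 3 by blast
    have "card (insert k ?u) = Suc d" using I 3 by simp
    then have k0: "interior (proj (insert k ?u) W) = {}" using W(3) I by (simp add: small_def)
    \<comment> \<open>The meagre set of base points where one of the two fibres has
      interior.\<close>
    let ?\<G> = "interval_bases ?u i W \<union> interval_bases ?u k W"
    have meager: "interior (\<Union>?\<G>) = {}"
    proof (rule Baire_functions)
      show "countable ?\<G>" by (simp add: countable_interval_bases)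
      show "closed T \<and> interior T = {}" if "T \<in> ?\<G>" for T
        using that interval_bases_nowhere_dense[OF W(2), of i ?u T] interval_bases_nowhere_dense[OF W(2), of k ?u T]
          I0 k0 ins 3 by auto
    qed
    let ?G = "interior (proj I (shear i k a ` W))"
    show ?thesis
    proof (rule ccontr)
      assume "?G \<noteq> {}"
      then obtain g where g: "g \<in> ?G" by blast
      let ?N = "(\<lambda>v. v(i := g i)) -` ?G"
      have "open ?N"
        by (intro open_vimage continuous_intros continuous_on_fun_upd open_interior)
      moreover have "?N \<subseteq> \<Union>?\<G>"
      proof
        fix v assume v: "v \<in> ?N"
        let ?A = "fibre ?u i W v" and ?B = "fibre ?u k W v"
        let ?T = "(\<lambda>t. v(i := t)) -` ?G"
        have "open ?T" by (rule open_vimage[OF open_interior continuous_on_coordinate_update])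
        have "?T \<subseteq> {x + a * y |x y. x \<in> ?A \<and> y \<in> ?B}"
        proof
          fix t assume "t \<in> ?T"
          then have "v(i := t) \<in> proj I (shear i k a ` W)" using interior_subset by blast
          then obtain w where w: "w \<in> W" "\<forall>j\<in>I. shear i k a w j = (v(i := t)) j"
            unfolding proj_def by auto
          then have "w i + a * w k = t" using 3 by (auto simp: shear_def)
          moreover have "w j = v j" if "j \<in> I" "j \<noteq> i" for j
            using bspec[OF w(2) that(1)] that(2) by (simp add: shear_def)
          then have "w i \<in> ?A" "w k \<in> ?B" using w(1) unfolding fibre_def by auto
          ultimately show "t \<in> {x + a * y |x y. x \<in> ?A \<and> y \<in> ?B}" by blast
        qed
        moreover have "g i \<in> ?T" using v by simp
        ultimately have "interior {x + a * y |x y. x \<in> ?A \<and> y \<in> ?B} \<noteq> {}"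
          using \<open>open ?T\<close> interior_maximal by blast
        moreover have "finite ?u" using I by simp
        note fin = dfn_fibre[OF W(1) this, of _ v]
        ultimately have "interior ?A \<noteq> {} \<or> interior ?B \<noteq> {}"
          using restrained_linear_image[OF R compact_imp_closed[OF compact_fibre[OF W(2)]] fin _
            compact_imp_closed[OF compact_fibre[OF W(2)]] fin, of i k a] by blast
        then show "v \<in> \<Union>?\<G>"
          using fibre_interior_interval_bases[of ?u i W v] fibre_interior_interval_bases[of ?u k W v] by auto
      qed
      ultimately have "?N = {}" using meager by (metis interior_maximal subset_empty)
      then show False using g by auto
    qed
  qed
qed

subsection \<open>Linear images and products\<close>

text \<open>For full \<open>S\<close> this is the graph map x \<mapsto> (x, a x), with the linear
  forms in the fresh coordinates M + j, where \<open>x\<close> is 0. Keeping \<open>x\<close> makes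
  each matrix entry an invertible shear, so the map can be built entry by entry.\<close>

definition lin :: "nat \<Rightarrow> (nat \<Rightarrow> nat \<Rightarrow> real) \<Rightarrow> (nat \<times> nat) set \<Rightarrow> (nat \<Rightarrow> real) \<Rightarrow> nat \<Rightarrow> real" where
  "lin M a S x k = x k + (\<Sum>p\<in>S. if M + fst p = k then a (fst p) (snd p) * x (snd p) else 0)"

lemma lin_low: "k < M \<Longrightarrow> lin M a S x k = x k"
  by (simp add: lin_def)

lemma lin_insert:
  assumes "finite S" "(j, i) \<notin> S" "i < M"
  shows "lin M a (insert (j, i) S) x = shear (M + j) i (a j i) (lin M a S x)"
proof
  fix k
  show "lin M a (insert (j, i) S) x k = shear (M + j) i (a j i) (lin M a S x) k"
    using assms by (auto simp: shear_def lin_low) (simp_all add: lin_def)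
qed

lemma small_lin:
  assumes R: "restrained R" and W: "dset R M W" "compact W" "small d W"
  shows "finite S \<Longrightarrow> S \<subseteq> {..<n} \<times> {..<M} \<Longrightarrow>
    dset R (M + n) (lin M a S ` W) \<and> compact (lin M a S ` W) \<and> small d (lin M a S ` W)"
proof (induction S rule: finite_induct)
  case empty
  have "lin M a {} ` W = W" by (simp add: lin_def[abs_def])
  then show ?case using W dset_mono[OF W(1), of "M + n"] by simp
next
  case (insert p S)
  obtain j i where p: "p = (j, i)" by (cases p)
  have "lin M a (insert p S) ` W = shear (M + j) i (a j i) ` lin M a S ` W"
    using insert p by (simp add: image_image lin_insert)
  moreover have "j < n" "i < M" using insert.prems p by auto
  ultimately show ?case
    using insert small_shear[OF R, of "M + n" "lin M a S ` W" d "M + j" i "a j i"]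
      dset_shear[of R "M + n" "lin M a S ` W" "M + j" i "a j i"]
    by (simp add: compact_shear)
qed

lemma lin_full:
  assumes "\<forall>i\<ge>M. x i = 0" "j < n"
  shows "lin M a ({..<n} \<times> {..<M}) x (M + j) = (\<Sum>i<M. a j i * x i)"
proof -
  have "lin M a ({..<n} \<times> {..<M}) x (M + j) =
    (\<Sum>j'<n. \<Sum>i<M. if j' = j then a j' i * x i else 0)"
    using assms(1) by (simp add: lin_def sum.cartesian_product split_def)
  also have "\<dots> = (\<Sum>j'<n. if j' = j then \<Sum>i<M. a j' i * x i else 0)"
    by (intro sum.cong) auto
  also have "\<dots> = (\<Sum>i<M. a j i * x i)" using assms(2) by simp
  finally show ?thesis .
qed

lemma proj_mono: "W \<subseteq> V \<Longrightarrow> I' \<subseteq> I \<Longrightarrow> proj I W \<subseteq> proj I' V"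
  unfolding proj_def by blast

lemma smallD:
  assumes "small d W" "finite I" "d < card I"
  shows "interior (proj I W) = {}"
proof -
  obtain I' where "I' \<subseteq> I" "card I' = Suc d" "finite I'"
    using assms(2,3) by (meson Suc_leI obtain_subset_with_card_n)
  then show ?thesis
    using assms(1) interior_mono[OF proj_mono[OF order_refl, of I' I W]] unfolding small_def by blast
qed

section \<open>Products of definable compact sets\<close>

definition join :: "nat \<Rightarrow> (nat \<Rightarrow> real) \<Rightarrow> (nat \<Rightarrow> real) \<Rightarrow> nat \<Rightarrow> real" where
  "join M w v = (\<lambda>i. if i < M then w i else v (i - M))"

definition join_set :: "nat \<Rightarrow> (nat \<Rightarrow> real) set \<Rightarrow> (nat \<Rightarrow> real) set \<Rightarrow> (nat \<Rightarrow> real) set" where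
  "join_set M W V = (\<lambda>(w, v). join M w v) ` (W \<times> V)"

lemma continuous_on_join:
  assumes "continuous_on A f" "continuous_on A g"
  shows "continuous_on A (\<lambda>x. join M (f x) (g x))"
proof -
  have "continuous_on A (\<lambda>x. f x i)" "continuous_on A (\<lambda>x. g x i)" for i
    using assms by (metis continuous_on_product_then_coordinatewise)+
  then show ?thesis unfolding join_def
    by (intro continuous_on_coordinatewise_then_product continuous_on_if_const)
qed

lemma compact_join_set: "compact W \<Longrightarrow> compact V \<Longrightarrow> compact (join_set M W V)"
  unfolding join_set_def split_def
  by (intro compact_continuous_image compact_Times continuous_on_join continuous_intros)

lemma dset_join_set:
  assumes W: "dset R M W" and V: "dset R N V"
  shows "dset R (M + N) (join_set M W V)"
  unfolding dset_def
proof
  show "\<forall>w\<in>join_set M W V. \<forall>i\<ge>M + N. w i = 0"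
    using V by (auto simp: dset_def join_set_def join_def)
  have "dfn R (\<lambda>v. trunc M v \<in> W)" "dfn R (\<lambda>v. trunc N (\<lambda>i. v (i + M)) \<in> V)"
    using dset_mem[OF W, of "\<lambda>v. v"] dset_mem[OF V, of "\<lambda>v i. v (i + M)"] by (simp_all add: tm.var)
  then have "dfn R (\<lambda>v. trunc M v \<in> W \<and> trunc N (\<lambda>i. v (i + M)) \<in> V)" by (rule dfn.conj)
  moreover have "(trunc M v \<in> W \<and> trunc N (\<lambda>i. v (i + M)) \<in> V) = (trunc (M + N) v \<in> join_set M W V)" for v
  proof
    assume *: "trunc M v \<in> W \<and> trunc N (\<lambda>i. v (i + M)) \<in> V"
    have "trunc (M + N) v = join M (trunc M v) (trunc N (\<lambda>i. v (i + M)))"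
      by (rule ext) (auto simp: trunc_def join_def)
    then show "trunc (M + N) v \<in> join_set M W V" using * unfolding join_set_def by auto
  next
    assume "trunc (M + N) v \<in> join_set M W V"
    then obtain w x where wx: "w \<in> W" "x \<in> V" "trunc (M + N) v = join M w x"
      unfolding join_set_def by auto
    have "trunc M v = w"
    proof
      fix i
      show "trunc M v i = w i"
        using fun_cong[OF wx(3), of i] wx(1) W by (auto simp: trunc_def join_def dset_def split: if_splits)
    qed
    moreover have "trunc N (\<lambda>i. v (i + M)) = x"
    proof
      fix i
      show "trunc N (\<lambda>i. v (i + M)) i = x i"
        using fun_cong[OF wx(3), of "i + M"] wx(2) V by (auto simp: trunc_def join_def dset_def split: if_splits)
    qed
    ultimately show "trunc M v \<in> W \<and> trunc N (\<lambda>i. v (i + M)) \<in> V" using wx by simp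
  qed
  ultimately show "dfn R (\<lambda>v. trunc (M + N) v \<in> join_set M W V)" by (rule dfn_cong)
qed

text \<open>Pigeonhole: d + e + 1 coordinates contain more than \<open>d\<close> of the first factor
  or more than \<open>e\<close> of the second.\<close>

lemma small_join_set:
  assumes W: "small d W" and V: "small e V"
  shows "small (d + e) (join_set M W V)"
  unfolding small_def
proof (intro allI impI)
  fix I :: "nat set"
  assume I: "finite I \<and> card I = Suc (d + e)"
  define I1 I2 where "I1 = I \<inter> {..<M}" and "I2 = {i. i + M \<in> I}"
  have I2: "finite I2" "card I2 = card (I - {..<M})"
  proof -
    have *: "I - {..<M} = (\<lambda>i. i + M) ` I2"
    proof
      show "I - {..<M} \<subseteq> (\<lambda>i. i + M) ` I2"
      proof
        fix j assume "j \<in> I - {..<M}"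
        then show "j \<in> (\<lambda>i. i + M) ` I2" by (intro image_eqI[of _ _ "j - M"]) (auto simp: I2_def)
      qed
    qed (auto simp: I2_def)
    then show "card I2 = card (I - {..<M})" by (simp add: card_image)
    have "finite ((\<lambda>i. i + M) ` I2)" using I by (simp flip: *)
    then show "finite I2" by (rule finite_imageD) simp
  qed
  have "card I1 + card I2 = card I"
    unfolding I2(2) I1_def using I by (metis card_Diff_subset_Int card_mono finite_Int inf_le1 le_add_diff_inverse)
  then consider "d < card I1" | "e < card I2" using I by linarith
  then show "interior (proj I (join_set M W V)) = {}"
  proof cases
    case 1
    have "proj I (join_set M W V) \<subseteq> proj I1 W"
      unfolding proj_def join_set_def I1_def join_def by auto
    then show ?thesis
      using smallD[OF W _ 1] I interior_mono unfolding I1_def by blast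
  next
    case 2
    let ?G = "interior (proj I (join_set M W V))"
    show ?thesis
    proof (rule ccontr)
      assume "?G \<noteq> {}"
      then obtain g where g: "g \<in> ?G" by blast
      \<comment> \<open>Freezing the first \<open>M\<close> coordinates at those of \<open>g\<close>
        turns an open part of the product's projection into one for \<open>V\<close>.\<close>
      have "open ((\<lambda>y. join M g y) -` ?G)"
        by (intro open_vimage open_interior continuous_on_join continuous_intros)
      moreover have "(\<lambda>y. join M g y) -` ?G \<subseteq> proj I2 V"
      proof
        fix y assume "y \<in> (\<lambda>y. join M g y) -` ?G"
        then have "join M g y \<in> proj I (join_set M W V)" using interior_subset by blast
        then obtain w v where wv: "w \<in> W" "v \<in> V" "\<forall>i\<in>I. join M w v i = join M g y i"
          unfolding proj_def join_set_def by auto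
        have "v i = y i" if "i \<in> I2" for i
          using wv(3)[rule_format, of "i + M"] that by (simp add: I2_def join_def)
        then show "y \<in> proj I2 V" using wv(2) unfolding proj_def by blast
      qed
      ultimately have "(\<lambda>y. join M g y) -` ?G = {}"
        using smallD[OF V I2(1) 2] by (metis interior_maximal subset_empty)
      moreover have "join M g (\<lambda>i. g (i + M)) = g" by (auto simp: join_def)
      ultimately show False using g by (metis empty_iff vimageI)
    qed
  qed
qed

subsection \<open>Projections with empty interior are null\<close>

text \<open>Steinhaus. If \<open>A\<close> had positive measure, take an open U around
  \<open>A\<close> with U - A of smaller measure than \<open>A\<close>. A translate of
  \<open>A\<close> by less than \<open>h\<close> stays in U, so it must meet \<open>A\<close>; hence
  A - A contains an interval, against \<open>restrained_linear_image\<close> with coefficient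
  -1.\<close>

lemma restrained_null_line:
  fixes A :: "real set"
  assumes R: "restrained R" and A: "compact A" "dfn R (\<lambda>v. v 0 \<in> A)" "interior A = {}"
  shows "emeasure lborel A = 0"
proof (rule ccontr)
  assume pos: "emeasure lborel A \<noteq> 0"
  have meas: "A \<in> sets lborel" using A(1) by (simp add: borel_compact)
  have fin: "emeasure lborel A < \<infinity>" using A(1) by (rule emeasure_compact_finite)
  have "0 < measure lborel A"
    using pos fin by (simp add: measure_def enn2real_positive_iff zero_less_iff_neq_zero)
  then obtain U where U: "open U" "A \<subseteq> U" "emeasure lborel (U - A) < ennreal (measure lborel A)"
    using outer_regular_lborel[of A "measure lborel A"] meas unfolding sets_lborel by metis
  obtain h where "0 < h" "(\<Union>x\<in>A. ball x h) \<subseteq> U"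
    by (rule compact_subset_open_imp_ball_epsilon_subset[OF A(1) U(1,2)])
  then have h: "0 < h" "\<And>x. x \<in> A \<Longrightarrow> ball x h \<subseteq> U" by blast+
  have "t \<in> {x + (-1) * y |x y. x \<in> A \<and> y \<in> A}" if "\<bar>t\<bar> < h" for t
  proof (rule ccontr)
    assume "t \<notin> {x + (-1) * y |x y. x \<in> A \<and> y \<in> A}"
    then have disj: "- t + y \<notin> A" if "y \<in> A" for y
      using that by force
    have sub: "(+) (- t) -` A \<subseteq> U - A"
    proof
      fix y assume y: "y \<in> (+) (- t) -` A"
      then have "- t + y \<in> A" by simp
      moreover have "y \<in> ball (- t + y) h" using that by (simp add: dist_real_def)
      ultimately have "y \<in> U" using h(2) by blast
      moreover have "y \<notin> A" using y disj by fastforce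
      ultimately show "y \<in> U - A" by blast
    qed
    have "emeasure lborel A = emeasure (distr lborel borel ((+) (- t))) A"
      by (simp only: lborel_distr_plus)
    also have "\<dots> = emeasure lborel ((+) (- t) -` A)"
      using meas by (simp add: emeasure_distr)
    also have "\<dots> \<le> emeasure lborel (U - A)"
      using sub U(1) meas by (intro emeasure_mono) auto
    also have "\<dots> < ennreal (measure lborel A)" by (rule U(3))
    also have "\<dots> = emeasure lborel A"
      using fin by (simp add: emeasure_eq_ennreal_measure)
    finally show False by simp
  qed
  then have "ball 0 h \<subseteq> {x + (-1) * y |x y. x \<in> A \<and> y \<in> A}" by (auto simp: dist_real_def)
  then have "0 \<in> interior {x + (-1) * y |x y. x \<in> A \<and> y \<in> A}"
    using h(1) by (meson mem_interior)
  then show False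
    using restrained_linear_image[OF R compact_imp_closed[OF A(1)] A(2,3) compact_imp_closed[OF A(1)] A(2,3), of "-1"]
    by blast
qed

text \<open>The projection inside the space of \<open>Pi\<^sub>M I\<close>, whose points are
  \<open>undefined\<close> off \<open>I\<close>; \<open>proj I V\<close> is its cylinder
  counterpart.\<close>

definition trace_on :: "nat set \<Rightarrow> (nat \<Rightarrow> real) set \<Rightarrow> (nat \<Rightarrow> real) set" where
  "trace_on I V = (\<lambda>w. restrict w I) ` V"

lemma trace_on_iff: "x \<in> trace_on I V \<longleftrightarrow> x \<in> extensional I \<and> x \<in> proj I V"
proof
  assume "x \<in> trace_on I V"
  then show "x \<in> extensional I \<and> x \<in> proj I V" by (auto simp: trace_on_def proj_def)
next
  assume *: "x \<in> extensional I \<and> x \<in> proj I V"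
  then obtain w where w: "w \<in> V" "\<forall>i\<in>I. w i = x i" by (auto simp: proj_def)
  then have "restrict w I = x" using * by (intro extensionalityI[of _ I]) auto
  then show "x \<in> trace_on I V" using w unfolding trace_on_def by blast
qed

lemma trace_on_sets:
  assumes "compact V"
  shows "trace_on I V \<in> sets (Pi\<^sub>M I (\<lambda>_. lborel))"
proof -
  \<comment> \<open>Extension by 0 leads back to \<open>nat \<Rightarrow> real\<close>, where the
    cylinder is closed and therefore Borel.\<close>
  let ?f = "\<lambda>x i. if i \<in> I then x i else (0::real)"
  have "?f \<in> borel_measurable (Pi\<^sub>M I (\<lambda>_. lborel))"
  proof (rule measurable_coordinatewise_then_product)
    fix i :: nat
    show "(\<lambda>x. ?f x i) \<in> borel_measurable (Pi\<^sub>M I (\<lambda>_. lborel))"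
    proof (cases "i \<in> I")
      case True
      then have "(\<lambda>x. x i) \<in> measurable (Pi\<^sub>M I (\<lambda>_. lborel)) (lborel :: real measure)"
        by (rule measurable_component_singleton)
      with True show ?thesis by simp
    qed simp
  qed
  then have "?f -` proj I V \<inter> space (Pi\<^sub>M I (\<lambda>_. lborel)) \<in> sets (Pi\<^sub>M I (\<lambda>_. lborel))"
    using closed_proj[OF assms] by (intro measurable_sets) auto
  moreover have "?f x \<in> proj I V \<longleftrightarrow> x \<in> proj I V" for x
    unfolding proj_def by (simp cong: ball_cong)
  then have "?f -` proj I V \<inter> space (Pi\<^sub>M I (\<lambda>_. lborel)) = trace_on I V"
    by (auto simp: trace_on_iff space_PiM PiE_def)
  ultimately show ?thesis by simp
qed

lemma fibre_cong: "(\<And>j. j \<in> u \<Longrightarrow> v j = v' j) \<Longrightarrow> fibre u i W v = fibre u i W v'"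
  unfolding fibre_def by auto

lemma trace_on_insert_fibre:
  assumes "i \<notin> u" "x \<in> extensional u"
  shows "x(i := y) \<in> trace_on (insert i u) V \<longleftrightarrow> y \<in> fibre u i V x"
proof -
  have "x(i := y) \<in> extensional (insert i u)" using assms(2) by (simp add: extensional_insert_undefined)
  then have "x(i := y) \<in> trace_on (insert i u) V \<longleftrightarrow> (\<exists>w\<in>V. w i = y \<and> (\<forall>j\<in>u. w j = x j))"
    using assms(1) unfolding trace_on_iff proj_def by (auto split: if_splits)
  also have "\<dots> \<longleftrightarrow> y \<in> fibre u i V x" unfolding fibre_def by auto
  finally show ?thesis .
qed

text \<open>Fubini in the coordinate \<open>i\<close>. Base points whose fibre contains a rational
  interval form countably many null sets by induction; over all others the fibre has empty interior
  and is null by \<open>restrained_null_line\<close>.\<close>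

lemma restrained_null:
  assumes R: "restrained R"
  shows "finite I \<Longrightarrow> compact V \<Longrightarrow> dset R N V \<Longrightarrow> interior (proj I V) = {} \<Longrightarrow>
    trace_on I V \<in> null_sets (Pi\<^sub>M I (\<lambda>_. lborel))"
proof (induction I arbitrary: V rule: finite_induct)
  case empty
  have "V = {}" by (rule interior_proj_empty_index[OF empty(3)])
  then show ?case by (simp add: trace_on_def)
next
  case (insert i u)
  interpret product_sigma_finite "\<lambda>_. lborel :: real measure" by standard
  \<comment> \<open>\<open>interval_base\<close> is an unbounded cylinder; its part in
    \<open>V\<close> is compact, and every base point of a nonempty fibre is represented
    there.\<close>
  let ?B = "\<lambda>(q, r). V \<inter> interval_base u i V q r"
  have B_null: "trace_on u (V \<inter> interval_base u i V q r) \<in> null_sets (Pi\<^sub>M u (\<lambda>_. lborel))"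
    if "q < r" for q r
  proof (rule insert.IH)
    show "compact (V \<inter> interval_base u i V q r)"
      by (intro compact_Int_closed insert.prems closed_interval_base)
    have "dfn R (\<lambda>v. \<forall>t. q \<le> t \<and> t \<le> r \<longrightarrow> (\<exists>w\<in>V. (\<forall>j\<in>u. w j = v j) \<and> w i = t))"
      by (intro dfn_all dfn_imp dfn.conj dfn_le tm.var tm.const dset_ex[OF insert.prems(2)]
          dfn_ball_finite[OF \<open>finite u\<close>] dfn.eq tm_trunc)
    moreover have "(\<forall>t. q \<le> t \<and> t \<le> r \<longrightarrow> (\<exists>w\<in>V. (\<forall>j\<in>u. w j = v j) \<and> w i = t)) =
      (v \<in> interval_base u i V q r)" for v
      unfolding interval_base_def fibre_def by fastforce
    ultimately have "dfn R (\<lambda>v. v \<in> interval_base u i V q r)" by (rule dfn_cong)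
    from dset_Collect[OF insert.prems(2) this]
    show "dset R N (V \<inter> interval_base u i V q r)" by (simp add: Collect_conj_eq)
    have "proj u (V \<inter> interval_base u i V q r) \<subseteq> interval_base u i V q r"
    proof
      fix v assume "v \<in> proj u (V \<inter> interval_base u i V q r)"
      then obtain w where w: "w \<in> interval_base u i V q r" "\<forall>j\<in>u. w j = v j"
        unfolding proj_def by auto
      then show "v \<in> interval_base u i V q r"
        using fibre_cong[of u w v i V] unfolding interval_base_def by auto
    qed
    then show "interior (proj u (V \<inter> interval_base u i V q r)) = {}"
      using interior_interval_base[OF insert.prems(3) insert.hyps(2) that] interior_mono by blast
  qed
  let ?P = "{(q :: real, r). q \<in> \<rat> \<and> r \<in> \<rat> \<and> q < r}"
  have null: "(\<Union>p\<in>?P. trace_on u (?B p)) \<in> null_sets (Pi\<^sub>M u (\<lambda>_. lborel))"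
    using B_null by (intro null_sets_UN' countable_rational_pairs) auto
  have zero: "emeasure lborel (fibre u i V x) = 0"
    if x: "x \<in> space (Pi\<^sub>M u (\<lambda>_. lborel))" "x \<notin> (\<Union>p\<in>?P. trace_on u (?B p))" for x
  proof (rule restrained_null_line[OF R compact_fibre[OF insert.prems(1)] dfn_fibre[OF insert.prems(2) \<open>finite u\<close>]])
    show "interior (fibre u i V x) = {}"
    proof (rule ccontr)
      assume "interior (fibre u i V x) \<noteq> {}"
      then obtain q r where qr: "q \<in> \<rat>" "r \<in> \<rat>" "q < r" "{q..r} \<subseteq> fibre u i V x"
        by (rule rational_subinterval)
      then have "q \<in> fibre u i V x" by auto
      then obtain w where w: "w \<in> V" "\<forall>j\<in>u. w j = x j" unfolding fibre_def by auto
      then have "w \<in> interval_base u i V q r"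
        using qr(4) fibre_cong[of u w x i V] by (auto simp: interval_base_def)
      then have "x \<in> proj u (V \<inter> interval_base u i V q r)"
        using w unfolding proj_def by blast
      then have "x \<in> trace_on u (V \<inter> interval_base u i V q r)"
        using x(1) by (simp add: trace_on_iff space_PiM PiE_def)
      then show False using x(2) qr by auto
    qed
  qed
  have meas: "trace_on (insert i u) V \<in> sets (Pi\<^sub>M (insert i u) (\<lambda>_. lborel))"
    by (rule trace_on_sets[OF insert.prems(1)])
  have "emeasure (Pi\<^sub>M (insert i u) (\<lambda>_. lborel)) (trace_on (insert i u) V) =
    (\<integral>\<^sup>+ x. indicator (trace_on (insert i u) V) x \<partial>Pi\<^sub>M (insert i u) (\<lambda>_. lborel))"
    using meas by simp
  also have "\<dots> = (\<integral>\<^sup>+ x. (\<integral>\<^sup>+ y. indicator (trace_on (insert i u) V) (x(i := y)) \<partial>lborel) \<partial>Pi\<^sub>M u (\<lambda>_. lborel))"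
    using meas insert.hyps by (intro product_nn_integral_insert) auto
  also have "\<dots> = (\<integral>\<^sup>+ x. emeasure lborel (fibre u i V x) \<partial>Pi\<^sub>M u (\<lambda>_. lborel))"
  proof (rule nn_integral_cong)
    fix x :: "nat \<Rightarrow> real" assume "x \<in> space (Pi\<^sub>M u (\<lambda>_. lborel))"
    then have "x \<in> extensional u" by (simp add: space_PiM PiE_def)
    then have "(\<lambda>y. indicator (trace_on (insert i u) V) (x(i := y)) :: ennreal) = indicator (fibre u i V x)"
      using trace_on_insert_fibre[OF insert.hyps(2)] by (auto simp: indicator_def fun_eq_iff)
    moreover have "fibre u i V x \<in> sets lborel"
      using compact_fibre[OF insert.prems(1)] by (simp add: borel_compact)
    ultimately show "(\<integral>\<^sup>+ y. indicator (trace_on (insert i u) V) (x(i := y)) \<partial>lborel) = emeasure lborel (fibre u i V x)"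
      by simp
  qed
  also have "\<dots> = (\<integral>\<^sup>+ x. 0 \<partial>Pi\<^sub>M u (\<lambda>_. lborel :: real measure))"
  proof (rule nn_integral_cong_AE, rule AE_I'[OF null])
    show "{x \<in> space (Pi\<^sub>M u (\<lambda>_. lborel)). emeasure lborel (fibre u i V x) \<noteq> 0} \<subseteq>
      (\<Union>p\<in>?P. trace_on u (?B p))"
      using zero by blast
  qed
  finally show ?case using meas by (intro null_setsI) simp_all
qed

subsection \<open>The strong Baire property\<close>

lemma closed_if_bounded_parts:
  fixes f :: "'a :: topological_space \<Rightarrow> real"
  assumes f: "continuous_on UNIV f" and S: "\<And>b. closed (S \<inter> {x. f x \<le> b})"
  shows "closed S"
proof -
  have "x \<in> S" if x: "x \<in> closure S" for x
  proof -
    have "open {y. f y < f x + 1}" by (intro open_Collect_less f continuous_intros)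
    moreover have "x \<in> {y. f y < f x + 1}" by simp
    ultimately have "x \<in> closure (S \<inter> {y. f y < f x + 1})"
      using x by (metis IntI Int_commute open_Int_closure_subset subsetD)
    also have "\<dots> \<subseteq> closure (S \<inter> {y. f y \<le> f x + 1})" by (intro closure_mono) auto
    also have "\<dots> = S \<inter> {y. f y \<le> f x + 1}" using S by (rule closure_closed)
    finally show ?thesis by simp
  qed
  then show ?thesis by (metis closure_subset_eq subsetI)
qed

lemma compact_sublevel:
  fixes Z :: "(nat \<Rightarrow> real) set"
  assumes "closed Z" "\<And>w i. w \<in> Z \<Longrightarrow> \<bar>w i\<bar> \<le> w \<rho>"
  shows "compact (Z \<inter> {w. w \<rho> \<le> (b :: real)})"
proof -
  have cl: "closed (Z \<inter> {w. w \<rho> \<le> b})"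
    by (intro closed_Int assms(1) closed_Collect_le continuous_intros)
  have "Z \<inter> {w. w \<rho> \<le> b} \<subseteq> {w. \<forall>i. \<bar>w i\<bar> \<le> b}"
  proof
    fix w assume "w \<in> Z \<inter> {w. w \<rho> \<le> b}"
    then have "w \<in> Z" "w \<rho> \<le> b" by auto
    then show "w \<in> {w. \<forall>i. \<bar>w i\<bar> \<le> b}" using assms(2)[of w] by (auto intro: order_trans)
  qed
  then have eq: "Z \<inter> {w. w \<rho> \<le> b} = {w. \<forall>i. \<bar>w i\<bar> \<le> b} \<inter> (Z \<inter> {w. w \<rho> \<le> b})" by blast
  show ?thesis
    by (subst eq) (rule compact_Int_closed[OF compact_box cl])
qed

lemma interior_proj_cylinder:
  assumes "y \<in> interior (proj u W)" "\<And>j. j \<in> u \<Longrightarrow> y' j = y j"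
  shows "y' \<in> interior (proj u W)"
proof -
  let ?f = "\<lambda>v j. if j \<in> u then v j else y j"
  have "continuous_on UNIV ?f"
    by (intro continuous_on_coordinatewise_then_product continuous_on_if_const continuous_intros)
  then have "open (?f -` interior (proj u W))" by (rule open_vimage[OF open_interior])
  then show ?thesis
  proof (rule interiorI)
    show "?f -` interior (proj u W) \<subseteq> proj u W"
    proof
      fix v assume "v \<in> ?f -` interior (proj u W)"
      then have "?f v \<in> proj u W" using interior_subset by blast
      then show "v \<in> proj u W" unfolding proj_def by auto
    qed
    have "?f y' = y" using assms(2) by auto
    then show "y' \<in> ?f -` interior (proj u W)" using assms(1) by simp
  qed
qed

lemma open_contains_coordinate_box:
  assumes "open N" "p \<in> (N :: (nat \<Rightarrow> real) set)"
  obtains F e where "finite F" "0 < e" "{v. \<forall>j\<in>F. \<bar>v j - p j\<bar> \<le> e} \<subseteq> N"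
proof -
  obtain X where X: "p \<in> Pi\<^sub>E UNIV X" "\<And>i. open (X i)" "finite {i. X i \<noteq> UNIV}" "Pi\<^sub>E UNIV X \<subseteq> N"
    using product_topology_open_contains_basis[of "\<lambda>_. euclidean" UNIV N p] assms
    by (auto simp: euclidean_product_topology)
  let ?F = "{i. X i \<noteq> UNIV}"
  have "\<exists>e>0. cball (p i) e \<subseteq> X i" for i
    using X(1,2) by (metis PiE_mem UNIV_I open_contains_cball)
  then obtain e where e: "\<And>i. 0 < e i" "\<And>i. cball (p i) (e i) \<subseteq> X i" by metis
  define d where "d = Min (insert 1 (e ` ?F))"
  have "0 < d" unfolding d_def using X(3) e(1) by (subst Min_gr_iff) auto
  have d: "d \<le> e i" if "i \<in> ?F" for i unfolding d_def using X(3) that by (intro Min_le) auto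
  have "{v. \<forall>j\<in>?F. \<bar>v j - p j\<bar> \<le> d} \<subseteq> Pi\<^sub>E UNIV X"
  proof
    fix v assume v: "v \<in> {v. \<forall>j\<in>?F. \<bar>v j - p j\<bar> \<le> d}"
    have "v i \<in> X i" for i
    proof (cases "i \<in> ?F")
      case True
      then have "\<bar>v i - p i\<bar> \<le> e i" using v d[OF True] by (auto intro: order_trans)
      then have "v i \<in> cball (p i) (e i)" by (simp add: dist_real_def abs_minus_commute)
      then show ?thesis using e(2) by blast
    qed simp
    then show "v \<in> Pi\<^sub>E UNIV X" unfolding PiE_def by auto
  qed
  then show ?thesis using that[OF X(3) \<open>0 < d\<close>] X(4) by blast
qed

lemma interior_UN_compact_real:
  fixes K :: "nat \<Rightarrow> real set"
  assumes "\<And>n. compact (K n)" "interior (\<Union>n. K n) \<noteq> {}"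
  obtains n where "interior (K n) \<noteq> {}"
proof -
  have "\<exists>n. interior (K n) \<noteq> {}"
  proof (rule ccontr)
    assume "\<nexists>n. interior (K n) \<noteq> {}"
    then have "interior (\<Union>(range K)) = {}"
      using Baire_category_alt[of "euclidean :: real topology" "range K"]
        completely_metrizable_space_euclidean[where ?'a = real] compact_imp_closed[OF assms(1)] by auto
    then show False using assms(2) by simp
  qed
  then show ?thesis using that by blast
qed

text \<open>The coordinate \<open>\<rho>\<close> bounds all others, so it exhausts \<open>Z\<close> by compact sets definably.\<close>

lemma strong_Baire:
  assumes R: "restrained R"
  shows "finite I \<Longrightarrow> closed Z \<Longrightarrow> dset R M Z \<Longrightarrow> (\<And>w i. w \<in> Z \<Longrightarrow> \<bar>w i\<bar> \<le> w \<rho>) \<Longrightarrow>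
    interior (proj I Z) = {} \<Longrightarrow> interior (closure (proj I Z)) = {}"
proof (induction I arbitrary: Z rule: finite_induct)
  case empty
  have "Z = {}" by (rule interior_proj_empty_index[OF empty(4)])
  then show ?case by (simp add: proj_def)
next
  case (insert i u)
  define Zn where "Zn n = Z \<inter> {w. w \<rho> \<le> real n}" for n
  have Zn: "compact (Zn n)" for n unfolding Zn_def using insert.prems by (intro compact_sublevel) auto
  \<comment> \<open>The part of \<open>Z\<close> in the slab between \<open>q\<close> and
    \<open>r\<close>. A base point lies in its projection exactly if the fibre meets
    \<open>{q..r}\<close>.\<close>
  define Y where "Y q r = Z \<inter> {w. q \<le> w i} \<inter> {w. w i \<le> r}" for q r
  have Y_closed: "closed (Y q r)" for q r
    unfolding Y_def by (intro closed_Int insert.prems closed_Collect_le continuous_intros)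
  have Y_dset: "dset R M (Y q r)" for q r
  proof -
    have "dset R M {w\<in>Z. q \<le> w i \<and> w i \<le> r}"
      by (intro dset_Collect insert.prems dfn.conj dfn_le tm.var tm.const)
    moreover have "{w\<in>Z. q \<le> w i \<and> w i \<le> r} = Y q r" by (auto simp: Y_def)
    ultimately show ?thesis by simp
  qed
  \<comment> \<open>Off this set, being in the closure of the slab's projection already means being
    in the projection. The induction hypothesis makes it nowhere dense.\<close>
  define T where "T q r = closure (proj u (Y q r)) - interior (proj u (Y q r))" for q r
  have T: "closed (T q r) \<and> interior (T q r) = {}" for q r
  proof
    show "closed (T q r)" unfolding T_def by (intro closed_Diff) auto
    show "interior (T q r) = {}"
    proof (rule ccontr)
      assume "interior (T q r) \<noteq> {}"
      then obtain p where p: "p \<in> interior (T q r)" by blast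
      obtain F e where e: "finite F" "0 < e" "{v. \<forall>j\<in>F. \<bar>v j - p j\<bar> \<le> e} \<subseteq> interior (T q r)"
        using open_contains_coordinate_box[OF open_interior p] by blast
      \<comment> \<open>The induction hypothesis needs a projection without interior, whereas that
        of the whole slab may have interior elsewhere; so the slab is cut down to a box about
        \<open>p\<close>.\<close>
      define X where "X = Y q r \<inter> (\<Inter>j\<in>u. {w. \<bar>w j - p j\<bar> \<le> e})"
      have "interior (closure (proj u X)) = {}" if "interior (proj u X) = {}"
      proof (rule insert.IH[OF _ _ _ that])
        show "closed X" unfolding X_def
          by (intro closed_Int Y_closed closed_INT ballI closed_Collect_le continuous_intros)
        have "dset R M {w\<in>Y q r. \<forall>j\<in>u. \<bar>w j - p j\<bar> \<le> e}"
          by (intro dset_Collect Y_dset dfn_ball_finite[OF \<open>finite u\<close>] dfn_abs_le tm_diff tm.var tm.const)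
        moreover have "{w\<in>Y q r. \<forall>j\<in>u. \<bar>w j - p j\<bar> \<le> e} = X" by (auto simp: X_def)
        ultimately show "dset R M X" by simp
        show "\<bar>w i\<bar> \<le> w \<rho>" if "w \<in> X" for w i
          using that insert.prems(3) by (simp add: X_def Y_def)
      qed
      moreover have "p \<in> interior (closure (proj u X))"
      proof -
        define O' where "O' = (\<Inter>j\<in>u. {v. \<bar>v j - p j\<bar> < e})"
        have O': "open O'" unfolding O'_def
          by (intro open_INT \<open>finite u\<close> ballI open_Collect_less continuous_intros)
        have "interior (T q r) \<inter> O' \<subseteq> closure (proj u X)"
        proof
          fix v assume v: "v \<in> interior (T q r) \<inter> O'"
          then have "v \<in> O' \<inter> closure (proj u (Y q r))" using interior_subset unfolding T_def by blast
          then have "v \<in> closure (O' \<inter> proj u (Y q r))"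
            using open_Int_closure_subset[OF O'] by blast
          moreover have "O' \<inter> proj u (Y q r) \<subseteq> proj u X"
          proof
            fix x assume x: "x \<in> O' \<inter> proj u (Y q r)"
            then obtain w where w: "w \<in> Y q r" "\<forall>j\<in>u. w j = x j" by (auto simp: proj_def)
            then have "w \<in> X" using x by (auto simp: X_def O'_def less_imp_le)
            then show "x \<in> proj u X" using w unfolding proj_def by blast
          qed
          ultimately show "v \<in> closure (proj u X)" using closure_mono by blast
        qed
        moreover have "p \<in> interior (T q r) \<inter> O'" using p e(2) by (simp add: O'_def)
        moreover have "open (interior (T q r) \<inter> O')" by (rule open_Int[OF open_interior O'])
        ultimately show ?thesis by (metis interiorI)
      qed
      ultimately have "interior (proj u X) \<noteq> {}" by blast
      then obtain y where y: "y \<in> interior (proj u X)" by blast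
      then have "y \<in> proj u X" using interior_subset by blast
      then have yp: "\<bar>y j - p j\<bar> \<le> e" if "j \<in> u" for j
        using that unfolding proj_def X_def by fastforce
      \<comment> \<open>The box constrains the coordinates in \<open>F\<close>, which need not lie
        in \<open>u\<close>. Outside \<open>u\<close> the point may be changed freely, and taking
        the values of \<open>p\<close> there puts it into the box.\<close>
      let ?y = "\<lambda>j. if j \<in> u then y j else p j"
      have "?y \<in> interior (proj u X)" by (rule interior_proj_cylinder[OF y]) simp
      moreover have "proj u X \<subseteq> proj u (Y q r)" by (rule proj_mono) (auto simp: X_def)
      ultimately have "?y \<in> interior (proj u (Y q r))" using interior_mono by blast
      moreover have "?y \<in> {v. \<forall>j\<in>F. \<bar>v j - p j\<bar> \<le> e}" using yp e(2) by simp
      then have "?y \<in> T q r" by (rule subsetD[OF interior_subset subsetD[OF e(3)]])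
      ultimately show False unfolding T_def by blast
    qed
  qed
  \<comment> \<open>The exceptional base points: those where slabs are not closed enough, and those
    where the fibre of some compact part \<open>Zn n\<close> has interior.\<close>
  define \<G> where "\<G> = (\<lambda>(q, r). T q r) ` {(q, r). q \<in> \<rat> \<and> r \<in> \<rat> \<and> q < r} \<union> (\<Union>n. interval_bases u i (Zn n))"
  have meager: "interior (\<Union>\<G>) = {}"
  proof (rule Baire_functions)
    show "countable \<G>"
      unfolding \<G>_def by (intro countable_Un countable_UN countable_image countable_rational_pairs
          countable_interval_bases) simp
    show "closed S \<and> interior S = {}" if "S \<in> \<G>" for S
    proof (cases "S \<in> (\<Union>n. interval_bases u i (Zn n))")
      case True
      then obtain n where n: "S \<in> interval_bases u i (Zn n)" by blast
      have "proj (insert i u) (Zn n) \<subseteq> proj (insert i u) Z" by (rule proj_mono) (auto simp: Zn_def)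
      then have "interior (proj (insert i u) (Zn n)) = {}"
        using insert.prems(4) interior_mono by blast
      then show ?thesis using interval_bases_nowhere_dense[OF Zn _ insert.hyps(2) n] by blast
    next
      case False
      then show ?thesis using that T unfolding \<G>_def by auto
    qed
  qed
  show ?case
  proof (rule ccontr)
    let ?G = "interior (closure (proj (insert i u) Z))"
    assume "?G \<noteq> {}"
    then obtain g where g: "g \<in> ?G" by blast
    have "open ((\<lambda>v. v(i := g i)) -` ?G)"
      by (intro open_vimage continuous_on_fun_upd continuous_intros open_interior)
    moreover have "g \<in> (\<lambda>v. v(i := g i)) -` ?G" using g by simp
    ultimately have "\<not> (\<lambda>v. v(i := g i)) -` ?G \<subseteq> \<Union>\<G>"
      using meager by (metis empty_iff interiorI)
    then obtain v where v: "v(i := g i) \<in> ?G" "v \<notin> \<Union>\<G>" by blast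
    have "open ((\<lambda>t. v(i := t)) -` ?G)"
      by (rule open_vimage[OF open_interior continuous_on_coordinate_update])
    then obtain e where e: "0 < e" "ball (g i) e \<subseteq> (\<lambda>t. v(i := t)) -` ?G"
      using v(1) by (metis (no_types, lifting) open_contains_ball vimageI)
    \<comment> \<open>Density of the projection near \<open>v\<close> only says that fibres nearby
      meet \<open>{q..r}\<close>; avoiding \<open>T q r\<close> transfers this to the fibre over
      \<open>v\<close> itself. That fibre is thus dense in an interval, so by
      \<open>strong_Baire_line\<close> it has interior, and so has one of its compact parts.\<close>
    have meets: "\<exists>t\<in>fibre u i Z v. q \<le> t \<and> t \<le> r"
      if qr: "q \<in> \<rat>" "r \<in> \<rat>" "q < r" "{q..r} \<subseteq> ball (g i) e" for q r
    proof -
      let ?t = "(q + r) / 2"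
      have "?t \<in> {q..r}" using qr(3) by (simp add: field_simps)
      then have "?t \<in> ball (g i) e" using qr(4) by blast
      then have "v(i := ?t) \<in> ?G" using e(2) by (meson subsetD vimageD)
      then have t: "v(i := ?t) \<in> closure (proj (insert i u) Z)" by (rule subsetD[OF interior_subset])
      have "v \<in> closure (proj u (Y q r))"
        unfolding closure_iff_nhds_not_empty
      proof (intro allI impI)
        fix A U assume AU: "U \<subseteq> A" "v \<in> U" "open U"
        let ?U = "(\<lambda>x. x(i := v i)) -` U \<inter> {x. q < x i} \<inter> {x. x i < r}"
        have "open ?U"
          by (intro open_Int open_vimage AU continuous_on_fun_upd open_Collect_less continuous_intros)
        moreover have "v(i := ?t) \<in> ?U" using AU qr by simp
        ultimately obtain x where x: "x \<in> ?U" "x \<in> proj (insert i u) Z"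
          using t unfolding closure_iff_nhds_not_empty by blast
        then obtain w where w: "w \<in> Z" "\<forall>j\<in>insert i u. w j = x j" by (auto simp: proj_def)
        then have "w \<in> Y q r" using x(1) by (simp add: Y_def)
        moreover have "\<forall>j\<in>u. w j = (x(i := v i)) j" using w insert.hyps(2) by auto
        ultimately have "x(i := v i) \<in> proj u (Y q r)" unfolding proj_def by blast
        then show "proj u (Y q r) \<inter> A \<noteq> {}" using x(1) AU by blast
      qed
      moreover have "v \<notin> T q r" using v(2) qr unfolding \<G>_def by blast
      ultimately have "v \<in> proj u (Y q r)" using interior_subset unfolding T_def by blast
      then show ?thesis unfolding proj_def fibre_def Y_def by fastforce
    qed
    \<comment> \<open>The bounding coordinate is kept as the height that
      \<open>strong_Baire_line\<close> minimizes first.\<close>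
    let ?Pf = "\<lambda>w. (w \<rho>, w i)"
    define P where "P = ?Pf ` {w\<in>Z. \<forall>j\<in>u. w j = v j}"
    have sndP: "snd ` P = fibre u i Z v" by (auto simp: P_def fibre_def image_image)
    have P_closed: "closed P"
    proof (rule closed_if_bounded_parts[of fst])
      fix b
      have "compact ((Z \<inter> {w. w \<rho> \<le> b}) \<inter> (\<Inter>j\<in>u. {w. w j = v j}))"
        using insert.prems
        by (intro compact_Int_closed[OF compact_sublevel] closed_INT ballI closed_Collect_eq continuous_intros) auto
      then have "compact (?Pf ` ((Z \<inter> {w. w \<rho> \<le> b}) \<inter> (\<Inter>j\<in>u. {w. w j = v j})))"
        by (intro compact_continuous_image continuous_intros)
      moreover have "?Pf ` ((Z \<inter> {w. w \<rho> \<le> b}) \<inter> (\<Inter>j\<in>u. {w. w j = v j})) = P \<inter> {x. fst x \<le> b}"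
        by (auto simp: P_def)
      ultimately show "closed (P \<inter> {x. fst x \<le> b})" by (simp add: compact_imp_closed)
    qed (intro continuous_intros)
    have P_dfn: "dfn R (\<lambda>x. (x 0, x 1) \<in> P)"
    proof -
      have "dfn R (\<lambda>x. \<exists>w\<in>Z. (\<forall>j\<in>u. w j = v j) \<and> w \<rho> = x 0 \<and> w i = x 1)"
        by (rule dset_ex[OF insert.prems(2)])
          (intro dfn.conj dfn_ball_finite[OF \<open>finite u\<close>] dfn.eq tm_trunc tm.var tm.const)
      moreover have "(\<exists>w\<in>Z. (\<forall>j\<in>u. w j = v j) \<and> w \<rho> = x 0 \<and> w i = x 1) = ((x 0, x 1) \<in> P)" for x
        unfolding P_def image_iff prod.inject Bex_def mem_Collect_eq by metis
      ultimately show ?thesis by (rule dfn_cong)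
    qed
    have P_bound: "\<bar>t\<bar> \<le> r" if "(r, t) \<in> P" for r t
      using that insert.prems(3) by (auto simp: P_def)
    have "ball (g i) e \<subseteq> closure (snd ` P)"
      unfolding sndP
    proof
      fix x assume x: "x \<in> ball (g i) e"
      show "x \<in> closure (fibre u i Z v)"
        unfolding closure_approachable
      proof (intro allI impI)
        fix h :: real assume "0 < h"
        have "open (ball x h \<inter> ball (g i) e)" by (intro open_Int open_ball)
        moreover have "x \<in> ball x h \<inter> ball (g i) e" using \<open>0 < h\<close> x by simp
        ultimately have "interior (ball x h \<inter> ball (g i) e) \<noteq> {}" by (metis empty_iff interior_open)
        then obtain q r where qr: "q \<in> \<rat>" "r \<in> \<rat>" "q < r" "{q..r} \<subseteq> ball x h \<inter> ball (g i) e"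
          by (rule rational_subinterval)
        then obtain t where t: "t \<in> fibre u i Z v" "q \<le> t \<and> t \<le> r" using meets by blast
        then have "t \<in> {q..r}" by simp
        then have "t \<in> ball x h" using qr(4) by blast
        then show "\<exists>y\<in>fibre u i Z v. dist y x < h" using t(1) by (auto simp: dist_commute)
      qed
    qed
    then have "g i \<in> interior (closure (snd ` P))"
      using e(1) by (intro interiorI[of "ball (g i) e"]) simp_all
    then have "interior (snd ` P) \<noteq> {}"
      using strong_Baire_line[OF R P_dfn P_closed P_bound] by blast
    moreover have "snd ` P = (\<Union>n. fibre u i (Zn n) v)"
      unfolding sndP
    proof
      show "fibre u i Z v \<subseteq> (\<Union>n. fibre u i (Zn n) v)"
      proof
        fix t assume "t \<in> fibre u i Z v"
        then obtain w where w: "w \<in> Z" "\<forall>j\<in>u. w j = v j" "t = w i" by (auto simp: fibre_def)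
        obtain n where "w \<rho> \<le> real n" using real_arch_simple by blast
        then show "t \<in> (\<Union>n. fibre u i (Zn n) v)" using w by (auto simp: fibre_def Zn_def)
      qed
    qed (auto simp: fibre_def Zn_def)
    ultimately have "interior (\<Union>n. fibre u i (Zn n) v) \<noteq> {}" by simp
    then obtain n where "interior (fibre u i (Zn n) v) \<noteq> {}"
      by (rule interior_UN_compact_real[OF compact_fibre[OF Zn]])
    from fibre_interior_interval_bases[OF this] show False using v(2) unfolding \<G>_def by blast
  qed
qed

subsection \<open>A discrete Frostman lemma\<close>

text \<open>Mass is assigned at the finest level so that each cell is exactly full, and then each
  coarser level scales down its overfull cells. A point never loses its full cell without gaining a
  coarser one: either its cell at the new level is not rescaled, or it becomes exactly full.
  \<open>n\<close> counts the levels treated so far.\<close>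

lemma finite_Frostman:
  fixes q :: "nat \<Rightarrow> 'a \<Rightarrow> 'c" and g :: "nat \<Rightarrow> real"
  assumes P: "finite P" and g: "\<And>i. 0 < g i"
    and refine: "\<And>i j x y. i \<le> j \<Longrightarrow> q j x = q j y \<Longrightarrow> q i x = q i y"
  shows "n \<le> k \<Longrightarrow> \<exists>w. (\<forall>x. 0 \<le> w x) \<and> (\<forall>i c. k - n \<le> i \<and> i \<le> k \<longrightarrow> sum w {x\<in>P. q i x = c} \<le> g i)
    \<and> (\<forall>x\<in>P. \<exists>i. k - n \<le> i \<and> i \<le> k \<and> sum w {y\<in>P. q i y = q i x} = g i)"
proof (induction n)
  case 0
  define w where "w x = g k / card {y\<in>P. q k y = q k x}" for x
  have eq: "sum w {y\<in>P. q k y = q k x} = g k" if "x \<in> P" for x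
  proof -
    have "sum w {y\<in>P. q k y = q k x} = (\<Sum>y\<in>{y\<in>P. q k y = q k x}. g k / card {y\<in>P. q k y = q k x})"
      unfolding w_def by (intro sum.cong) auto
    moreover have "card {y\<in>P. q k y = q k x} \<noteq> 0" using P that by auto
    ultimately show ?thesis by simp
  qed
  show ?case
  proof (intro exI[of _ w] conjI allI ballI impI)
    show "0 \<le> w x" for x using g[of k] by (simp add: w_def)
    fix i c assume "k - 0 \<le> i \<and> i \<le> k"
    then have "i = k" by simp
    show "sum w {x\<in>P. q i x = c} \<le> g i"
    proof (cases "\<exists>x\<in>P. q i x = c")
      case True
      then show ?thesis using eq \<open>i = k\<close> by auto
    next
      case False
      then have "{x\<in>P. q i x = c} = {}" by blast
      then show ?thesis using g[of i] by (simp only: sum.empty less_imp_le)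
    qed
  next
    fix x assume "x \<in> P"
    then show "\<exists>i. k - 0 \<le> i \<and> i \<le> k \<and> sum w {y\<in>P. q i y = q i x} = g i"
      using eq by (intro exI[of _ k]) simp
  qed
next
  case (Suc n)
  define j where "j = k - Suc n"
  have j: "k - n = Suc j" "Suc j \<le> k" using Suc.prems by (auto simp: j_def)
  from Suc.IH[OF Suc_leD[OF Suc.prems], unfolded j(1)] obtain w where w0: "\<forall>x. 0 \<le> w x"
    "\<forall>i c. Suc j \<le> i \<and> i \<le> k \<longrightarrow> sum w {x\<in>P. q i x = c} \<le> g i"
    "\<forall>x\<in>P. \<exists>i. Suc j \<le> i \<and> i \<le> k \<and> sum w {y\<in>P. q i y = q i x} = g i"
    by blast
  then have w: "\<And>x. 0 \<le> w x"
    "\<And>i c. Suc j \<le> i \<Longrightarrow> i \<le> k \<Longrightarrow> sum w {x\<in>P. q i x = c} \<le> g i"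
    "\<And>x. x \<in> P \<Longrightarrow> \<exists>i. Suc j \<le> i \<and> i \<le> k \<and> sum w {y\<in>P. q i y = q i x} = g i"
    by blast+
  define m where "m c = sum w {y\<in>P. q j y = c}" for c
  \<comment> \<open>The factor is constant on each cell of level \<open>j\<close>, so all finer
    cells inside are scaled uniformly.\<close>
  define f where "f c = (if m c \<le> g j then 1 else g j / m c)" for c
  define w' where "w' x = w x * f (q j x)" for x
  have f: "0 \<le> f c" "f c \<le> 1" for c
    using g[of j] by (simp_all add: f_def)
  have scale: "sum w' {y\<in>P. q i y = q i x} = sum w {y\<in>P. q i y = q i x} * f (q j x)" if "j \<le> i" for i x
    unfolding w'_def sum_distrib_right
  proof (rule sum.cong[OF refl])
    fix y assume "y \<in> {y\<in>P. q i y = q i x}"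
    then have "q i y = q i x" by simp
    from refine[OF that this] show "w y * f (q j y) = w y * f (q j x)" by simp
  qed
  have nonneg: "0 \<le> w' x" for x using w(1) f by (simp add: w'_def)
  show ?case
  proof (intro exI[of _ w'] conjI allI ballI impI)
    show "0 \<le> w' x" for x by (rule nonneg)
    fix i c assume i: "k - Suc n \<le> i \<and> i \<le> k"
    show "sum w' {x\<in>P. q i x = c} \<le> g i"
    proof (cases "\<exists>x\<in>P. q i x = c")
      case True
      then obtain x where x: "x \<in> P" "q i x = c" by blast
      have s: "sum w' {x\<in>P. q i x = c} = sum w {x\<in>P. q i x = c} * f (q j x)"
        using scale[of i x] i x by (simp add: j_def)
      show ?thesis
      proof (cases "i = j")
        case True
        then have "sum w' {x\<in>P. q i x = c} = m c * f c" using s x by (simp add: m_def)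
        also have "\<dots> \<le> g j" using g[of j] by (simp add: f_def)
        finally show ?thesis using True by simp
      next
        case False
        then have "sum w {x\<in>P. q i x = c} \<le> g i" using i by (intro w(2)) (auto simp: j_def)
        moreover have "sum w {x\<in>P. q i x = c} * f (q j x) \<le> sum w {x\<in>P. q i x = c}"
          using f w(1) by (intro mult_left_le sum_nonneg) auto
        ultimately show ?thesis unfolding s by linarith
      qed
    next
      case False
      then have "{x\<in>P. q i x = c} = {}" by blast
      then show ?thesis using g[of i] by (simp only: sum.empty less_imp_le)
    qed
  next
    fix x assume x: "x \<in> P"
    show "\<exists>i. k - Suc n \<le> i \<and> i \<le> k \<and> sum w' {y\<in>P. q i y = q i x} = g i"
    proof (cases "m (q j x) \<le> g j")
      case True
      then have "f (q j x) = 1" by (simp add: f_def)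
      moreover obtain i where "Suc j \<le> i \<and> i \<le> k \<and> sum w {y\<in>P. q i y = q i x} = g i"
        using w(3)[OF x] by blast
      ultimately show ?thesis using scale[of i x] by (intro exI[of _ i]) (auto simp: j_def)
    next
      case False
      then have "sum w {y\<in>P. q j y = q j x} * f (q j x) = g j"
        using g[of j] by (simp add: f_def flip: m_def)
      then show ?thesis using scale[of j x] j by (intro exI[of _ j]) (auto simp: j_def)
    qed
  qed
qed

text \<open>Each point takes its coarsest full cell. Cells are nested, and two overlapping chosen
  ones coincide by this maximality; hence they are disjoint and their capacities add up to at most
  the total mass.\<close>

lemma saturated_cover:
  fixes q :: "nat \<Rightarrow> 'a \<Rightarrow> 'c" and g :: "nat \<Rightarrow> real"
  assumes P: "finite P" and w: "\<And>x. 0 \<le> w x"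
    and refine: "\<And>i j x y. i \<le> j \<Longrightarrow> q j x = q j y \<Longrightarrow> q i x = q i y"
    and sat: "\<And>x. x \<in> P \<Longrightarrow> \<exists>i\<le>k. sum w {y\<in>P. q i y = q i x} = g i"
  obtains \<C> where "finite \<C>" "\<And>x. x \<in> P \<Longrightarrow> \<exists>i\<le>k. (i, q i x) \<in> \<C>" "\<And>i c. (i, c) \<in> \<C> \<Longrightarrow> i \<le> k"
    "(\<Sum>(i, c)\<in>\<C>. g i) \<le> sum w P"
proof -
  define m where "m x = (LEAST i. sum w {y\<in>P. q i y = q i x} = g i)" for x
  have m: "sum w {y\<in>P. q (m x) y = q (m x) x} = g (m x)" "m x \<le> k" if "x \<in> P" for x
  proof -
    obtain i where i: "i \<le> k" "sum w {y\<in>P. q i y = q i x} = g i" using sat[OF \<open>x \<in> P\<close>] by blast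
    show "sum w {y\<in>P. q (m x) y = q (m x) x} = g (m x)" unfolding m_def using i(2) by (rule LeastI)
    have "m x \<le> i" unfolding m_def using i(2) by (rule Least_le)
    then show "m x \<le> k" using i(1) by simp
  qed
  have m_le: "m x \<le> i" if "sum w {y\<in>P. q i y = q i x} = g i" for x i
    unfolding m_def using that by (rule Least_le)
  define K where "K p = {y\<in>P. q (fst p) y = snd p}" for p
  define \<C> where "\<C> = (\<lambda>x. (m x, q (m x) x)) ` P"
  have same: "m x = m y \<and> q (m x) x = q (m y) y"
    if "x \<in> P" "y \<in> P" "z \<in> K (m x, q (m x) x)" "z \<in> K (m y, q (m y) y)" "m x \<le> m y" for x y z
  proof -
    have z: "q (m x) z = q (m x) x" "q (m y) z = q (m y) y" using that by (auto simp: K_def)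
    have "q (m x) y = q (m x) x" using refine[OF that(5) z(2)] z(1) by simp
    moreover from this have "m y \<le> m x" using m(1)[OF \<open>x \<in> P\<close>] by (intro m_le) simp
    ultimately show ?thesis using that(5) by (metis le_antisym)
  qed
  have disj: "K p \<inter> K p' = {}" if pp: "p \<in> \<C>" "p' \<in> \<C>" "p \<noteq> p'" for p p'
  proof (rule ccontr)
    assume "K p \<inter> K p' \<noteq> {}"
    then obtain z where z: "z \<in> K p" "z \<in> K p'" by blast
    obtain x y where xy: "x \<in> P" "y \<in> P" "p = (m x, q (m x) x)" "p' = (m y, q (m y) y)"
      using pp unfolding \<C>_def by blast
    show False
      using same[OF xy(1,2), of z] same[OF xy(2,1), of z] z pp(3) unfolding xy(3,4)
      by (cases "m x \<le> m y") auto
  qed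
  show thesis
  proof (rule that[of \<C>])
    show "finite \<C>" unfolding \<C>_def using P by simp
    show "\<exists>i\<le>k. (i, q i x) \<in> \<C>" if "x \<in> P" for x
      using m(2)[OF that] that by (intro exI[of _ "m x"]) (auto simp: \<C>_def)
    show "i \<le> k" if "(i, c) \<in> \<C>" for i c using that m(2) by (auto simp: \<C>_def)
    have "(\<Sum>(i, c)\<in>\<C>. g i) = (\<Sum>p\<in>\<C>. sum w (K p))"
      using m(1) by (intro sum.cong) (auto simp: \<C>_def K_def)
    also have "\<dots> = sum w (\<Union>p\<in>\<C>. K p)"
      using disj \<open>finite \<C>\<close> P by (subst sum.UNION_disjoint) (auto simp: K_def)
    also have "\<dots> \<le> sum w P" using P w by (intro sum_mono2) (auto simp: K_def)
    finally show "(\<Sum>(i, c)\<in>\<C>. g i) \<le> sum w P" .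
  qed
qed

section \<open>Dyadic cubes and discrete Frostman weights\<close>

definition cube :: "nat \<Rightarrow> (nat \<Rightarrow> real) \<Rightarrow> nat \<Rightarrow> int" where
  "cube i x = (\<lambda>j. \<lfloor>2 ^ i * x j\<rfloor>)"

lemma cube_refine:
  assumes "i \<le> j" "cube j x = cube j y"
  shows "cube i x = cube i y"
proof
  fix l
  have eq: "\<lfloor>2 ^ i * z\<rfloor> = \<lfloor>2 ^ j * z\<rfloor> div 2 ^ (j - i)" for z :: real
  proof -
    have "(2 :: real) ^ j = 2 ^ i * 2 ^ (j - i)"
      using assms(1) by (simp flip: power_add)
    then have "2 ^ i * z = 2 ^ j * z / real_of_int (2 ^ (j - i))"
      by (simp only: of_int_power of_int_numeral) simp
    then show ?thesis by (metis floor_divide_real_eq_div zero_le_numeral zero_le_power)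
  qed
  show "cube i x l = cube i y l"
    using fun_cong[OF assms(2), of l] unfolding cube_def eq[of "x l"] eq[of "y l"] by simp
qed

lemma finite_cubes:
  assumes "\<And>x j. x \<in> W \<Longrightarrow> \<bar>x j\<bar> \<le> b" "\<And>x j. x \<in> W \<Longrightarrow> j \<ge> M \<Longrightarrow> x j = 0"
  shows "finite (cube i ` W)"
proof -
  define B where "B = \<lceil>2 ^ i * b\<rceil> + 1"
  have "cube i ` W \<subseteq> {c. \<forall>j. (j \<in> {..<M} \<longrightarrow> c j \<in> {-B..B}) \<and> (j \<notin> {..<M} \<longrightarrow> c j = 0)}"
  proof clarify
    fix x j assume x: "x \<in> W"
    have "\<bar>2 ^ i * x j\<bar> \<le> 2 ^ i * b" using assms(1)[OF x] by (simp add: abs_mult)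
    then have "cube i x j \<in> {-B..B}"
      unfolding cube_def B_def by (simp, linarith)
    moreover have "j \<notin> {..<M} \<Longrightarrow> cube i x j = 0" using assms(2)[OF x] by (simp add: cube_def)
    ultimately show "(j \<in> {..<M} \<longrightarrow> cube i x j \<in> {-B..B}) \<and> (j \<notin> {..<M} \<longrightarrow> cube i x j = 0)" by blast
  qed
  moreover have "finite {c :: nat \<Rightarrow> int. \<forall>j. (j \<in> {..<M} \<longrightarrow> c j \<in> {-B..B}) \<and> (j \<notin> {..<M} \<longrightarrow> c j = 0)}"
    by (rule finite_set_of_finite_funs) auto
  ultimately show ?thesis by (rule finite_subset)
qed

lemma floor_scaled_eq_imp_close:
  fixes x y :: real
  assumes "\<lfloor>2 ^ k * x\<rfloor> = \<lfloor>2 ^ k * y\<rfloor>"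
  shows "\<bar>x - y\<bar> \<le> (1 / 2) ^ k"
proof -
  have "\<bar>2 ^ k * x - 2 ^ k * y\<bar> \<le> 1" using assms by linarith
  moreover have "\<bar>2 ^ k * x - 2 ^ k * y\<bar> = 2 ^ k * \<bar>x - y\<bar>"
    by (simp add: abs_mult flip: right_diff_distrib)
  ultimately show ?thesis by (simp add: power_divide field_simps)
qed

definition near :: "nat \<Rightarrow> (nat \<Rightarrow> real) \<Rightarrow> (nat \<Rightarrow> real) \<Rightarrow> bool" where
  "near i x y \<longleftrightarrow> (\<forall>j. \<bar>x j - y j\<bar> \<le> (1 / 2) ^ i)"

text \<open>A substitute for a Frostman measure of exponent \<open>t\<close>: the weights may change
  with the finest scale \<open>k\<close>, while \<open>C\<close>, \<open>B\<close> and
  \<open>c\<close> may not.\<close>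

definition frostman :: "real \<Rightarrow> (nat \<Rightarrow> real) set \<Rightarrow> bool" where
  "frostman t V \<longleftrightarrow> (\<exists>C B c. 0 < c \<and> (\<forall>k. \<exists>P w. finite P \<and> P \<subseteq> V \<and> (\<forall>x. 0 \<le> w x) \<and>
     c \<le> sum w P \<and> sum w P \<le> B \<and>
     (\<forall>i\<le>k. \<forall>z. sum w {x\<in>P. near i x z} \<le> C * 2 powr (- (t * real i)))))"

text \<open>A sup-norm ball of radius 2^-i meets only the cube of its centre and adjacent ones, in
  each coordinate at most three.\<close>

lemma near_cubes:
  assumes "near i x z" "\<And>j. j \<ge> M \<Longrightarrow> x j = 0"
  shows "cube i x \<in> {c. \<forall>j. (j \<in> {..<M} \<longrightarrow> c j - cube i z j \<in> {-1..1}) \<and> (j \<notin> {..<M} \<longrightarrow> c j = 0)}"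
proof clarify
  fix j
  have "\<bar>2 ^ i * x j - 2 ^ i * z j\<bar> = 2 ^ i * \<bar>x j - z j\<bar>"
    by (simp add: abs_mult flip: right_diff_distrib)
  also have "\<dots> \<le> 2 ^ i * (1 / 2) ^ i" using assms(1) by (simp add: near_def)
  also have "\<dots> = 1" by (simp add: power_divide)
  finally have "\<bar>2 ^ i * x j - 2 ^ i * z j\<bar> \<le> 1" .
  then have "cube i x j - cube i z j \<in> {-1..1}" unfolding cube_def by (simp, linarith)
  then show "(j \<in> {..<M} \<longrightarrow> cube i x j - cube i z j \<in> {-1..1}) \<and> (j \<notin> {..<M} \<longrightarrow> cube i x j = 0)"
    using assms(2)[of j] by (auto simp: cube_def)
qed

lemma card_adjacent_cubes:
  fixes b :: "nat \<Rightarrow> int" and M :: nat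
  defines "S \<equiv> {c. \<forall>j. (j \<in> {..<M} \<longrightarrow> c j - b j \<in> {-1..1}) \<and> (j \<notin> {..<M} \<longrightarrow> c j = 0)}"
  shows "finite S \<and> card S \<le> 3 ^ M"
proof -
  let ?E = "{..<M} \<rightarrow>\<^sub>E {-1..1 :: int}"
  let ?f = "\<lambda>d j. if j < M then b j + d j else 0"
  have "S \<subseteq> ?f ` ?E"
  proof
    fix c assume c: "c \<in> S"
    show "c \<in> ?f ` ?E"
    proof (rule image_eqI)
      show "restrict (\<lambda>j. c j - b j) {..<M} \<in> ?E" using c by (auto simp: S_def)
      show "c = ?f (restrict (\<lambda>j. c j - b j) {..<M})" using c by (auto simp: S_def)
    qed
  qed
  moreover have fin: "finite ?E" by (intro finite_PiE) auto
  ultimately have "finite S" "card S \<le> card (?f ` ?E)"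
    by (auto intro: finite_subset card_mono)
  moreover have "card (?f ` ?E) \<le> card ?E" using fin by (rule card_image_le)
  moreover have "card ?E = 3 ^ M" by (simp add: card_PiE)
  ultimately show ?thesis by simp
qed

text \<open>The weights of \<open>finite_Frostman\<close> on representatives of the cubes of level
  \<open>k\<close> have total mass at least the content, because their full cells cover all of
  \<open>W\<close>.\<close>

lemma frostman_of_content:
  assumes bnd: "\<And>x j. x \<in> W \<Longrightarrow> \<bar>x j\<bar> \<le> b" and supp: "\<And>x j. x \<in> W \<Longrightarrow> j \<ge> M \<Longrightarrow> x j = 0"
    and "0 < c" and content: "\<And>\<C>. finite \<C> \<Longrightarrow> (\<And>x. x \<in> W \<Longrightarrow> \<exists>i. (i, cube i x) \<in> \<C>) \<Longrightarrow>
      c \<le> (\<Sum>(i, q)\<in>\<C>. 2 powr (- (s * real i)))"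
  shows "frostman s W"
  unfolding frostman_def
proof (rule exI[of _ "3 ^ M"], rule exI[of _ "real (card (cube 0 ` W))"], rule exI[of _ c], intro conjI allI)
  show "0 < c" by fact
  fix k
  let ?g = "\<lambda>i. 2 powr (- (s * real i))"
  have fin: "finite (cube i ` W)" for i
    by (rule finite_cubes[of W b M]) (simp_all add: bnd supp)
  have "\<exists>P. P \<subseteq> W \<and> finite P \<and> cube k ` P = cube k ` W"
    using finite_subset_image[OF fin[of k] order_refl] by metis
  then obtain P where P: "P \<subseteq> W" "finite P" "cube k ` P = cube k ` W" by blast
  \<comment> \<open>The shape of \<open>finite_Frostman\<close> for \<open>n = k\<close>, so that
    \<open>k - k\<close> is level 0.\<close>
  have "\<exists>w. (\<forall>x. 0 \<le> w x) \<and> (\<forall>i q. k - k \<le> i \<and> i \<le> k \<longrightarrow> sum w {x\<in>P. cube i x = q} \<le> ?g i)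
    \<and> (\<forall>x\<in>P. \<exists>i. k - k \<le> i \<and> i \<le> k \<and> sum w {y\<in>P. cube i y = cube i x} = ?g i)"
  proof (rule finite_Frostman[OF P(2)])
    show "cube i x = cube i y" if "i \<le> j" "cube j x = cube j y" for i j x y
      using that by (rule cube_refine)
  qed simp_all
  then obtain w where w0: "\<forall>x. 0 \<le> w x"
    "\<forall>i q. k - k \<le> i \<and> i \<le> k \<longrightarrow> sum w {x\<in>P. cube i x = q} \<le> ?g i"
    "\<forall>x\<in>P. \<exists>i. k - k \<le> i \<and> i \<le> k \<and> sum w {y\<in>P. cube i y = cube i x} = ?g i"
    by (elim exE conjE)
  have w: "0 \<le> w x" "i \<le> k \<Longrightarrow> sum w {x\<in>P. cube i x = q} \<le> ?g i" for x i q
    using w0(1,2) by simp_all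
  have sat: "\<exists>i\<le>k. sum w {y\<in>P. cube i y = cube i x} = ?g i" if "x \<in> P" for x
    using bspec[OF w0(3) that] by blast
  obtain \<C> where \<C>: "finite \<C>" "\<And>x. x \<in> P \<Longrightarrow> \<exists>i\<le>k. (i, cube i x) \<in> \<C>" "(\<Sum>(i, q)\<in>\<C>. ?g i) \<le> sum w P"
    by (rule saturated_cover[where q = cube and g = ?g, OF P(2) w(1) cube_refine sat]) simp_all
  \<comment> \<open>Every point of \<open>W\<close> shares its cube of level \<open>k\<close> with
    some point of \<open>P\<close>, hence also all coarser cubes; this is why the levels in the
    cover must not exceed \<open>k\<close>.\<close>
  have cover: "\<exists>i. (i, cube i x) \<in> \<C>" if "x \<in> W" for x
  proof -
    have "cube k x \<in> cube k ` P" using that P(3) by simp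
    then obtain p where p: "p \<in> P" "cube k x = cube k p" by auto
    obtain i where "i \<le> k" "(i, cube i p) \<in> \<C>" using \<C>(2)[OF p(1)] by blast
    then show ?thesis using cube_refine[OF _ p(2)] by metis
  qed
  \<comment> \<open>At level 0 each cube carries mass at most 1.\<close>
  have total: "sum w P \<le> card (cube 0 ` W)"
  proof -
    have "sum w P = (\<Sum>q\<in>cube 0 ` P. sum w {x\<in>P. cube 0 x = q})"
      using P(2) by (rule sum.image_gen)
    also have "\<dots> \<le> (\<Sum>q\<in>cube 0 ` P. 1)"
      using w(2)[of 0] by (intro sum_mono) simp
    also have "\<dots> \<le> card (cube 0 ` W)"
      using card_mono[OF fin, of "cube 0 ` P" 0] P(1) by auto
    finally show ?thesis .
  qed
  have ball: "sum w {x\<in>P. near i x z} \<le> 3 ^ M * ?g i" if "i \<le> k" for i z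
  proof -
    let ?S = "{q. \<forall>j. (j \<in> {..<M} \<longrightarrow> q j - cube i z j \<in> {-1..1}) \<and> (j \<notin> {..<M} \<longrightarrow> q j = 0)}"
    have S: "finite ?S" "card ?S \<le> 3 ^ M" using card_adjacent_cubes[of M "cube i z"] by auto
    have "{x\<in>P. near i x z} \<subseteq> (\<Union>q\<in>?S. {x\<in>P. cube i x = q})"
      using near_cubes[of i _ z M] supp P(1) by blast
    then have "sum w {x\<in>P. near i x z} \<le> sum w (\<Union>q\<in>?S. {x\<in>P. cube i x = q})"
      using P(2) w(1) S(1) by (intro sum_mono2) auto
    also have "\<dots> = (\<Sum>q\<in>?S. sum w {x\<in>P. cube i x = q})"
      using S(1) P(2) by (intro sum.UNION_disjoint) auto
    also have "\<dots> \<le> (\<Sum>q\<in>?S. ?g i)" using w(2)[OF that] by (intro sum_mono)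
    also have "\<dots> = card ?S * ?g i" by simp
    also have "\<dots> \<le> 3 ^ M * ?g i"
    proof (rule mult_right_mono)
      have "real (card ?S) \<le> real (3 ^ M)" using S(2) by (simp only: of_nat_le_iff)
      then show "real (card ?S) \<le> 3 ^ M" by simp
    qed simp
    finally show ?thesis .
  qed
  show "\<exists>P w. finite P \<and> P \<subseteq> W \<and> (\<forall>x. 0 \<le> w x) \<and> c \<le> sum w P \<and> sum w P \<le> card (cube 0 ` W) \<and>
     (\<forall>i\<le>k. \<forall>z. sum w {x\<in>P. near i x z} \<le> 3 ^ M * 2 powr (- (s * real i)))"
    using P w(1) content[OF \<C>(1) cover] \<C>(3) total ball by (intro exI[of _ P] exI[of _ w]) auto
qed

text \<open>Product weights work: \<open>near\<close> is a sup-norm condition, so a ball in the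
  product is a product of balls and the exponents add.\<close>

lemma frostman_join_set:
  assumes V1: "frostman t1 V1" "\<And>x j. x \<in> V1 \<Longrightarrow> j \<ge> M \<Longrightarrow> x j = 0" and V2: "frostman t2 V2"
  shows "frostman (t1 + t2) (join_set M V1 V2)"
proof -
  obtain C1 B1 c1 where 1: "0 < c1" "\<And>k. \<exists>P w. finite P \<and> P \<subseteq> V1 \<and> (\<forall>x. 0 \<le> w x) \<and>
     c1 \<le> sum w P \<and> sum w P \<le> B1 \<and> (\<forall>i\<le>k. \<forall>z. sum w {x\<in>P. near i x z} \<le> C1 * 2 powr (- (t1 * real i)))"
    using V1(1) unfolding frostman_def by blast
  obtain C2 B2 c2 where 2: "0 < c2" "\<And>k. \<exists>P w. finite P \<and> P \<subseteq> V2 \<and> (\<forall>x. 0 \<le> w x) \<and>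
     c2 \<le> sum w P \<and> sum w P \<le> B2 \<and> (\<forall>i\<le>k. \<forall>z. sum w {x\<in>P. near i x z} \<le> C2 * 2 powr (- (t2 * real i)))"
    using V2 unfolding frostman_def by blast
  show ?thesis
    unfolding frostman_def
  proof (rule exI[of _ "C1 * C2"], rule exI[of _ "B1 * B2"], rule exI[of _ "c1 * c2"], intro conjI allI)
    show "0 < c1 * c2" using 1(1) 2(1) by simp
    fix k
    obtain P1 w1 where P1: "finite P1" "P1 \<subseteq> V1" "\<forall>x. 0 \<le> w1 x" "c1 \<le> sum w1 P1" "sum w1 P1 \<le> B1"
      "\<forall>i\<le>k. \<forall>z. sum w1 {x\<in>P1. near i x z} \<le> C1 * 2 powr (- (t1 * real i))"
      using 1(2)[of k] by blast
    obtain P2 w2 where P2: "finite P2" "P2 \<subseteq> V2" "\<forall>x. 0 \<le> w2 x" "c2 \<le> sum w2 P2" "sum w2 P2 \<le> B2"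
      "\<forall>i\<le>k. \<forall>z. sum w2 {x\<in>P2. near i x z} \<le> C2 * 2 powr (- (t2 * real i))"
      using 2(2)[of k] by blast
    define P where "P = join_set M P1 P2"
    define w where "w x = w1 (trunc M x) * w2 (\<lambda>i. x (i + M))" for x
    have t: "trunc M (join M x y) = x" "(\<lambda>i. join M x y (i + M)) = y" if "x \<in> P1" for x y
      using that P1(2) V1(2) by (auto simp: trunc_def join_def fun_eq_iff)
    have inj: "inj_on (\<lambda>(x, y). join M x y) (P1 \<times> P2)"
    proof (rule inj_onI, clarify)
      fix x y x' y' assume "x \<in> P1" "x' \<in> P1" and eq: "join M x y = join M x' y'"
      then show "x = x' \<and> y = y'" using t[of x y] t[of x' y'] by simp
    qed
    have sumP: "sum w ((\<lambda>(x, y). join M x y) ` (A1 \<times> A2)) = sum w1 A1 * sum w2 A2"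
      if "A1 \<subseteq> P1" "A2 \<subseteq> P2" for A1 A2
    proof -
      have "sum w ((\<lambda>(x, y). join M x y) ` (A1 \<times> A2)) = (\<Sum>(x, y)\<in>A1 \<times> A2. w (join M x y))"
        using inj_on_subset[OF inj, of "A1 \<times> A2"] that by (subst sum.reindex) (auto simp: split_def intro: Sigma_mono)
      also have "\<dots> = (\<Sum>(x, y)\<in>A1 \<times> A2. w1 x * w2 y)"
        using that t by (intro sum.cong) (auto simp: w_def)
      also have "\<dots> = sum w1 A1 * sum w2 A2"
        by (simp add: sum_product sum.cartesian_product)
      finally show ?thesis .
    qed
    have total: "sum w P = sum w1 P1 * sum w2 P2"
      unfolding P_def join_set_def by (rule sumP) auto
    have ball: "sum w {x\<in>P. near i x z} \<le> (C1 * C2) * 2 powr (- ((t1 + t2) * real i))" if "i \<le> k" for i z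
    proof -
      let ?A1 = "{x\<in>P1. near i x (trunc M z)}" and ?A2 = "{x\<in>P2. near i x (\<lambda>i. z (i + M))}"
      have sub: "{x\<in>P. near i x z} \<subseteq> (\<lambda>(x, y). join M x y) ` (?A1 \<times> ?A2)"
      proof
        fix v assume "v \<in> {x\<in>P. near i x z}"
        then obtain x y where xy: "x \<in> P1" "y \<in> P2" "v = join M x y" "near i v z"
          by (auto simp: P_def join_set_def)
        have "near i x (trunc M z)"
          unfolding near_def
        proof
          fix j
          show "\<bar>x j - trunc M z j\<bar> \<le> (1 / 2) ^ i"
            using xy(4)[unfolded near_def, rule_format, of j] xy V1(2)[of x j] P1(2)
            by (cases "j < M") (auto simp: trunc_def join_def)
        qed
        moreover have "near i y (\<lambda>i. z (i + M))"
          unfolding near_def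
        proof
          fix j
          show "\<bar>y j - z (j + M)\<bar> \<le> (1 / 2) ^ i"
            using xy(4)[unfolded near_def, rule_format, of "j + M"] xy by (simp add: join_def)
        qed
        ultimately show "v \<in> (\<lambda>(x, y). join M x y) ` (?A1 \<times> ?A2)" using xy by auto
      qed
      have "sum w {x\<in>P. near i x z} \<le> sum w ((\<lambda>(x, y). join M x y) ` (?A1 \<times> ?A2))"
        using P1(1,3) P2(1,3) by (intro sum_mono2[OF _ sub]) (auto simp: w_def)
      also have "\<dots> = sum w1 ?A1 * sum w2 ?A2" by (rule sumP) auto
      also have "\<dots> \<le> (C1 * 2 powr (- (t1 * real i))) * (C2 * 2 powr (- (t2 * real i)))"
      proof (rule mult_mono)
        show "sum w1 ?A1 \<le> C1 * 2 powr (- (t1 * real i))" "sum w2 ?A2 \<le> C2 * 2 powr (- (t2 * real i))"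
          using P1(6) P2(6) that by blast+
        show "0 \<le> sum w2 ?A2" using P2(3) by (intro sum_nonneg) auto
        have "0 \<le> sum w1 ?A1" using P1(3) by (intro sum_nonneg) auto
        then show "0 \<le> C1 * 2 powr (- (t1 * real i))" using P1(6) that by (meson order_trans)
      qed
      also have "\<dots> = (C1 * C2) * 2 powr (- ((t1 + t2) * real i))"
        by (simp add: powr_add[symmetric] algebra_simps)
      finally show ?thesis .
    qed
    have "c1 * c2 \<le> sum w P" "sum w P \<le> B1 * B2"
      unfolding total using 1(1) 2(1) P1(4,5) P2(4,5) by (auto intro!: mult_mono)
    moreover have "finite P" "P \<subseteq> join_set M V1 V2"
      using P1(1,2) P2(1,2) by (auto simp: P_def join_set_def)
    moreover have "\<forall>x. 0 \<le> w x" using P1(3) P2(3) by (simp add: w_def)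
    ultimately show "\<exists>P w. finite P \<and> P \<subseteq> join_set M V1 V2 \<and> (\<forall>x. 0 \<le> w x) \<and>
      c1 * c2 \<le> sum w P \<and> sum w P \<le> B1 * B2 \<and>
      (\<forall>i\<le>k. \<forall>z. sum w {x\<in>P. near i x z} \<le> (C1 * C2) * 2 powr (- ((t1 + t2) * real i)))"
      using ball by (intro exI[of _ P] exI[of _ w]) simp
  qed
qed

subsection \<open>Energy and linear projections\<close>

lemma card_close_nats:
  fixes S :: "nat set"
  assumes "finite S" "0 \<le> l" "\<And>x y. x \<in> S \<Longrightarrow> y \<in> S \<Longrightarrow> real y - real x \<le> l"
  shows "real (card S) \<le> l + 1"
proof (cases "S = {}")
  case False
  have "S \<subseteq> {Min S..Min S + nat \<lfloor>l\<rfloor>}"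
  proof
    fix y assume y: "y \<in> S"
    have "Min S \<le> y" using assms(1) y by simp
    moreover have "real y - real (Min S) \<le> l" using assms(1,3) False y by (meson Min_in)
    then have "y \<le> Min S + nat \<lfloor>l\<rfloor>" using \<open>Min S \<le> y\<close> by linarith
    ultimately show "y \<in> {Min S..Min S + nat \<lfloor>l\<rfloor>}" by simp
  qed
  then have "card S \<le> card {Min S..Min S + nat \<lfloor>l\<rfloor>}" by (rule card_mono[OF finite_atLeastAtMost])
  then have "card S \<le> nat \<lfloor>l\<rfloor> + 1" by simp
  then show ?thesis using assms(2) by linarith
qed (use assms(2) in simp)

text \<open>With all other coefficients fixed, the \<open>j\<close>-th one is confined to an
  interval of length at most 2 \<delta> h, because \<bar>y j\<bar> \<ge> 1 / h. It contains at most
  2 \<delta> h L + 1 grid values, and a grid of mesh 1 / L \<le> \<delta> is fine enough to absorb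
  the 1.\<close>

lemma card_small_linear_form:
  fixes y :: "nat \<Rightarrow> real" and L :: nat
  assumes j: "j < N" "h * \<bar>y j\<bar> \<ge> 1" and h: "1 \<le> h" and L: "1 \<le> \<delta> * real L" "0 < \<delta>"
  shows "real (card {\<alpha>\<in>{..<N} \<rightarrow>\<^sub>E {..<L}. \<bar>\<Sum>i<N. real (\<alpha> i) / real L * y i\<bar> \<le> \<delta>}) \<le> real (L ^ N) * (3 * \<delta> * h)"
proof -
  define J where "J = {..<N} - {j}"
  have J: "finite J" "j \<notin> J" "{..<N} = insert j J" "card J = N - 1" using j(1) by (auto simp: J_def)
  define S where "S \<beta> = {x\<in>{..<L}. \<bar>real x / real L * y j + (\<Sum>i\<in>J. real (\<beta> i) / real L * y i)\<bar> \<le> \<delta>}" for \<beta> :: "nat \<Rightarrow> nat"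
  let ?E = "J \<rightarrow>\<^sub>E {..<L}"
  have fE: "finite ?E" using J(1) by (intro finite_PiE) auto
  have "0 < L" using L by (cases L) auto
  have tri: "\<bar>A + s\<bar> \<le> d \<Longrightarrow> \<bar>B + s\<bar> \<le> d \<Longrightarrow> \<bar>B - A\<bar> \<le> 2 * d" for A B s d :: real
    by linarith
  have S: "real (card (S \<beta>)) \<le> 3 * \<delta> * h * real L" for \<beta>
  proof -
    have "real (card (S \<beta>)) \<le> 2 * \<delta> * h * real L + 1"
    proof (rule card_close_nats)
      show "finite (S \<beta>)" unfolding S_def by simp
      show "0 \<le> 2 * \<delta> * h * real L" using L h by simp
      fix x x' assume "x \<in> S \<beta>" "x' \<in> S \<beta>"
      then have "\<bar>real x / real L * y j + (\<Sum>i\<in>J. real (\<beta> i) / real L * y i)\<bar> \<le> \<delta>"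
        "\<bar>real x' / real L * y j + (\<Sum>i\<in>J. real (\<beta> i) / real L * y i)\<bar> \<le> \<delta>"
        by (auto simp: S_def)
      then have "\<bar>real x' / real L * y j - real x / real L * y j\<bar> \<le> 2 * \<delta>" by (rule tri)
      moreover have "real x' / real L * y j - real x / real L * y j = (real x' - real x) / real L * y j"
        by (simp add: diff_divide_distrib left_diff_distrib)
      ultimately have "\<bar>real x' - real x\<bar> * \<bar>y j\<bar> / real L \<le> 2 * \<delta>"
        by (simp add: abs_mult)
      then have *: "\<bar>real x' - real x\<bar> * \<bar>y j\<bar> \<le> 2 * \<delta> * real L"
        using \<open>0 < L\<close> by (simp only: pos_divide_le_eq of_nat_0_less_iff)
      have "\<bar>real x' - real x\<bar> * 1 \<le> \<bar>real x' - real x\<bar> * (h * \<bar>y j\<bar>)"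
        using j(2) by (intro mult_left_mono) auto
      also have "\<dots> = h * (\<bar>real x' - real x\<bar> * \<bar>y j\<bar>)" by simp
      also have "\<dots> \<le> h * (2 * \<delta> * real L)" using * h by (intro mult_left_mono) auto
      finally show "real x' - real x \<le> 2 * \<delta> * h * real L" by (simp add: mult_ac)
    qed
    moreover have "1 \<le> \<delta> * h * real L"
    proof -
      have "1 * 1 \<le> h * (\<delta> * real L)" using h L by (intro mult_mono) auto
      then show ?thesis by (simp add: mult_ac)
    qed
    ultimately show ?thesis by linarith
  qed
  let ?B = "{\<alpha>\<in>{..<N} \<rightarrow>\<^sub>E {..<L}. \<bar>\<Sum>i<N. real (\<alpha> i) / real L * y i\<bar> \<le> \<delta>}"
  have "?B \<subseteq> (\<lambda>(\<beta>, x). \<beta>(j := x)) ` (Sigma ?E S)"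
  proof
    fix \<alpha> assume \<alpha>: "\<alpha> \<in> ?B"
    have "restrict \<alpha> J \<in> ?E" using \<alpha> J(3) by auto
    moreover have "\<alpha> j \<in> S (restrict \<alpha> J)"
      using \<alpha> J j(1) unfolding S_def by (auto simp: J(3))
    moreover have "\<alpha> = (restrict \<alpha> J)(j := \<alpha> j)"
      using \<alpha> J(3) by (auto simp: PiE_def extensional_def fun_eq_iff)
    ultimately show "\<alpha> \<in> (\<lambda>(\<beta>, x). \<beta>(j := x)) ` (Sigma ?E S)"
      by (intro image_eqI[of _ _ "(restrict \<alpha> J, \<alpha> j)"]) auto
  qed
  moreover have fS: "finite (Sigma ?E S)" using fE by (intro finite_SigmaI) (auto simp: S_def)
  ultimately have "card ?B \<le> card (Sigma ?E S)"
    by (meson card_image_le card_mono finite_imageI order_trans)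
  also have "\<dots> = (\<Sum>\<beta>\<in>?E. card (S \<beta>))" using fE by (intro card_SigmaI) (auto simp: S_def)
  finally have "real (card ?B) \<le> (\<Sum>\<beta>\<in>?E. real (card (S \<beta>)))" by (simp flip: of_nat_sum)
  also have "\<dots> \<le> (\<Sum>\<beta>\<in>?E. 3 * \<delta> * h * real L)" by (intro sum_mono S)
  also have "\<dots> = real (L ^ (N - 1)) * (3 * \<delta> * h * real L)" using J by (simp add: card_PiE)
  also have "\<dots> = real (L ^ N) * (3 * \<delta> * h)"
    using j(1) by (cases N) (simp_all add: mult_ac)
  finally show ?thesis .
qed

text \<open>The average over the grid of the weight of bad \<open>p\<close> is at most 3 \<delta>
  times the sum of u h, so some grid point does no worse. Where 1 \<le> 3 \<delta> h the claimed
  proportion is trivial.\<close>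

lemma choose_row:
  fixes y :: "'a \<Rightarrow> nat \<Rightarrow> real"
  assumes T: "finite T" and u: "\<And>p. 0 \<le> u p" and "0 < \<delta>"
    and h: "\<And>p. p \<in> T \<Longrightarrow> 1 \<le> h p" "\<And>p. p \<in> T \<Longrightarrow> 1 \<le> 3 * \<delta> * h p \<or> (\<exists>j<N. h p * \<bar>y p j\<bar> \<ge> 1)"
  shows "\<exists>a. (\<forall>i. \<bar>a i\<bar> \<le> 1) \<and> sum u {p\<in>T. \<bar>\<Sum>i<N. a i * y p i\<bar> \<le> \<delta>} \<le> 3 * \<delta> * (\<Sum>p\<in>T. u p * h p)"
proof -
  define L where "L = nat \<lceil>1 / \<delta>\<rceil>"
  have L: "1 \<le> \<delta> * real L"
  proof -
    have "1 / \<delta> \<le> real L" unfolding L_def by linarith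
    then show ?thesis using \<open>0 < \<delta>\<close> by (simp add: field_simps)
  qed
  then have "0 < L" by (cases L) auto
  let ?G = "{..<N} \<rightarrow>\<^sub>E {..<L}"
  have G: "finite ?G" "card ?G = L ^ N" by (simp_all add: finite_PiE card_PiE)
  define bad where "bad \<alpha> p \<longleftrightarrow> \<bar>\<Sum>i<N. real (\<alpha> i) / real L * y p i\<bar> \<le> \<delta>" for \<alpha> p
  define K where "K = 3 * \<delta> * (\<Sum>p\<in>T. u p * h p)"
  have count: "real (card {\<alpha>\<in>?G. bad \<alpha> p}) \<le> real (L ^ N) * (3 * \<delta> * h p)" if p: "p \<in> T" for p
    using h(2)[OF p]
  proof
    assume *: "1 \<le> 3 * \<delta> * h p"
    have "real (card {\<alpha>\<in>?G. bad \<alpha> p}) \<le> real (L ^ N)"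
      unfolding of_nat_le_iff G(2)[symmetric] by (rule card_mono[OF G(1)]) auto
    also have "\<dots> \<le> real (L ^ N) * (3 * \<delta> * h p)" using * by (intro mult_right_mono[of 1, simplified] mult_le_cancel_left1[THEN iffD2]) auto
    finally show ?thesis .
  next
    assume "\<exists>j<N. h p * \<bar>y p j\<bar> \<ge> 1"
    then obtain j where "j < N" "h p * \<bar>y p j\<bar> \<ge> 1" by blast
    with card_small_linear_form[where h = "h p" and y = "y p" and \<delta> = \<delta> and L = L and N = N and j = j]
    show ?thesis unfolding bad_def using h(1)[OF p] L \<open>0 < \<delta>\<close> by blast
  qed
  have "\<exists>\<alpha>\<in>?G. sum u {p\<in>T. bad \<alpha> p} \<le> K"
  proof (rule ccontr)
    assume "\<not> (\<exists>\<alpha>\<in>?G. sum u {p\<in>T. bad \<alpha> p} \<le> K)"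
    then have "(\<Sum>\<alpha>\<in>?G. K) < (\<Sum>\<alpha>\<in>?G. sum u {p\<in>T. bad \<alpha> p})"
      using \<open>0 < L\<close> G(1) by (intro sum_strict_mono) (auto simp: PiE_eq_empty_iff not_le)
    also have "\<dots> = (\<Sum>\<alpha>\<in>?G. \<Sum>p\<in>T. if bad \<alpha> p then u p else 0)"
      by (simp only: sum.inter_filter[OF T])
    also have "\<dots> = (\<Sum>p\<in>T. \<Sum>\<alpha>\<in>?G. if bad \<alpha> p then u p else 0)" by (rule sum.swap)
    also have "\<dots> = (\<Sum>p\<in>T. u p * real (card {\<alpha>\<in>?G. bad \<alpha> p}))"
      by (simp add: sum.inter_filter[OF G(1), symmetric] mult.commute)
    also have "\<dots> \<le> (\<Sum>p\<in>T. u p * (real (L ^ N) * (3 * \<delta> * h p)))"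
      using count u by (intro sum_mono mult_left_mono) auto
    also have "\<dots> = (\<Sum>\<alpha>\<in>?G. K)"
      using G(2) by (simp add: K_def sum_distrib_left mult_ac)
    finally show False by simp
  qed
  then obtain \<alpha> where \<alpha>: "\<alpha> \<in> ?G" "sum u {p\<in>T. bad \<alpha> p} \<le> K" by blast
  define a where "a i = (if i < N then real (\<alpha> i) / real L else 0)" for i
  have "\<bar>a i\<bar> \<le> 1" for i
  proof (cases "i < N")
    case True
    then have "\<alpha> i < L" using \<alpha>(1) by auto
    then show ?thesis using True \<open>0 < L\<close> by (simp add: a_def)
  qed (simp add: a_def)
  moreover have "bad \<alpha> p \<longleftrightarrow> \<bar>\<Sum>i<N. a i * y p i\<bar> \<le> \<delta>" for p
    unfolding bad_def a_def by simp
  ultimately show ?thesis using \<alpha>(2) unfolding K_def by (intro exI[of _ a]) simp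
qed

lemma choose_rows:
  fixes y :: "'a \<Rightarrow> nat \<Rightarrow> real"
  assumes T: "finite T" and "0 < \<delta>"
    and h: "\<And>p. 1 \<le> h p" "\<And>p. p \<in> T \<Longrightarrow> 1 \<le> 3 * \<delta> * h p \<or> (\<exists>j<N. h p * \<bar>y p j\<bar> \<ge> 1)"
  shows "(\<And>p. 0 \<le> u p) \<Longrightarrow> \<exists>a. (\<forall>j i. \<bar>a j i\<bar> \<le> 1) \<and>
    sum u {p\<in>T. \<forall>j<e. \<bar>\<Sum>i<N. a j i * y p i\<bar> \<le> \<delta>} \<le> (3 * \<delta>) ^ e * (\<Sum>p\<in>T. u p * h p ^ e)"
proof (induction e arbitrary: u)
  case 0
  show ?case by (rule exI[of _ "\<lambda>j i. 0"]) simp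
next
  case (Suc e)
  have uh: "0 \<le> u p * h p" for p using Suc.prems[of p] h(1)[of p] by simp
  \<comment> \<open>The first \<open>e\<close> rows are chosen for the weight \<open>u h\<close>,
    which anticipates the factor \<open>h\<close> that the last row costs on the surviving
    pairs.\<close>
  obtain a where a: "\<forall>j i. \<bar>a j i\<bar> \<le> 1"
    "(\<Sum>p\<in>{p\<in>T. \<forall>j<e. \<bar>\<Sum>i<N. a j i * y p i\<bar> \<le> \<delta>}. u p * h p) \<le> (3 * \<delta>) ^ e * (\<Sum>p\<in>T. u p * h p * h p ^ e)"
    using Suc.IH[of "\<lambda>p. u p * h p", OF uh] by blast
  let ?T = "{p\<in>T. \<forall>j<e. \<bar>\<Sum>i<N. a j i * y p i\<bar> \<le> \<delta>}"
  obtain b where b: "\<forall>i. \<bar>b i\<bar> \<le> 1"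
    "sum u {p\<in>?T. \<bar>\<Sum>i<N. b i * y p i\<bar> \<le> \<delta>} \<le> 3 * \<delta> * (\<Sum>p\<in>?T. u p * h p)"
    using choose_row[of ?T u \<delta> h N y] T Suc.prems \<open>0 < \<delta>\<close> h by auto
  let ?a = "a(e := b)"
  have "{p\<in>T. \<forall>j<Suc e. \<bar>\<Sum>i<N. ?a j i * y p i\<bar> \<le> \<delta>} = {p\<in>?T. \<bar>\<Sum>i<N. b i * y p i\<bar> \<le> \<delta>}"
    by (auto simp: less_Suc_eq)
  then have "sum u {p\<in>T. \<forall>j<Suc e. \<bar>\<Sum>i<N. ?a j i * y p i\<bar> \<le> \<delta>} \<le> 3 * \<delta> * (\<Sum>p\<in>?T. u p * h p)"
    using b(2) by simp
  also have "\<dots> \<le> 3 * \<delta> * ((3 * \<delta>) ^ e * (\<Sum>p\<in>T. u p * h p * h p ^ e))"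
    using a(2) \<open>0 < \<delta>\<close> by (intro mult_left_mono) auto
  also have "\<dots> = (3 * \<delta>) ^ Suc e * (\<Sum>p\<in>T. u p * h p ^ Suc e)" by (simp add: mult_ac)
  finally show ?case using a(1) b(1) by (intro exI[of _ ?a]) auto
qed

text \<open>\<open>dyadic k z z'\<close> is comparable to the inverse of \<open>max \<bar>z - z'\<bar> (1 / 2) ^ k\<close>.\<close>

definition dyadic :: "nat \<Rightarrow> (nat \<Rightarrow> real) \<Rightarrow> (nat \<Rightarrow> real) \<Rightarrow> real" where
  "dyadic k z z' = (if near 0 z z' then 2 ^ Suc (Max {i. i \<le> k \<and> near i z z'}) else 1)"

lemma dyadic_max:
  assumes "near 0 z z'"
  obtains i where "i \<le> k" "near i z z'" "dyadic k z z' = 2 ^ Suc i" "i = k \<or> \<not> near (Suc i) z z'"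
proof -
  define S where "S = {i. i \<le> k \<and> near i z z'}"
  have S: "finite S" "S \<noteq> {}" using assms by (auto simp: S_def)
  have Max: "Max S \<in> S" "\<And>i. i \<in> S \<Longrightarrow> i \<le> Max S" using S by (rule Max_in) (simp add: S)
  have "Suc (Max S) \<notin> S" using Max(2) by force
  then have "Max S = k \<or> \<not> near (Suc (Max S)) z z'" using Max(1) by (auto simp: S_def)
  moreover have "dyadic k z z' = 2 ^ Suc (Max S)" using assms by (simp add: dyadic_def S_def)
  ultimately show ?thesis using Max(1) by (intro that[of "Max S"]) (auto simp: S_def)
qed

lemma dyadic_ge_1: "1 \<le> dyadic k z z'"
  unfolding dyadic_def by (simp only: split: if_split) (simp add: one_le_power del: power_Suc)

text \<open>The largest scale 2^-i at which the points are near is either 2^-k, and the first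
  alternative holds since 3 * 2 \<ge> 1, or some coordinate differs by more than 2^-(i+1), the
  inverse of \<open>dyadic\<close>.\<close>

lemma dyadic_separates:
  assumes "\<And>j. j \<ge> N \<Longrightarrow> z j = z' j"
  shows "1 \<le> 3 * (1 / 2) ^ k * dyadic k z z' \<or> (\<exists>j<N. dyadic k z z' * \<bar>z j - z' j\<bar> \<ge> 1)"
proof (cases "near 0 z z'")
  case True
  then obtain i where i: "i \<le> k" "dyadic k z z' = 2 ^ Suc i" "i = k \<or> \<not> near (Suc i) z z'"
    by (rule dyadic_max)
  show ?thesis
  proof (cases "i = k")
    case True
    then show ?thesis using i by (simp add: power_divide)
  next
    case False
    then obtain j where j: "(1 / 2) ^ Suc i < \<bar>z j - z' j\<bar>" using i by (auto simp: near_def not_le)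
    then have "j < N" using assms[of j] by (cases "j < N") auto
    moreover have "1 \<le> 2 ^ Suc i * \<bar>z j - z' j\<bar>"
      using j by (simp add: power_divide field_simps)
    ultimately show ?thesis using i(2) by auto
  qed
next
  case False
  then obtain j where j: "1 < \<bar>z j - z' j\<bar>" by (auto simp: near_def not_le)
  then have "j < N" using assms[of j] by (cases "j < N") auto
  then show ?thesis using j False by (auto simp: dyadic_def)
qed

text \<open>One term is bounded by the sum over all scales, to which the ball condition of
  \<open>frostman\<close> can be applied scale by scale.\<close>

lemma dyadic_power_le:
  "dyadic k z z' ^ e \<le> 1 + (\<Sum>i\<le>k. if near i z z' then 2 ^ (Suc i * e) else 0)"
proof (cases "near 0 z z'")
  case True
  then obtain i where i: "i \<le> k" "near i z z'" "dyadic k z z' = 2 ^ Suc i"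
    by (rule dyadic_max)
  have "dyadic k z z' ^ e = (if near i z z' then 2 ^ (Suc i * e) else 0)"
    using i(2) unfolding i(3) by (simp only: power_mult if_True)
  also have "\<dots> \<le> (\<Sum>i\<le>k. if near i z z' then 2 ^ (Suc i * e) else 0)"
    using i(1) by (intro member_le_sum) auto
  finally show ?thesis by simp
next
  case False
  then show ?thesis by (simp add: dyadic_def sum_nonneg)
qed

text \<open>Summing the ball condition over all scales gives a geometric series of ratio 2^(e - t) <
  1, so the discrete e-energy is bounded uniformly in \<open>k\<close>. Then
  \<open>choose_rows\<close> finds a matrix under which few pairs of points become
  2^-k-close.\<close>

lemma energy:
  assumes V: "frostman t V" "\<And>z j. z \<in> V \<Longrightarrow> j \<ge> N \<Longrightarrow> z j = 0" and "real e < t"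
  obtains K c :: real where "0 < c" "0 < K"
    "\<And>k. \<exists>P w a. finite P \<and> P \<subseteq> V \<and> (\<forall>x. 0 \<le> w x) \<and> c \<le> sum w P \<and> (\<forall>j i. \<bar>a j i\<bar> \<le> 1) \<and>
      (\<Sum>(z, z')\<in>{(z, z')\<in>P \<times> P. \<forall>j<e. \<bar>(\<Sum>i<N. a j i * z i) - (\<Sum>i<N. a j i * z' i)\<bar> \<le> (1 / 2) ^ k}. w z * w z')
        \<le> K * ((1 / 2) ^ k) ^ e"
proof -
  obtain C B c where c: "0 < c" and F: "\<And>k. \<exists>P w. finite P \<and> P \<subseteq> V \<and> (\<forall>x. 0 \<le> w x) \<and>
     c \<le> sum w P \<and> sum w P \<le> B \<and> (\<forall>i\<le>k. \<forall>z. sum w {x\<in>P. near i x z} \<le> C * 2 powr (- (t * real i)))"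
    using V(1) unfolding frostman_def by blast
  define r where "r = 2 powr (real e - t)"
  have r: "0 < r" "r < 1" using \<open>real e < t\<close> by (auto simp: r_def powr_less_one)
  \<comment> \<open>3^e comes from \<open>choose_rows\<close>, the first \<open>B\<close> from the
    outer sum, and the bracket bounds the inner sum; 2^e reflects the shift \<open>Suc i\<close> in
    \<open>dyadic\<close>. The sign of \<open>C\<close> is not known, whence \<bar>C\<bar>, and the
    final 1 makes \<open>K\<close> positive.\<close>
  define K where "K = 3 ^ e * (B * (B + \<bar>C\<bar> * 2 ^ e / (1 - r))) + 1"
  have "\<exists>P w a. finite P \<and> P \<subseteq> V \<and> (\<forall>x. 0 \<le> w x) \<and> c \<le> sum w P \<and> (\<forall>j i. \<bar>a j i\<bar> \<le> 1) \<and>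
      (\<Sum>(z, z')\<in>{(z, z')\<in>P \<times> P. \<forall>j<e. \<bar>(\<Sum>i<N. a j i * z i) - (\<Sum>i<N. a j i * z' i)\<bar> \<le> (1 / 2) ^ k}. w z * w z')
        \<le> K * ((1 / 2) ^ k) ^ e" for k
  proof -
    obtain P w where P: "finite P" "P \<subseteq> V" "\<forall>x. 0 \<le> w x" "c \<le> sum w P" "sum w P \<le> B"
      and ball: "\<forall>i\<le>k. \<forall>z. sum w {x\<in>P. near i x z} \<le> C * 2 powr (- (t * real i))"
      using F[of k] by blast
    let ?y = "\<lambda>(z, z') i. z i - z' i :: real"
    let ?u = "\<lambda>(z, z'). w z * w z'"
    let ?h = "\<lambda>(z, z'). dyadic k z' z"
    have "\<exists>a. (\<forall>j i. \<bar>a j i\<bar> \<le> 1) \<and>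
      sum ?u {p\<in>P \<times> P. \<forall>j<e. \<bar>\<Sum>i<N. a j i * ?y p i\<bar> \<le> (1 / 2) ^ k} \<le>
      (3 * (1 / 2) ^ k) ^ e * (\<Sum>p\<in>P \<times> P. ?u p * ?h p ^ e)"
    proof (rule choose_rows)
      show "finite (P \<times> P)" using P(1) by simp
      show "1 \<le> ?h p" for p by (simp add: split_def dyadic_ge_1)
      show "0 \<le> ?u p" for p using P(3) by (simp add: split_def)
      show "1 \<le> 3 * (1 / 2) ^ k * ?h p \<or> (\<exists>j<N. ?h p * \<bar>?y p j\<bar> \<ge> 1)" if p: "p \<in> P \<times> P" for p
      proof -
        obtain z z' where zz: "p = (z, z')" "z \<in> V" "z' \<in> V" using p P(2) by auto
        then have "z' j = z j" if "j \<ge> N" for j using V(2)[of z j] V(2)[of z' j] that by simp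
        from dyadic_separates[of N z' z k, OF this] show ?thesis
          unfolding zz by (simp add: abs_minus_commute)
      qed
    qed simp
    then obtain a where a: "\<forall>j i. \<bar>a j i\<bar> \<le> 1"
      "sum ?u {p\<in>P \<times> P. \<forall>j<e. \<bar>\<Sum>i<N. a j i * ?y p i\<bar> \<le> (1 / 2) ^ k} \<le>
      (3 * (1 / 2) ^ k) ^ e * (\<Sum>p\<in>P \<times> P. ?u p * ?h p ^ e)" by blast
    have inner: "(\<Sum>z'\<in>P. w z' * dyadic k z' z ^ e) \<le> B + \<bar>C\<bar> * 2 ^ e / (1 - r)" for z
    proof -
      have "(\<Sum>z'\<in>P. w z' * dyadic k z' z ^ e) \<le>
        (\<Sum>z'\<in>P. w z' * (1 + (\<Sum>i\<le>k. if near i z' z then 2 ^ (Suc i * e) else 0)))"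
        using P(3) by (intro sum_mono mult_left_mono dyadic_power_le) auto
      also have "\<dots> = sum w P + (\<Sum>z'\<in>P. \<Sum>i\<le>k. w z' * (if near i z' z then 2 ^ (Suc i * e) else 0))"
        by (simp add: distrib_left sum.distrib sum_distrib_left)
      also have "(\<Sum>z'\<in>P. \<Sum>i\<le>k. w z' * (if near i z' z then 2 ^ (Suc i * e) else 0)) =
        (\<Sum>i\<le>k. \<Sum>z'\<in>P. w z' * (if near i z' z then 2 ^ (Suc i * e) else 0))" by (rule sum.swap)
      also have "\<dots> = (\<Sum>i\<le>k. sum w {z'\<in>P. near i z' z} * 2 ^ (Suc i * e))"
      proof (rule sum.cong[OF refl])
        fix i
        show "(\<Sum>z'\<in>P. w z' * (if near i z' z then 2 ^ (Suc i * e) else 0)) = sum w {z'\<in>P. near i z' z} * 2 ^ (Suc i * e)"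
          unfolding sum.inter_filter[OF P(1)] sum_distrib_right by (intro sum.cong) auto
      qed
      also have "\<dots> \<le> (\<Sum>i\<le>k. \<bar>C\<bar> * 2 ^ e * r ^ i)"
      proof (rule sum_mono)
        fix i assume "i \<in> {..k}"
        then have "sum w {z'\<in>P. near i z' z} \<le> C * 2 powr (- (t * real i))" using ball by simp
        also have "\<dots> \<le> \<bar>C\<bar> * 2 powr (- (t * real i))" by (intro mult_right_mono) auto
        finally have "sum w {z'\<in>P. near i z' z} * 2 ^ (Suc i * e) \<le> \<bar>C\<bar> * 2 powr (- (t * real i)) * 2 ^ (Suc i * e)"
          by (rule mult_right_mono) simp
        also have "\<dots> = \<bar>C\<bar> * (2 powr (- (t * real i)) * 2 powr (real (Suc i * e)))"
          by (simp only: powr_realpow[symmetric, of 2] mult.assoc zero_less_numeral)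
        also have "2 powr (- (t * real i)) * 2 powr (real (Suc i * e)) = 2 powr real e * (2 powr (real e - t)) powr real i"
          by (simp add: powr_add[symmetric] powr_powr algebra_simps)
        also have "\<dots> = 2 ^ e * r ^ i" using r(1) by (simp add: r_def powr_realpow)
        finally show "sum w {z'\<in>P. near i z' z} * 2 ^ (Suc i * e) \<le> \<bar>C\<bar> * 2 ^ e * r ^ i" by (simp add: mult.assoc)
      qed
      also have "\<dots> = \<bar>C\<bar> * 2 ^ e * (\<Sum>i\<le>k. r ^ i)" by (simp add: sum_distrib_left)
      also have "\<dots> \<le> \<bar>C\<bar> * 2 ^ e * (1 / (1 - r))"
      proof (rule mult_left_mono)
        have "(\<Sum>i\<le>k. r ^ i) \<le> (\<Sum>i. r ^ i)"
          using r by (intro sum_le_suminf summable_geometric) auto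
        then show "(\<Sum>i\<le>k. r ^ i) \<le> 1 / (1 - r)" using r by (simp add: suminf_geometric)
      qed simp
      finally show ?thesis using P(5) by simp
    qed
    have "(\<Sum>p\<in>P \<times> P. ?u p * ?h p ^ e) = (\<Sum>z\<in>P. w z * (\<Sum>z'\<in>P. w z' * dyadic k z' z ^ e))"
    proof -
      have "(\<Sum>p\<in>P \<times> P. ?u p * ?h p ^ e) = (\<Sum>(z, z')\<in>P \<times> P. w z * w z' * dyadic k z' z ^ e)"
        by (intro sum.cong) auto
      also have "\<dots> = (\<Sum>z\<in>P. \<Sum>z'\<in>P. w z * w z' * dyadic k z' z ^ e)"
        by (simp only: sum.cartesian_product)
      finally show ?thesis by (simp add: sum_distrib_left mult.assoc)
    qed
    also have "\<dots> \<le> (\<Sum>z\<in>P. w z * (B + \<bar>C\<bar> * 2 ^ e / (1 - r)))"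
      using P(3) by (intro sum_mono mult_left_mono inner) auto
    also have "\<dots> = sum w P * (B + \<bar>C\<bar> * 2 ^ e / (1 - r))" by (simp add: sum_distrib_right)
    also have "\<dots> \<le> B * (B + \<bar>C\<bar> * 2 ^ e / (1 - r))"
    proof (rule mult_right_mono[OF P(5)])
      have "0 < B" using c P(4,5) by linarith
      then show "0 \<le> B + \<bar>C\<bar> * 2 ^ e / (1 - r)" using r by simp
    qed
    finally have "(3 * (1 / 2) ^ k) ^ e * (\<Sum>p\<in>P \<times> P. ?u p * ?h p ^ e) \<le>
      (3 * (1 / 2) ^ k) ^ e * (B * (B + \<bar>C\<bar> * 2 ^ e / (1 - r)))"
      by (intro mult_left_mono) auto
    also have "\<dots> \<le> K * ((1 / 2) ^ k) ^ e"
      by (simp add: K_def power_mult_distrib algebra_simps)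
    finally have "sum ?u {p\<in>P \<times> P. \<forall>j<e. \<bar>\<Sum>i<N. a j i * ?y p i\<bar> \<le> (1 / 2) ^ k} \<le> K * ((1 / 2) ^ k) ^ e"
      using a(2) by linarith
    moreover have "{p\<in>P \<times> P. \<forall>j<e. \<bar>\<Sum>i<N. a j i * ?y p i\<bar> \<le> (1 / 2) ^ k} =
      {(z, z')\<in>P \<times> P. \<forall>j<e. \<bar>(\<Sum>i<N. a j i * z i) - (\<Sum>i<N. a j i * z' i)\<bar> \<le> (1 / 2) ^ k}"
      by (auto simp: right_diff_distrib sum_subtractf)
    ultimately show ?thesis
      using P a(1) by (intro exI[of _ P] exI[of _ w] exI[of _ a]) simp
  qed
  moreover have "0 < K"
  proof -
    have "0 < B" using F[of 0] c by force
    then show ?thesis using r by (simp add: K_def add_nonneg_pos)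
  qed
  ultimately show ?thesis using that[OF c, of K] by blast
qed

section \<open>Counting cells and their volume\<close>

definition dyadic_cell :: "nat set \<Rightarrow> nat \<Rightarrow> (nat \<Rightarrow> real) \<Rightarrow> nat \<Rightarrow> int" where
  "dyadic_cell J k y = (\<lambda>i\<in>J. \<lfloor>2 ^ k * y i\<rfloor>)"

definition cell_box :: "nat set \<Rightarrow> nat \<Rightarrow> (nat \<Rightarrow> int) \<Rightarrow> (nat \<Rightarrow> real) set" where
  "cell_box J k q = (\<Pi>\<^sub>E i\<in>J. {of_int (q i) / 2 ^ k..<(of_int (q i) + 1) / 2 ^ k})"

lemma cell_box_floor: "y \<in> cell_box J k q \<Longrightarrow> i \<in> J \<Longrightarrow> \<lfloor>2 ^ k * y i\<rfloor> = q i"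
proof -
  assume "y \<in> cell_box J k q" "i \<in> J"
  then have "y i \<in> {of_int (q i) / 2 ^ k..<(of_int (q i) + 1) / 2 ^ k}" by (auto simp: cell_box_def)
  then show "\<lfloor>2 ^ k * y i\<rfloor> = q i" by (simp add: floor_eq_iff field_simps)
qed

lemma emeasure_cell_boxes:
  assumes J: "finite J" and Q: "finite Q" "Q \<subseteq> extensional J"
  shows "(\<Union>q\<in>Q. cell_box J k q) \<in> sets (Pi\<^sub>M J (\<lambda>_. lborel))"
    and "emeasure (Pi\<^sub>M J (\<lambda>_. lborel)) (\<Union>q\<in>Q. cell_box J k q) = ennreal (real (card Q) * ((1 / 2) ^ k) ^ card J)"
proof -
  interpret product_sigma_finite "\<lambda>_. lborel :: real measure" by standard
  have sets: "cell_box J k q \<in> sets (Pi\<^sub>M J (\<lambda>_. lborel))" for q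
    unfolding cell_box_def using J by (intro sets_PiM_I_finite) auto
  then show "(\<Union>q\<in>Q. cell_box J k q) \<in> sets (Pi\<^sub>M J (\<lambda>_. lborel))"
    using Q(1) by (intro sets.finite_UN) auto
  have disj: "disjoint_family_on (cell_box J k) Q"
    unfolding disjoint_family_on_def
  proof (intro ballI impI)
    fix q q' assume q: "q \<in> Q" "q' \<in> Q" "q \<noteq> q'"
    show "cell_box J k q \<inter> cell_box J k q' = {}"
    proof (rule ccontr)
      assume "cell_box J k q \<inter> cell_box J k q' \<noteq> {}"
      then obtain y where y: "y \<in> cell_box J k q" "y \<in> cell_box J k q'" by blast
      have "q i = q' i" if "i \<in> J" for i using cell_box_floor[OF y(1) that] cell_box_floor[OF y(2) that] by simp
      then have "q = q'" using q Q(2) by (intro extensionalityI[of _ J]) auto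
      then show False using q(3) by simp
    qed
  qed
  have vol: "emeasure (Pi\<^sub>M J (\<lambda>_. lborel)) (cell_box J k q) = ennreal (((1 / 2) ^ k) ^ card J)" for q
  proof -
    have "emeasure (Pi\<^sub>M J (\<lambda>_. lborel)) (cell_box J k q) =
      (\<Prod>i\<in>J. emeasure lborel {of_int (q i) / 2 ^ k..<(of_int (q i) + 1) / 2 ^ k :: real})"
      unfolding cell_box_def using J by (intro emeasure_PiM) auto
    also have "\<dots> = (\<Prod>i\<in>J. ennreal ((1 / 2) ^ k))"
    proof (rule prod.cong[OF refl])
      fix i
      have "(of_int (q i) + 1) / 2 ^ k - of_int (q i) / 2 ^ k = (1 / 2 :: real) ^ k"
        by (simp add: power_divide add_divide_distrib)
      moreover have "of_int (q i) / 2 ^ k \<le> (of_int (q i) + 1) / (2 :: real) ^ k" by (simp add: divide_right_mono)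
      ultimately show "emeasure lborel {of_int (q i) / 2 ^ k..<(of_int (q i) + 1) / 2 ^ k :: real} = ennreal ((1 / 2) ^ k)"
        by simp
    qed
    also have "\<dots> = ennreal (((1 / 2) ^ k) ^ card J)" by (simp add: ennreal_power)
    finally show ?thesis .
  qed
  have "emeasure (Pi\<^sub>M J (\<lambda>_. lborel)) (\<Union>q\<in>Q. cell_box J k q) =
    (\<Sum>q\<in>Q. emeasure (Pi\<^sub>M J (\<lambda>_. lborel)) (cell_box J k q))"
    using sets disj Q(1) by (intro sum_emeasure[symmetric]) auto
  also have "\<dots> = of_nat (card Q) * ennreal (((1 / 2) ^ k) ^ card J)" by (simp add: vol)
  also have "\<dots> = ennreal (real (card Q) * ((1 / 2) ^ k) ^ card J)"
    by (simp add: ennreal_mult ennreal_of_nat_eq_real_of_nat)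
  finally show "emeasure (Pi\<^sub>M J (\<lambda>_. lborel)) (\<Union>q\<in>Q. cell_box J k q) = ennreal (real (card Q) * ((1 / 2) ^ k) ^ card J)" .
qed

text \<open>Cauchy-Schwarz: the square of the total mass is at most the number of occupied cells
  times the sum of squared cell masses. The latter is the mass of pairs in a common cell, and such
  pairs are 2^-k-close.\<close>

lemma many_cells:
  fixes F :: "(nat \<Rightarrow> real) \<Rightarrow> nat \<Rightarrow> real"
  assumes P: "finite P" and w: "\<And>x. 0 \<le> w x"
    and X: "(\<Sum>(z, z')\<in>{(z, z')\<in>P \<times> P. \<forall>i\<in>J. \<bar>F z i - F z' i\<bar> \<le> (1 / 2) ^ k}. w z * w z') \<le> X"
  shows "(sum w P)\<^sup>2 \<le> X * real (card ((\<lambda>z. dyadic_cell J k (F z)) ` P))"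
proof -
  let ?c = "\<lambda>z. dyadic_cell J k (F z)"
  let ?Q = "?c ` P"
  define m where "m q = sum w {z\<in>P. ?c z = q}" for q
  have close: "\<bar>F z i - F z' i\<bar> \<le> (1 / 2) ^ k" if eq: "?c z = ?c z'" and i: "i \<in> J" for z z' i
  proof -
    have "\<lfloor>2 ^ k * F z i\<rfloor> = \<lfloor>2 ^ k * F z' i\<rfloor>"
      using fun_cong[OF eq, of i] i by (simp add: dyadic_cell_def)
    then show ?thesis by (rule floor_scaled_eq_imp_close)
  qed
  have "(sum w P)\<^sup>2 = (\<Sum>q\<in>?Q. m q)\<^sup>2"
    unfolding m_def using sum.image_gen[OF P, of w ?c] by simp
  also have "\<dots> \<le> (\<Sum>q\<in>?Q. (m q)\<^sup>2) * real (card ?Q)" by (rule sum_squared_le_sum_of_squares)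
  also have "\<dots> \<le> X * real (card ?Q)"
  proof (rule mult_right_mono)
    let ?S = "{(z, z')\<in>P \<times> P. ?c z = ?c z'}"
    have "(\<Sum>q\<in>?Q. (m q)\<^sup>2) = (\<Sum>q\<in>?Q. \<Sum>p\<in>{p\<in>?S. ?c (fst p) = q}. w (fst p) * w (snd p))"
    proof (rule sum.cong[OF refl])
      fix q
      have "(m q)\<^sup>2 = (\<Sum>(z, z')\<in>{z\<in>P. ?c z = q} \<times> {z\<in>P. ?c z = q}. w z * w z')"
        by (simp add: m_def power2_eq_square sum_product sum.cartesian_product)
      also have "\<dots> = (\<Sum>p\<in>{p\<in>?S. ?c (fst p) = q}. w (fst p) * w (snd p))"
        by (intro sum.cong) auto
      finally show "(m q)\<^sup>2 = (\<Sum>p\<in>{p\<in>?S. ?c (fst p) = q}. w (fst p) * w (snd p))" .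
    qed
    also have "\<dots> = (\<Sum>p\<in>?S. w (fst p) * w (snd p))"
    proof (rule sum.group)
      show "finite ?S" by (rule finite_subset[of _ "P \<times> P"]) (use P in auto)
      show "(\<lambda>p. ?c (fst p)) ` ?S \<subseteq> ?Q" by auto
    qed (use P in simp)
    also have "\<dots> \<le> (\<Sum>p\<in>{(z, z')\<in>P \<times> P. \<forall>i\<in>J. \<bar>F z i - F z' i\<bar> \<le> (1 / 2) ^ k}. w (fst p) * w (snd p))"
    proof (rule sum_mono2)
      show "finite {(z, z')\<in>P \<times> P. \<forall>i\<in>J. \<bar>F z i - F z' i\<bar> \<le> (1 / 2) ^ k}"
        by (rule finite_subset[of _ "P \<times> P"]) (use P in auto)
      show "?S \<subseteq> {(z, z')\<in>P \<times> P. \<forall>i\<in>J. \<bar>F z i - F z' i\<bar> \<le> (1 / 2) ^ k}"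
        using close by blast
    qed (simp add: w)
    finally show "(\<Sum>q\<in>?Q. (m q)\<^sup>2) \<le> X" using X by (simp add: split_def)
  qed simp
  finally show ?thesis .
qed

lemma compact_bounded_coordinates:
  assumes "compact (V :: (nat \<Rightarrow> real) set)" "\<And>x j. x \<in> V \<Longrightarrow> j \<ge> N \<Longrightarrow> x j = 0"
  obtains b where "\<And>x j. x \<in> V \<Longrightarrow> \<bar>x j\<bar> \<le> b" "0 \<le> b"
proof -
  have "\<exists>b. \<forall>x\<in>V. \<bar>x j\<bar> \<le> b" for j
  proof -
    have "compact ((\<lambda>x. x j) ` V)" by (intro compact_continuous_image assms continuous_intros)
    then have "bounded ((\<lambda>x. x j) ` V)" by (rule compact_imp_bounded)
    then show ?thesis unfolding bounded_iff by auto
  qed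
  then obtain b where b: "\<And>j x. x \<in> V \<Longrightarrow> \<bar>x j\<bar> \<le> b j" by metis
  have "\<bar>x j\<bar> \<le> (\<Sum>i<N. \<bar>b i\<bar>)" if "x \<in> V" for x j
  proof (cases "j < N")
    case True
    have "\<bar>x j\<bar> \<le> \<bar>b j\<bar>" using b[OF that, of j] by linarith
    also have "\<dots> \<le> (\<Sum>i<N. \<bar>b i\<bar>)" using True by (intro member_le_sum) auto
    finally show ?thesis .
  next
    case False
    then show ?thesis using assms(2)[OF that] by (simp add: sum_nonneg)
  qed
  then show ?thesis by (rule that) (simp_all add: sum_nonneg)
qed

lemma tendsto_coordinate:
  "(x \<longlongrightarrow> l) F \<Longrightarrow> ((\<lambda>n. x n i :: real) \<longlongrightarrow> l (i :: nat)) F"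
  by (rule continuous_on_tendsto_compose[of UNIV "\<lambda>x. x i"]) (auto intro: continuous_intros)

text \<open>At scale \<open>(1 / 2) ^ k\<close> some projection of \<open>V\<close> with coefficient matrix in a fixed compact set has
  volume bounded below. A limit of these projections has positive volume, contrary to smallness.\<close>

lemma not_frostman:
  assumes R: "restrained R" and V: "dset R N V" "compact V" "small D V" and F: "frostman t V"
    and t: "real D + 1 < t"
  shows False
proof -
  have supp: "z j = 0" if "z \<in> V" "N \<le> j" for z j using V(1) that by (simp add: dset_def)
  obtain b where b: "\<And>z j. z \<in> V \<Longrightarrow> \<bar>z j\<bar> \<le> b" "0 \<le> b"
    by (rule compact_bounded_coordinates[of V N]) (use V(2) supp in blast)+
  \<comment> \<open>The fresh coordinates in which \<open>lin\<close> stores the linear forms; row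
    \<open>i - N\<close> belongs to coordinate \<open>i\<close>.\<close>
  define J where "J = {N..<N + Suc D}"
  have J: "finite J" "card J = Suc D" by (auto simp: J_def)
  define L where "L a z i = (\<Sum>l<N. a (i - N) l * z l)" for a :: "nat \<Rightarrow> nat \<Rightarrow> real" and z :: "nat \<Rightarrow> real" and i
  have J_all: "(\<forall>j<Suc D. Q j) \<longleftrightarrow> (\<forall>i\<in>J. Q (i - N))" for Q
  proof
    assume *: "\<forall>i\<in>J. Q (i - N)"
    show "\<forall>j<Suc D. Q j"
    proof (intro allI impI)
      fix j assume "j < Suc D"
      then have "Q (j + N - N)" using *[rule_format, of "j + N"] by (simp add: J_def)
      then show "Q j" by simp
    qed
  qed (auto simp: J_def)
  obtain K c :: real where Kc: "0 < c" "0 < K"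
    "\<And>k. \<exists>P w a. finite P \<and> P \<subseteq> V \<and> (\<forall>x. 0 \<le> w x) \<and> c \<le> sum w P \<and> (\<forall>j i. \<bar>a j i\<bar> \<le> 1) \<and>
      (\<Sum>(z, z')\<in>{(z, z')\<in>P \<times> P. \<forall>j<Suc D. \<bar>(\<Sum>i<N. a j i * z i) - (\<Sum>i<N. a j i * z' i)\<bar> \<le> (1 / 2) ^ k}. w z * w z')
        \<le> K * ((1 / 2) ^ k) ^ Suc D"
  proof (rule energy[OF F, of N "Suc D"])
    show "z j = 0" if "z \<in> V" "N \<le> j" for z j using supp that .
    show "real (Suc D) < t" using t by simp
  qed blast
  let ?M = "Pi\<^sub>M J (\<lambda>_. lborel :: real measure)"
  \<comment> \<open>By \<open>many_cells\<close> at least c^2 / K * 2^(k (D + 1)) cells are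
    occupied, each of volume 2^-(k (D + 1)).\<close>
  define \<eta> where "\<eta> = c\<^sup>2 / K"
  have \<eta>: "0 < \<eta>" using Kc by (simp add: \<eta>_def)
  let ?box = "\<Pi>\<^sub>E i\<in>J. {- (real N * b + 1)..real N * b + 1}"
  have step: "\<exists>a G. (\<forall>j i. \<bar>a j i\<bar> \<le> 1) \<and> G \<in> sets ?M \<and> ennreal \<eta> \<le> emeasure ?M G \<and> G \<subseteq> ?box \<and>
    (\<forall>y\<in>G. \<exists>z\<in>V. \<forall>i\<in>J. \<bar>y i - L a z i\<bar> \<le> (1 / 2) ^ k)" for k
  proof -
    obtain P w a where P: "finite P" "P \<subseteq> V" "\<forall>x. 0 \<le> w x" "c \<le> sum w P" "\<forall>j i. \<bar>a j i\<bar> \<le> 1"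
      "(\<Sum>(z, z')\<in>{(z, z')\<in>P \<times> P. \<forall>j<Suc D. \<bar>(\<Sum>i<N. a j i * z i) - (\<Sum>i<N. a j i * z' i)\<bar> \<le> (1 / 2) ^ k}. w z * w z')
        \<le> K * ((1 / 2) ^ k) ^ Suc D"
      using Kc(3)[of k] by (elim exE conjE)
    let ?Q = "(\<lambda>z. dyadic_cell J k (L a z)) ` P"
    let ?G = "\<Union>q\<in>?Q. cell_box J k q"
    have "(sum w P)\<^sup>2 \<le> (K * ((1 / 2) ^ k) ^ Suc D) * real (card ?Q)"
    proof (rule many_cells[OF P(1)])
      show "(\<Sum>(z, z')\<in>{(z, z')\<in>P \<times> P. \<forall>i\<in>J. \<bar>L a z i - L a z' i\<bar> \<le> (1 / 2) ^ k}. w z * w z')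
        \<le> K * ((1 / 2) ^ k) ^ Suc D"
        using P(6) unfolding J_all L_def .
    qed (use P(3) in simp)
    moreover have "c\<^sup>2 \<le> (sum w P)\<^sup>2" using P(4) Kc(1) by (intro power_mono) auto
    ultimately have "\<eta> \<le> real (card ?Q) * ((1 / 2) ^ k) ^ card J"
      using Kc(2) unfolding \<eta>_def J(2) by (simp add: pos_divide_le_eq mult_ac)
    moreover have Q: "finite ?Q" "?Q \<subseteq> extensional J" using P(1) by (auto simp: dyadic_cell_def)
    ultimately have "ennreal \<eta> \<le> emeasure ?M ?G"
      using emeasure_cell_boxes(2)[OF J(1) Q, of k] by (simp only: ennreal_leI)
    have near: "\<exists>z\<in>V. \<forall>i\<in>J. \<bar>y i - L a z i\<bar> \<le> (1 / 2) ^ k" if y: "y \<in> ?G" for y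
    proof -
      obtain z where z: "z \<in> P" "y \<in> cell_box J k (dyadic_cell J k (L a z))" using y by blast
      have "\<bar>y i - L a z i\<bar> \<le> (1 / 2) ^ k" if "i \<in> J" for i
      proof -
        have "\<lfloor>2 ^ k * y i\<rfloor> = \<lfloor>2 ^ k * L a z i\<rfloor>"
          using cell_box_floor[OF z(2) that] that by (simp add: dyadic_cell_def)
        then show ?thesis by (rule floor_scaled_eq_imp_close)
      qed
      then show ?thesis using z(1) P(2) by blast
    qed
    have "?G \<subseteq> ?box"
    proof
      fix y assume y: "y \<in> ?G"
      then obtain z where z: "z \<in> V" "\<forall>i\<in>J. \<bar>y i - L a z i\<bar> \<le> (1 / 2) ^ k" using near by blast
      have "y i \<in> {- (real N * b + 1)..real N * b + 1}" if "i \<in> J" for i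
      proof -
        have "\<bar>L a z i\<bar> \<le> (\<Sum>l<N. \<bar>a (i - N) l * z l\<bar>)" unfolding L_def by (rule sum_abs)
        also have "\<dots> \<le> (\<Sum>l<N. 1 * b)"
          unfolding abs_mult using P(5) b z(1) by (intro sum_mono mult_mono) auto
        finally have "\<bar>L a z i\<bar> \<le> real N * b" by simp
        moreover have "\<bar>y i - L a z i\<bar> \<le> 1" using z(2) that power_le_one[of "1 / 2 :: real" k] by force
        ultimately have "y i \<le> real N * b + 1" "- (real N * b + 1) \<le> y i" by linarith+
        then show ?thesis by (simp only: atLeastAtMost_iff)
      qed
      moreover have "y \<in> extensional J" using y by (auto simp: cell_box_def PiE_def)
      ultimately show "y \<in> ?box" by (simp only: PiE_iff) blast
    qed
    then show ?thesis
      using P(5) emeasure_cell_boxes(1)[OF J(1) Q, of k] \<open>ennreal \<eta> \<le> emeasure ?M ?G\<close> near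
      by (intro exI[of _ a] exI[of _ ?G] conjI ballI) auto
  qed
  then obtain a G where a: "\<And>k j i. \<bar>a k j i\<bar> \<le> 1" and G: "\<And>k. G k \<in> sets ?M" "\<And>k. ennreal \<eta> \<le> emeasure ?M (G k)"
    "\<And>k. G k \<subseteq> ?box" "\<And>k y. y \<in> G k \<Longrightarrow> \<exists>z\<in>V. \<forall>i\<in>J. \<bar>y i - L (a k) z i\<bar> \<le> (1 / 2) ^ k"
    by metis
  \<comment> \<open>The matrix is coded as one bounded sequence so that \<open>compact_box\<close>
    yields a convergent subsequence.\<close>
  define \<alpha> where "\<alpha> k n = a k (fst (prod_decode n)) (snd (prod_decode n))" for k n
  have "\<forall>k. \<alpha> k \<in> {w. \<forall>i. \<bar>w i\<bar> \<le> 1}" using a by (simp add: \<alpha>_def)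
  then obtain l \<sigma> where \<sigma>: "strict_mono (\<sigma> :: nat \<Rightarrow> nat)" "(\<alpha> \<circ> \<sigma>) \<longlonglongrightarrow> l"
    using compact_imp_seq_compact[OF compact_box[of 1]] unfolding seq_compact_def by metis
  define A where "A j i = l (prod_encode (j, i))" for j i
  have A: "(\<lambda>n. a (\<sigma> n) j i) \<longlonglongrightarrow> A j i" for j i
    using tendsto_coordinate[OF \<sigma>(2), of "prod_encode (j, i)"] by (simp add: A_def \<alpha>_def o_def)
  \<comment> \<open>The intersection of these tails is the limit superior of the sets
    \<open>G\<close>. All of them lie in one box of finite volume, so continuity from above
    preserves the bound \<open>\<eta>\<close>.\<close>
  define H where "H m = (\<Union>n\<in>{m..}. G (\<sigma> n))" for m
  have H_sets: "H m \<in> sets ?M" for m unfolding H_def using G(1) by (intro sets.countable_UN') auto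
  have H_box: "emeasure ?M (H m) \<noteq> \<infinity>" for m
  proof -
    interpret product_sigma_finite "\<lambda>_. lborel :: real measure" by standard
    have "emeasure ?M (H m) \<le> emeasure ?M ?box"
      using G(3) J(1) by (intro emeasure_mono sets_PiM_I_finite) (auto simp: H_def)
    also have "\<dots> = (\<Prod>i\<in>J. emeasure lborel {- (real N * b + 1)..real N * b + 1})"
      using J(1) by (intro emeasure_PiM) auto
    also have "\<dots> = ennreal ((2 * (real N * b + 1)) ^ card J)"
    proof -
      have "emeasure lborel {- \<beta>..\<beta>} = ennreal (2 * \<beta>)" if "0 \<le> \<beta>" for \<beta> :: real
        using that by simp
      moreover have "0 \<le> real N * b + 1" using b(2) by simp
      ultimately show ?thesis by (simp only: prod_constant ennreal_power mult_nonneg_nonneg zero_le_numeral)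
    qed
    finally show ?thesis by (auto simp: top_unique)
  qed
  have "emeasure ?M (\<Inter>m. H m) = (INF m. emeasure ?M (H m))"
  proof (rule INF_emeasure_decseq[symmetric])
    show "decseq H" unfolding decseq_def H_def by fastforce
  qed (use H_sets H_box in auto)
  moreover have "ennreal \<eta> \<le> emeasure ?M (H m)" for m
  proof -
    have "ennreal \<eta> \<le> emeasure ?M (G (\<sigma> m))" by (rule G(2))
    also have "\<dots> \<le> emeasure ?M (H m)" by (rule emeasure_mono) (auto simp: H_def intro: H_sets[unfolded H_def])
    finally show ?thesis .
  qed
  ultimately have pos: "ennreal \<eta> \<le> emeasure ?M (\<Inter>m. H m)" by (simp add: INF_greatest)
  let ?W = "lin N A ({..<Suc D} \<times> {..<N}) ` V"
  have W: "dset R (N + Suc D) ?W" "compact ?W" "small D ?W"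
    using small_lin[OF R V, of "{..<Suc D} \<times> {..<N}" "Suc D" A] by auto
  have "trace_on J ?W \<in> null_sets ?M"
    using smallD[OF W(3) J(1)] J by (intro restrained_null[OF R J(1) W(2,1)]) simp
  moreover have "(\<Inter>m. H m) \<subseteq> trace_on J ?W"
  proof
    fix y assume y: "y \<in> (\<Inter>m. H m)"
    \<comment> \<open>A point in infinitely many \<open>G\<close> is approximated by images of
      points of \<open>V\<close>. Compactness of \<open>V\<close> and convergence of the matrices
      make it the exact image of a point under \<open>A\<close>.\<close>
    have "\<exists>n\<ge>m. y \<in> G (\<sigma> n)" for m using y by (auto simp: H_def)
    then obtain n where n: "\<And>m. m \<le> n m" "\<And>m. y \<in> G (\<sigma> (n m))" by metis
    have "\<forall>m. \<exists>z\<in>V. \<forall>i\<in>J. \<bar>y i - L (a (\<sigma> (n m))) z i\<bar> \<le> (1 / 2) ^ \<sigma> (n m)"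
      using G(4)[OF n(2)] by blast
    then obtain z where z: "\<And>m. z m \<in> V" "\<And>m i. i \<in> J \<Longrightarrow> \<bar>y i - L (a (\<sigma> (n m))) (z m) i\<bar> \<le> (1 / 2) ^ \<sigma> (n m)"
      by metis
    obtain x \<rho> where x: "x \<in> V" "strict_mono (\<rho> :: nat \<Rightarrow> nat)" "(z \<circ> \<rho>) \<longlonglongrightarrow> x"
      using compact_imp_seq_compact[OF V(2)] z(1) unfolding seq_compact_def by metis
    have n_lim: "filterlim (\<lambda>m. n (\<rho> m)) at_top sequentially"
    proof (rule filterlim_at_top_mono[OF filterlim_ident])
      show "\<forall>\<^sub>F m in sequentially. m \<le> n (\<rho> m)"
        using n(1) seq_suble[OF x(2)] by (intro always_eventually allI) (meson order_trans)
    qed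
    have "y i = L A x i" if i: "i \<in> J" for i
    proof -
      have "(\<lambda>m. L (a (\<sigma> (n (\<rho> m)))) (z (\<rho> m)) i) \<longlonglongrightarrow> L A x i"
        unfolding L_def
      proof (intro tendsto_sum tendsto_mult)
        show "(\<lambda>m. a (\<sigma> (n (\<rho> m))) (i - N) l) \<longlonglongrightarrow> A (i - N) l" for l
          using filterlim_compose[OF A n_lim] .
        show "(\<lambda>m. z (\<rho> m) l) \<longlonglongrightarrow> x l" for l
          using tendsto_coordinate[OF x(3), of l] by (simp add: o_def)
      qed
      moreover have "(\<lambda>m. y i - L (a (\<sigma> (n (\<rho> m)))) (z (\<rho> m)) i) \<longlonglongrightarrow> 0"
      proof (rule Lim_null_comparison)
        have "(1 / 2) ^ \<sigma> (n (\<rho> m)) \<le> (1 / 2 :: real) ^ m" for m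
        proof (rule power_decreasing)
          have "m \<le> \<rho> m" by (rule seq_suble[OF x(2)])
          also have "\<dots> \<le> n (\<rho> m)" by (rule n(1))
          also have "\<dots> \<le> \<sigma> (n (\<rho> m))" by (rule seq_suble[OF \<sigma>(1)])
          finally show "m \<le> \<sigma> (n (\<rho> m))" .
        qed auto
        then show "\<forall>\<^sub>F m in sequentially. norm (y i - L (a (\<sigma> (n (\<rho> m)))) (z (\<rho> m)) i) \<le> (1 / 2 :: real) ^ m"
          using z(2)[OF i] by (intro always_eventually allI) (metis order_trans real_norm_def)
        show "(\<lambda>m. (1 / 2 :: real) ^ m) \<longlonglongrightarrow> 0" by (rule LIMSEQ_power_zero) simp
      qed
      ultimately have "(\<lambda>m. (y i - L (a (\<sigma> (n (\<rho> m)))) (z (\<rho> m)) i) + L (a (\<sigma> (n (\<rho> m)))) (z (\<rho> m)) i) \<longlonglongrightarrow> 0 + L A x i"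
        by (intro tendsto_add)
      then show ?thesis by (simp add: LIMSEQ_const_iff)
    qed
    moreover have "lin N A ({..<Suc D} \<times> {..<N}) x i = L A x i" if "i \<in> J" for i
    proof -
      have "i - N < Suc D" "N + (i - N) = i" using that by (auto simp: J_def)
      then show ?thesis using lin_full[of N x "i - N" "Suc D" A] supp[OF x(1)] by (simp add: L_def)
    qed
    ultimately have "y \<in> proj J ?W" unfolding proj_def using x(1) by (auto intro!: bexI[of _ x])
    moreover have "y \<in> extensional J" using y G(3) by (fastforce simp: H_def PiE_def)
    ultimately show "y \<in> trace_on J ?W" by (simp add: trace_on_iff)
  qed
  ultimately have "emeasure ?M (\<Inter>m. H m) = 0"
    by (metis emeasure_eq_0 null_setsD1 null_setsD2)
  then show False using pos \<eta> by simp
qed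

text \<open>Dimension and exponent are both multiplied by \<open>Suc m\<close>, and hence so is
  their difference.\<close>

lemma frostman_power:
  assumes W: "dset R M W" "compact W" "small d W" "frostman s W"
  shows "\<exists>N V. dset R N V \<and> compact V \<and> small (Suc m * d) V \<and> frostman (real (Suc m) * s) V"
proof (induction m)
  case 0
  then show ?case using W by auto
next
  case (Suc m)
  then obtain N V where V: "dset R N V" "compact V" "small (Suc m * d) V" "frostman (real (Suc m) * s) V"
    by blast
  have "frostman (s + real (Suc m) * s) (join_set M W V)"
    using W(1) by (intro frostman_join_set W(4) V(4)) (simp add: dset_def)
  moreover have "small (d + Suc m * d) (join_set M W V)" by (rule small_join_set[OF W(3) V(3)])
  ultimately show ?case
    using dset_join_set[OF W(1) V(1)] compact_join_set[OF W(2) V(2)]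
    by (intro exI[of _ "M + N"] exI[of _ "join_set M W V"]) (simp add: algebra_simps)
qed

lemma small_not_frostman:
  assumes R: "restrained R" and W: "dset R M W" "compact W" "small d W" and s: "real d < s"
  shows "\<not> frostman s W"
proof
  assume F: "frostman s W"
  obtain m :: nat where m: "1 < real m * (s - real d)"
    using reals_Archimedean3[of "s - real d"] s by (metis diff_gt_0_iff_gt)
  obtain N V where V: "dset R N V" "compact V" "small (Suc m * d) V" "frostman (real (Suc m) * s) V"
    using frostman_power[OF W F] by blast
  have "real (Suc m * d) + 1 < real (Suc m) * s"
    using m s by (simp add: algebra_simps)
  then show False by (rule not_frostman[OF R V])
qed

subsection \<open>Hausdorff measure\<close>

definition fine_cover :: "nat \<Rightarrow> real \<Rightarrow> (nat \<Rightarrow> real) set \<Rightarrow> (nat \<Rightarrow> (nat \<Rightarrow> real) set) \<Rightarrow> bool" where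
  "fine_cover n \<delta> X U \<longleftrightarrow> X \<subseteq> (\<Union>i. U i) \<and> (\<forall>i. U i \<subseteq> topspace (Euclidean_space n) \<and>
     (\<forall>x \<in> U i. \<forall>y \<in> U i. euclid_dist n x y \<le> \<delta>))"

lemma hausdorff_null_iff:
  "hausdorff_measure n s X = 0 \<longleftrightarrow>
    (\<forall>\<delta>>0. \<forall>\<epsilon>>0. \<exists>U. fine_cover n \<delta> X U \<and> (\<Sum>i. diam_power n s (U i)) \<le> ennreal \<epsilon>)"
proof -
  have pre: "hausdorff_premeasure n s \<delta> X = (INF U\<in>Collect (fine_cover n \<delta> X). \<Sum>i. diam_power n s (U i))" for \<delta>
    unfolding hausdorff_premeasure_def fine_cover_def ..
  have "hausdorff_premeasure n s \<delta> X = 0 \<longleftrightarrow>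
    (\<forall>\<epsilon>>0. \<exists>U. fine_cover n \<delta> X U \<and> (\<Sum>i. diam_power n s (U i)) \<le> ennreal \<epsilon>)" for \<delta>
  proof (intro iffI allI impI)
    fix \<epsilon> :: real assume "hausdorff_premeasure n s \<delta> X = 0" "0 < \<epsilon>"
    then have "(INF U\<in>Collect (fine_cover n \<delta> X). \<Sum>i. diam_power n s (U i)) < ennreal \<epsilon>"
      by (simp add: pre)
    then show "\<exists>U. fine_cover n \<delta> X U \<and> (\<Sum>i. diam_power n s (U i)) \<le> ennreal \<epsilon>"
      unfolding INF_less_iff by (auto intro: less_imp_le)
  next
    assume *: "\<forall>\<epsilon>>0. \<exists>U. fine_cover n \<delta> X U \<and> (\<Sum>i. diam_power n s (U i)) \<le> ennreal \<epsilon>"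
    have "hausdorff_premeasure n s \<delta> X \<le> 0"
    proof (rule ennreal_le_epsilon)
      fix \<epsilon> :: real assume "0 < \<epsilon>"
      then obtain U where "fine_cover n \<delta> X U" "(\<Sum>i. diam_power n s (U i)) \<le> ennreal \<epsilon>" using * by blast
      then show "hausdorff_premeasure n s \<delta> X \<le> 0 + ennreal \<epsilon>"
        unfolding pre by (intro INF_lower2[of U]) auto
    qed
    then show "hausdorff_premeasure n s \<delta> X = 0" by simp
  qed
  moreover have "hausdorff_measure n s X = 0 \<longleftrightarrow> (\<forall>\<delta>>0. hausdorff_premeasure n s \<delta> X = 0)"
    unfolding hausdorff_measure_def bot_ennreal[symmetric] SUP_bot_conv by auto
  ultimately show ?thesis by simp
qed

lemma hausdorff_null_UN:
  assumes "\<And>k :: nat. hausdorff_measure n s (X k) = 0"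
  shows "hausdorff_measure n s (\<Union>k. X k) = 0"
  unfolding hausdorff_null_iff
proof (intro allI impI)
  fix \<delta> \<epsilon> :: real assume "0 < \<delta>" "0 < \<epsilon>"
  have "\<exists>U. fine_cover n \<delta> (X k) U \<and> (\<Sum>i. diam_power n s (U i)) \<le> ennreal (\<epsilon> * (1 / 2) ^ Suc k)" for k
    using assms[of k, unfolded hausdorff_null_iff, rule_format, OF \<open>0 < \<delta>\<close>, of "\<epsilon> * (1 / 2) ^ Suc k"] \<open>0 < \<epsilon>\<close> by simp
  then obtain U where U: "\<And>k. fine_cover n \<delta> (X k) (U k)"
    "\<And>k. (\<Sum>i. diam_power n s (U k i)) \<le> ennreal (\<epsilon> * (1 / 2) ^ Suc k)"
    by metis
  define V where "V m = (\<lambda>(k, i). U k i) (prod_decode m)" for m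
  show "\<exists>U. fine_cover n \<delta> (\<Union>k. X k) U \<and> (\<Sum>i. diam_power n s (U i)) \<le> ennreal \<epsilon>"
  proof (intro exI conjI)
    have "x \<in> (\<Union>m. V m)" if x: "x \<in> X k" for x k
    proof -
      obtain i where "x \<in> U k i" using U(1)[of k] x unfolding fine_cover_def by blast
      then have "x \<in> V (prod_encode (k, i))" by (simp add: V_def)
      then show ?thesis by blast
    qed
    then show "fine_cover n \<delta> (\<Union>k. X k) V"
      using U(1) unfolding fine_cover_def by (auto simp: V_def split: prod.split)
    have "(\<Sum>m. diam_power n s (V m)) = (\<Sum>k. \<Sum>i. diam_power n s (U k i))"
      using suminf_ennreal_2dimen[of "\<lambda>k. \<Sum>i. diam_power n s (U k i)" "\<lambda>(k, i). diam_power n s (U k i)"]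
      by (simp add: V_def split_def)
    also have "\<dots> \<le> (\<Sum>k. ennreal (\<epsilon> * (1 / 2) ^ Suc k))" by (intro suminf_le U(2)) auto
    also have "\<dots> = ennreal (\<Sum>k. \<epsilon> * (1 / 2) ^ Suc k)"
      using \<open>0 < \<epsilon>\<close> by (intro suminf_ennreal2 summable_mult sums_summable[OF power_half_series]) auto
    also have "(\<Sum>k. \<epsilon> * (1 / 2) ^ Suc k) = \<epsilon>"
      using sums_unique[OF sums_mult[OF power_half_series, of \<epsilon>]] by simp
    finally show "(\<Sum>m. diam_power n s (V m)) \<le> ennreal \<epsilon>" .
  qed
qed

lemma euclid_dist_nonneg: "0 \<le> euclid_dist n x y"
  by (simp add: euclid_dist_def L2_set_nonneg)

lemma diam_power_le:
  assumes "0 < s" and "\<And>x y. x \<in> U \<Longrightarrow> y \<in> U \<Longrightarrow> euclid_dist n x y \<le> B" and "0 \<le> B"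
  shows "diam_power n s U \<le> ennreal (B powr s)"
proof (cases "U = {}")
  case False
  then obtain x where x: "x \<in> U" by blast
  have bdd: "bdd_above ((\<lambda>(x, y). euclid_dist n x y) ` (U \<times> U))"
    using assms(2) by (intro bdd_aboveI[of _ B]) auto
  have "euclid_dist n x x \<le> euclid_diam n U"
    unfolding euclid_diam_def using False x by (auto intro!: cSUP_upper2[OF bdd, of "(x, x)"])
  then have "0 \<le> euclid_diam n U" by (rule order_trans[OF euclid_dist_nonneg])
  moreover have "euclid_diam n U \<le> B"
    unfolding euclid_diam_def using False assms(2) by (auto intro!: cSUP_least)
  ultimately have "euclid_diam n U powr s \<le> B powr s" using assms(1) by (intro powr_mono2) auto
  then show ?thesis using False assms(1) by (simp add: diam_power_def ennreal_leI)
qed (simp add: diam_power_def)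

lemma euclid_dist_le:
  assumes "\<And>j. \<bar>x j - y j\<bar> \<le> r"
  shows "euclid_dist n x y \<le> real n * r"
proof -
  have "euclid_dist n x y \<le> (\<Sum>j<n. \<bar>x j - y j\<bar>)" unfolding euclid_dist_def by (rule L2_set_le_sum_abs)
  also have "\<dots> \<le> (\<Sum>j<n. r)" by (intro sum_mono assms)
  finally show ?thesis by simp
qed

text \<open>By \<open>frostman_of_content\<close> there are finite covers by cubes of arbitrarily
  small content. Small content also makes every single cube small, so no separate argument is needed
  to refine a cover to diameter \<open>\<delta>\<close>.\<close>

lemma hausdorff_null_of_not_frostman:
  assumes bnd: "\<And>x j. x \<in> W \<Longrightarrow> \<bar>x j\<bar> \<le> b" and supp: "\<And>x j. x \<in> W \<Longrightarrow> j \<ge> n \<Longrightarrow> x j = 0"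
    and "0 < s" and W: "\<not> frostman s W"
  shows "hausdorff_measure n s W = 0"
  unfolding hausdorff_null_iff
proof (intro allI impI)
  fix \<delta> \<epsilon> :: real assume "0 < \<delta>" "0 < \<epsilon>"
  \<comment> \<open>Cubes of side 2^-i have diameter at most n 2^-i; the extra 1 keeps
    \<open>A\<close> positive for n = 0.\<close>
  define A where "A = real n + 1"
  have "0 < A" by (simp add: A_def)
  \<comment> \<open>The first bound controls the sum of the powers of the diameters; the second
    forces A 2^-i \<le> \<delta> for each cube used.\<close>
  define c where "c = min (\<epsilon> / A powr s) ((\<delta> / A) powr s)"
  have "0 < c" using \<open>0 < \<delta>\<close> \<open>0 < \<epsilon>\<close> \<open>0 < A\<close> by (simp add: c_def)
  have "\<exists>\<C>. finite \<C> \<and> (\<forall>x\<in>W. \<exists>i. (i, cube i x) \<in> \<C>) \<and> (\<Sum>(i, q)\<in>\<C>. 2 powr (- (s * real i))) < c"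
  proof (rule ccontr)
    assume none: "\<nexists>\<C>. finite \<C> \<and> (\<forall>x\<in>W. \<exists>i. (i, cube i x) \<in> \<C>) \<and> (\<Sum>(i, q)\<in>\<C>. 2 powr (- (s * real i))) < c"
    have "frostman s W"
    proof (rule frostman_of_content[of W b n c])
      show "c \<le> (\<Sum>(i, q)\<in>\<C>. 2 powr (- (s * real i)))"
        if "finite \<C>" "\<And>x. x \<in> W \<Longrightarrow> \<exists>i. (i, cube i x) \<in> \<C>" for \<C>
        using none that by (meson not_le)
    qed (use bnd supp \<open>0 < c\<close> in auto)
    then show False using W by simp
  qed
  then obtain \<C> where \<C>: "finite \<C>" "\<And>x. x \<in> W \<Longrightarrow> \<exists>i. (i, cube i x) \<in> \<C>"
    "(\<Sum>(i, q)\<in>\<C>. 2 powr (- (s * real i))) < c" by blast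
  have level: "A * (1 / 2) ^ i \<le> \<delta>" "A powr s * 2 powr (- (s * real i)) = (A * (1 / 2) ^ i) powr s"
    if "(i, q) \<in> \<C>" for i q
  proof -
    have half: "2 powr (- (s * real i)) = ((1 / 2) ^ i) powr s"
    proof -
      have "(1 / 2 :: real) ^ i = 2 powr (- real i)" by (simp add: powr_minus powr_realpow power_one_over field_simps)
      then show ?thesis by (simp add: powr_powr mult.commute)
    qed
    then show "A powr s * 2 powr (- (s * real i)) = (A * (1 / 2) ^ i) powr s"
      using \<open>0 < A\<close> by (simp add: powr_mult)
    have "2 powr (- (s * real i)) \<le> (\<Sum>(i, q)\<in>\<C>. 2 powr (- (s * real i)))"
      using member_le_sum[OF that, of "\<lambda>(i, q). 2 powr (- (s * real i))"] \<C>(1) by auto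
    also have "\<dots> < c" by (rule \<C>(3))
    also have "\<dots> \<le> (\<delta> / A) powr s" by (simp add: c_def)
    finally have "((1 / 2) ^ i) powr s < (\<delta> / A) powr s" unfolding half .
    then have "(1 / 2) ^ i < \<delta> / A"
      using powr_mono2[of s "\<delta> / A" "(1 / 2) ^ i"] \<open>0 < s\<close> \<open>0 < \<delta>\<close> \<open>0 < A\<close> by force
    then show "A * (1 / 2) ^ i \<le> \<delta>" using \<open>0 < A\<close> by (simp add: field_simps)
  qed
  obtain e where e: "bij_betw e {..<card \<C>} \<C>"
    using ex_bij_betw_nat_finite[OF \<C>(1)] by (auto simp: atLeast0LessThan)
  define C where "C = (\<lambda>(i, q). {x \<in> topspace (Euclidean_space n). cube i x = q})"
  define U where "U m = (if m < card \<C> then C (e m) else {})" for m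
  have dist: "euclid_dist n x y \<le> A * (1 / 2) ^ i" if "x \<in> C (i, q)" "y \<in> C (i, q)" for x y i q
  proof -
    have "\<bar>x j - y j\<bar> \<le> (1 / 2) ^ i" for j
    proof -
      have "\<lfloor>2 ^ i * x j\<rfloor> = \<lfloor>2 ^ i * y j\<rfloor>" using that by (auto simp: C_def cube_def fun_eq_iff)
      then show ?thesis by (rule floor_scaled_eq_imp_close)
    qed
    then have "euclid_dist n x y \<le> real n * (1 / 2) ^ i" by (rule euclid_dist_le)
    also have "\<dots> \<le> A * (1 / 2) ^ i" by (intro mult_right_mono) (simp_all add: A_def)
    finally show ?thesis .
  qed
  show "\<exists>U. fine_cover n \<delta> W U \<and> (\<Sum>i. diam_power n s (U i)) \<le> ennreal \<epsilon>"
  proof (intro exI conjI)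
    have "x \<in> (\<Union>m. U m)" if x: "x \<in> W" for x
    proof -
      obtain i where i: "(i, cube i x) \<in> \<C>" using \<C>(2)[OF x] by blast
      then have "(i, cube i x) \<in> e ` {..<card \<C>}" using e by (simp add: bij_betw_def)
      then obtain m where "m < card \<C>" "e m = (i, cube i x)" by auto
      then have "x \<in> U m" using supp[OF x] by (auto simp: U_def C_def topspace_Euclidean_space)
      then show ?thesis by blast
    qed
    moreover have "euclid_dist n x y \<le> \<delta>" if xy: "x \<in> U m" "y \<in> U m" for x y m
    proof -
      have m: "m < card \<C>" using xy by (auto simp: U_def split: if_splits)
      obtain i q where iq: "e m = (i, q)" by (cases "e m")
      then have "(i, q) \<in> \<C>" using e m by (metis bij_betwE lessThan_iff)
      then show ?thesis using dist[of x i q y] level(1)[of i q] xy m iq by (simp add: U_def)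
    qed
    moreover have "U m \<subseteq> topspace (Euclidean_space n)" for m
      by (auto simp: U_def C_def split: prod.splits if_splits)
    ultimately show "fine_cover n \<delta> W U" unfolding fine_cover_def by blast
    have "(\<Sum>m. diam_power n s (U m)) = (\<Sum>m<card \<C>. diam_power n s (U m))"
      by (rule suminf_finite) (auto simp: U_def diam_power_def)
    also have "\<dots> = (\<Sum>m<card \<C>. diam_power n s (C (e m)))" by (simp add: U_def)
    also have "\<dots> = (\<Sum>p\<in>\<C>. diam_power n s (C p))" by (rule sum.reindex_bij_betw[OF e])
    also have "\<dots> \<le> (\<Sum>(i, q)\<in>\<C>. ennreal (A powr s * 2 powr (- (s * real i))))"
    proof (rule sum_mono)
      fix p assume "p \<in> \<C>"
      then obtain i q where p: "p = (i, q)" "(i, q) \<in> \<C>" by (cases p) auto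
      have "diam_power n s (C (i, q)) \<le> ennreal ((A * (1 / 2) ^ i) powr s)"
        using \<open>0 < A\<close> by (intro diam_power_le[OF \<open>0 < s\<close>] dist) auto
      then show "diam_power n s (C p) \<le> (case p of (i, q) \<Rightarrow> ennreal (A powr s * 2 powr (- (s * real i))))"
        using level(2)[OF p(2)] p(1) by simp
    qed
    also have "\<dots> = ennreal (A powr s * (\<Sum>(i, q)\<in>\<C>. 2 powr (- (s * real i))))"
      by (simp add: split_def sum_distrib_left sum_ennreal)
    also have "\<dots> \<le> ennreal \<epsilon>"
    proof (rule ennreal_leI)
      have "A powr s * (\<Sum>(i, q)\<in>\<C>. 2 powr (- (s * real i))) \<le> A powr s * (\<epsilon> / A powr s)"
        using \<C>(3) by (intro mult_left_mono) (auto simp: c_def)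
      then show "A powr s * (\<Sum>(i, q)\<in>\<C>. 2 powr (- (s * real i))) \<le> \<epsilon>" using \<open>0 < A\<close> by simp
    qed
    finally show "(\<Sum>m. diam_power n s (U m)) \<le> ennreal \<epsilon>" .
  qed
qed

lemma interior_proj_contains_box:
  assumes "interior (proj I X) \<noteq> {}"
  obtains p e where "0 < e" "(\<Pi>\<^sub>E i\<in>I. {p i - e..p i + e :: real}) \<subseteq> trace_on I X"
proof -
  obtain p where p: "p \<in> interior (proj I X)" using assms by blast
  obtain F e where "finite F" and e: "0 < e" "{v. \<forall>j\<in>F. \<bar>v j - p j\<bar> \<le> e} \<subseteq> interior (proj I X)"
    by (rule open_contains_coordinate_box[OF open_interior p])
  have "y \<in> trace_on I X" if y: "y \<in> (\<Pi>\<^sub>E i\<in>I. {p i - e..p i + e})" for y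
  proof -
    let ?v = "\<lambda>i. if i \<in> I then y i else p i"
    have yi: "\<bar>y i - p i\<bar> \<le> e" if "i \<in> I" for i
    proof -
      have "y i \<in> {p i - e..p i + e}" using y that by (rule PiE_mem)
      then show ?thesis by (auto simp: abs_le_iff)
    qed
    have "?v \<in> {v. \<forall>j\<in>F. \<bar>v j - p j\<bar> \<le> e}" using yi e(1) by simp
    then have "?v \<in> proj I X" by (rule subsetD[OF interior_subset subsetD[OF e(2)]])
    then have "y \<in> proj I X" unfolding proj_def by auto
    then show ?thesis using y by (simp add: trace_on_iff PiE_def)
  qed
  then show ?thesis using that[of e p] e(1) by blast
qed

lemma emeasure_coordinate_box:
  assumes "finite I" "0 \<le> e"
  shows "(\<Pi>\<^sub>E i\<in>I. {p i - e..p i + e}) \<in> sets (Pi\<^sub>M I (\<lambda>_. lborel :: real measure))"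
    and "emeasure (Pi\<^sub>M I (\<lambda>_. lborel)) (\<Pi>\<^sub>E i\<in>I. {p i - e..p i + e}) = ennreal ((2 * e) ^ card I)"
proof -
  interpret product_sigma_finite "\<lambda>_. lborel :: real measure" by standard
  show "(\<Pi>\<^sub>E i\<in>I. {p i - e..p i + e}) \<in> sets (Pi\<^sub>M I (\<lambda>_. lborel))"
    using assms by (intro sets_PiM_I_finite) auto
  have "emeasure (Pi\<^sub>M I (\<lambda>_. lborel)) (\<Pi>\<^sub>E i\<in>I. {p i - e..p i + e}) =
    (\<Prod>i\<in>I. emeasure lborel {p i - e..p i + e})"
    using assms by (intro emeasure_PiM) auto
  also have "\<dots> = (\<Prod>i\<in>I. ennreal (2 * e))" using assms(2) by (intro prod.cong) auto
  also have "\<dots> = ennreal ((2 * e) ^ card I)"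
    using assms(2) by (simp only: prod_constant ennreal_power mult_nonneg_nonneg zero_le_numeral)
  finally show "emeasure (Pi\<^sub>M I (\<lambda>_. lborel)) (\<Pi>\<^sub>E i\<in>I. {p i - e..p i + e}) = ennreal ((2 * e) ^ card I)" .
qed

text \<open>A set of diameter \<open>d\<close> projects into a box of side 2 d. Since d \<le> 1 and
  s < card I, its volume is at most 2^card I times \<open>d^s\<close>, so a cheap cover would have a
  projection too small to contain a box.\<close>

lemma hausdorff_positive_of_projection:
  assumes I: "I \<subseteq> {..<n}" "interior (proj I X) \<noteq> {}" and s: "0 \<le> s" "s < real (card I)"
  shows "hausdorff_measure n s X \<noteq> 0"
proof
  assume null: "hausdorff_measure n s X = 0"
  let ?M = "Pi\<^sub>M I (\<lambda>_. lborel :: real measure)"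
  have fin: "finite I" using I(1) by (rule finite_subset) simp
  obtain p e where e: "0 < e" "(\<Pi>\<^sub>E i\<in>I. {p i - e..p i + e}) \<subseteq> trace_on I X"
    by (rule interior_proj_contains_box[OF I(2)])
  \<comment> \<open>The box in the projection has volume (2 e)^card I, while the cover accounts for
    at most 2^card I * \<epsilon>, half of that.\<close>
  define \<epsilon> where "\<epsilon> = e ^ card I / 2"
  have "0 < \<epsilon>" using e by (simp add: \<epsilon>_def)
  then obtain U where U: "fine_cover n 1 X U" "(\<Sum>i. diam_power n s (U i)) \<le> ennreal \<epsilon>"
    using null[unfolded hausdorff_null_iff, rule_format, of 1 \<epsilon>] by auto
  have "\<exists>B\<in>sets ?M. trace_on I (U m) \<subseteq> B \<and> emeasure ?M B \<le> ennreal (2 ^ card I) * diam_power n s (U m)" for m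
  proof (cases "U m = {}")
    case True
    then show ?thesis by (intro bexI[of _ "{}"]) (auto simp: trace_on_def)
  next
    case False
    then obtain c where c: "c \<in> U m" by blast
    have le1: "euclid_dist n x y \<le> 1" if "x \<in> U m" "y \<in> U m" for x y
      using U(1) that unfolding fine_cover_def by blast
    have bdd: "bdd_above ((\<lambda>(x, y). euclid_dist n x y) ` (U m \<times> U m))"
      using le1 by (intro bdd_aboveI[of _ 1]) auto
    let ?d = "euclid_diam n (U m)"
    have d: "euclid_dist n x y \<le> ?d" if "x \<in> U m" "y \<in> U m" for x y
      unfolding euclid_diam_def using False that by (auto intro!: cSUP_upper2[OF bdd, of "(x, y)"])
    have "?d \<le> 1" unfolding euclid_diam_def using False le1 by (auto intro!: cSUP_least)
    have "0 \<le> ?d" using d[OF c c] by (rule order_trans[OF euclid_dist_nonneg])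
    let ?B = "\<Pi>\<^sub>E i\<in>I. {c i - ?d..c i + ?d}"
    have "trace_on I (U m) \<subseteq> ?B"
    proof
      fix y assume "y \<in> trace_on I (U m)"
      then obtain x where x: "x \<in> U m" "y = restrict x I" by (auto simp: trace_on_def)
      have "\<bar>x i - c i\<bar> \<le> ?d" if "i \<in> I" for i
      proof -
        have "\<bar>x i - c i\<bar> \<le> L2_set (\<lambda>i. \<bar>x i - c i\<bar>) {..<n}"
          using I(1) that by (intro member_le_L2_set) auto
        also have "\<dots> = euclid_dist n x c" by (simp add: euclid_dist_def L2_set_def)
        also have "\<dots> \<le> ?d" by (rule d[OF x(1) c])
        finally show ?thesis .
      qed
      then have "x i \<in> {c i - ?d..c i + ?d}" if "i \<in> I" for i using that by (fastforce simp: abs_le_iff)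
      then show "y \<in> ?B" using x(2) by simp
    qed
    moreover have "emeasure ?M ?B \<le> ennreal (2 ^ card I) * diam_power n s (U m)"
    proof -
      have "ennreal (?d ^ card I) \<le> diam_power n s (U m)"
      proof (cases "s = 0")
        case True
        then show ?thesis using False \<open>0 \<le> ?d\<close> \<open>?d \<le> 1\<close> by (simp add: diam_power_def power_le_one)
      next
        case s0: False
        have "?d ^ card I \<le> ?d powr s"
        proof (cases "?d = 0")
          case True
          then show ?thesis using s by (simp add: power_0_left)
        next
          case d0: False
          then have "?d ^ card I = ?d powr real (card I)" using \<open>0 \<le> ?d\<close> by (simp add: powr_realpow)
          also have "\<dots> \<le> ?d powr s" using s \<open>0 \<le> ?d\<close> \<open>?d \<le> 1\<close> d0 by (intro powr_mono') auto
          finally show ?thesis .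
        qed
        then show ?thesis using False s0 by (simp add: diam_power_def ennreal_leI)
      qed
      then have "ennreal (2 ^ card I) * ennreal (?d ^ card I) \<le> ennreal (2 ^ card I) * diam_power n s (U m)"
        by (rule mult_left_mono) simp
      then show ?thesis
        using emeasure_coordinate_box(2)[OF fin \<open>0 \<le> ?d\<close>, of c] \<open>0 \<le> ?d\<close>
        by (simp add: power_mult_distrib ennreal_mult)
    qed
    ultimately show ?thesis using emeasure_coordinate_box(1)[OF fin \<open>0 \<le> ?d\<close>, of c] by blast
  qed
  then obtain B where B: "\<And>m. B m \<in> sets ?M" "\<And>m. trace_on I (U m) \<subseteq> B m"
    "\<And>m. emeasure ?M (B m) \<le> ennreal (2 ^ card I) * diam_power n s (U m)" by metis
  have "trace_on I X \<subseteq> (\<Union>m. B m)"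
    using U(1) B(2) unfolding fine_cover_def trace_on_def by blast
  then have "(\<Pi>\<^sub>E i\<in>I. {p i - e..p i + e}) \<subseteq> (\<Union>m. B m)" using e(2) by (rule order_trans[rotated])
  then have "emeasure ?M (\<Pi>\<^sub>E i\<in>I. {p i - e..p i + e}) \<le> emeasure ?M (\<Union>m. B m)"
    using B(1) by (intro emeasure_mono sets.countable_UN) auto
  then have "ennreal ((2 * e) ^ card I) \<le> emeasure ?M (\<Union>m. B m)"
    by (simp only: emeasure_coordinate_box(2)[OF fin less_imp_le[OF e(1)]])
  also have "\<dots> \<le> (\<Sum>m. emeasure ?M (B m))" using B(1) by (intro emeasure_subadditive_countably) auto
  also have "\<dots> \<le> (\<Sum>m. ennreal (2 ^ card I) * diam_power n s (U m))" by (intro suminf_le B(3)) auto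
  also have "\<dots> = ennreal (2 ^ card I) * (\<Sum>m. diam_power n s (U m))" by simp
  also have "\<dots> \<le> ennreal (2 ^ card I) * ennreal \<epsilon>" using U(2) by (rule mult_left_mono) simp
  also have "\<dots> = ennreal (2 ^ card I * \<epsilon>)" using \<open>0 < \<epsilon>\<close> by (simp add: ennreal_mult)
  finally have "(2 * e) ^ card I \<le> 2 ^ card I * \<epsilon>" using \<open>0 < \<epsilon>\<close> by simp
  then show False using e(1) by (simp add: \<epsilon>_def power_mult_distrib)
qed

subsection \<open>Coordinate subspaces\<close>

text \<open>Passes between relative interior in a coordinate subspace and interior of the cylinder
  over it: an open cylinder is sliced at the outer coordinates of one of its points, and a
  relatively open set is pulled back along \<open>coord_proj\<close>.\<close>

lemma interior_of_coord_subspace_eq_empty: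
  assumes S: "S \<subseteq> coord_subspace I"
  shows "top_of_set (coord_subspace I) interior_of S = {} \<longleftrightarrow> interior {v. coord_proj I v \<in> S} = {}"
proof
  assume empty: "top_of_set (coord_subspace I) interior_of S = {}"
  show "interior {v. coord_proj I v \<in> S} = {}"
  proof (rule ccontr)
    let ?G = "interior {v. coord_proj I v \<in> S}"
    assume "?G \<noteq> {}"
    then obtain g where g: "g \<in> ?G" by blast
    let ?f = "\<lambda>x i. if i \<in> I then x i else g i"
    have "open (?f -` ?G)"
      by (intro open_vimage open_interior continuous_on_coordinatewise_then_product
          continuous_on_if_const continuous_intros)
    then have "openin (top_of_set (coord_subspace I)) (coord_subspace I \<inter> ?f -` ?G)"
      by (rule openin_open_Int)
    moreover have "coord_subspace I \<inter> ?f -` ?G \<subseteq> S"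
    proof
      fix x assume x: "x \<in> coord_subspace I \<inter> ?f -` ?G"
      then have "?f x \<in> ?G" by simp
      then have "coord_proj I (?f x) \<in> S" using interior_subset by blast
      moreover have "coord_proj I (?f x) = x" using x by (auto simp: coord_proj_def coord_subspace_def)
      ultimately show "x \<in> S" by simp
    qed
    ultimately have none: "coord_subspace I \<inter> ?f -` ?G = {}"
      using interior_of_maximal[of "coord_subspace I \<inter> ?f -` ?G" S] empty by blast
    have "coord_proj I g \<in> coord_subspace I" by (simp add: coord_proj_def coord_subspace_def)
    moreover have "?f (coord_proj I g) = g" by (auto simp: coord_proj_def)
    ultimately have "coord_proj I g \<in> coord_subspace I \<inter> ?f -` ?G" using g by simp
    then show False using none by blast
  qed
next
  assume empty: "interior {v. coord_proj I v \<in> S} = {}"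
  show "top_of_set (coord_subspace I) interior_of S = {}"
  proof (rule ccontr)
    assume "top_of_set (coord_subspace I) interior_of S \<noteq> {}"
    then obtain x T where T: "openin (top_of_set (coord_subspace I)) T" "x \<in> T" "T \<subseteq> S"
      unfolding interior_of_def by blast
    then obtain O' where O': "open O'" "T = coord_subspace I \<inter> O'" by (auto simp: openin_open)
    have "open (coord_proj I -` O')" by (intro open_vimage O' continuous_on_coord_proj)
    moreover have "coord_proj I -` O' \<subseteq> {v. coord_proj I v \<in> S}"
    proof
      fix v assume "v \<in> coord_proj I -` O'"
      then have "coord_proj I v \<in> T" using O'(2) by (simp add: coord_proj_def coord_subspace_def)
      then show "v \<in> {v. coord_proj I v \<in> S}" using T(3) by blast
    qed
    ultimately have none: "coord_proj I -` O' = {}" using empty interior_maximal by blast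
    have "coord_proj I x = x" using T(2) O'(2) by (auto simp: coord_proj_def coord_subspace_def)
    then have "x \<in> coord_proj I -` O'" using T(2) O'(2) by simp
    then show False using none by blast
  qed
qed

lemma coord_proj_image: "{v. coord_proj I v \<in> coord_proj I ` X} = proj I X"
proof (intro set_eqI iffI)
  fix v assume "v \<in> {v. coord_proj I v \<in> coord_proj I ` X}"
  then obtain w where w: "w \<in> X" "coord_proj I v = coord_proj I w" by auto
  have "w i = v i" if "i \<in> I" for i
    using fun_cong[OF w(2), of i] that by (simp add: coord_proj_def)
  then show "v \<in> proj I X" using w(1) by (auto simp: proj_def)
next
  fix v assume "v \<in> proj I X"
  then obtain w where "w \<in> X" "\<forall>i\<in>I. w i = v i" by (auto simp: proj_def)
  then show "v \<in> {v. coord_proj I v \<in> coord_proj I ` X}"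
    by (auto simp: coord_proj_def fun_eq_iff intro!: rev_image_eqI[of w])
qed

lemma Euclidean_space_coord_subspace: "Euclidean_space n = top_of_set (coord_subspace {..<n})"
  unfolding Euclidean_space_def euclidean_product_topology coord_subspace_def by (simp add: not_less)

lemma subtopology_coord_subspace:
  assumes "I \<subseteq> {..<n}"
  shows "subtopology (Euclidean_space n) (coord_subspace I) = top_of_set (coord_subspace I)"
proof -
  have "coord_subspace {..<n} \<inter> coord_subspace I = coord_subspace I"
    using assms by (auto simp: coord_subspace_def)
  then show ?thesis by (simp add: Euclidean_space_coord_subspace subtopology_subtopology)
qed

lemma interior_of_projection_eq_empty:
  assumes "I \<subseteq> {..<n}"
  shows "subtopology (Euclidean_space n) (coord_subspace I) interior_of (coord_proj I ` X) = {} \<longleftrightarrow>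
    interior (proj I X) = {}"
proof -
  have "coord_proj I ` X \<subseteq> coord_subspace I" by (auto simp: coord_proj_def coord_subspace_def)
  then show ?thesis
    unfolding subtopology_coord_subspace[OF assms]
    by (simp only: interior_of_coord_subspace_eq_empty coord_proj_image)
qed

lemma coord_proj_support: "X \<subseteq> {x. \<forall>i\<ge>n. x i = 0} \<Longrightarrow> coord_proj {..<n} ` X = X"
proof -
  assume X: "X \<subseteq> {x. \<forall>i\<ge>n. x i = 0}"
  have "coord_proj {..<n} x = x" if "x \<in> X" for x
    using X that by (auto simp: coord_proj_def fun_eq_iff)
  then show ?thesis by force
qed

lemma interior_of_Euclidean_eq_empty:
  assumes "X \<subseteq> {x. \<forall>i\<ge>n. x i = 0}"
  shows "Euclidean_space n interior_of X = {} \<longleftrightarrow> interior (proj {..<n} X) = {}"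
proof -
  have "X \<subseteq> coord_subspace {..<n}" using assms by (auto simp: coord_subspace_def)
  from interior_of_coord_subspace_eq_empty[OF this] show ?thesis
    unfolding Euclidean_space_coord_subspace
    using coord_proj_image[of "{..<n}" X] by (simp only: coord_proj_support[OF assms])
qed

lemma nowhere_dense_in_Euclidean:
  assumes X: "X \<subseteq> {x. \<forall>i\<ge>n. x i = 0}" and "interior (closure (proj {..<n} X)) = {}"
  shows "nowhere_dense_in (Euclidean_space n) X"
proof -
  let ?S = "Euclidean_space n closure_of X"
  have S: "?S \<subseteq> {x. \<forall>i\<ge>n. x i = 0}"
    using closure_of_subset_topspace[of "Euclidean_space n" X] by (simp only: topspace_Euclidean_space)
  have S_closure: "?S \<subseteq> closure X"
    unfolding Euclidean_space_coord_subspace closure_of_subtopology by (auto intro: closure_mono[THEN subsetD])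
  have "proj {..<n} ?S \<subseteq> closure (proj {..<n} X)"
  proof
    fix v assume "v \<in> proj {..<n} ?S"
    then obtain w where w: "w \<in> ?S" "\<forall>i\<in>{..<n}. w i = v i" by (auto simp: proj_def)
    \<comment> \<open>Overwriting the outer coordinates by those of \<open>v\<close> maps
      \<open>X\<close> into its cylinder and the limit point \<open>w\<close> to
      \<open>v\<close>.\<close>
    let ?f = "\<lambda>x i. if i < n then x i else v i"
    have f: "continuous_on UNIV ?f"
      by (intro continuous_on_coordinatewise_then_product continuous_on_if_const continuous_intros)
    have img: "?f ` closure X \<subseteq> closure (?f ` X)"
      by (rule image_closure_subset[OF continuous_on_subset[OF f] closed_closure closure_subset]) simp
    have fw: "?f w = v" using w(2) by auto
    have "?f w \<in> closure (?f ` X)" by (rule subsetD[OF img imageI[OF subsetD[OF S_closure w(1)]]])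
    then have "v \<in> closure (?f ` X)" by (simp only: fw)
    moreover have "?f ` X \<subseteq> proj {..<n} X" by (auto simp: proj_def)
    ultimately show "v \<in> closure (proj {..<n} X)" using closure_mono by blast
  qed
  then have "interior (proj {..<n} ?S) = {}" using assms(2) interior_mono by blast
  then show ?thesis unfolding nowhere_dense_in_def interior_of_Euclidean_eq_empty[OF S] .
qed

subsection \<open>Compact exhaustion and the dimension formula\<close>

text \<open>\<open>small\<close> quantifies over all finite index sets; if one contains an index
  from \<open>n\<close> on, the projection lies in a hyperplane.\<close>

lemma small_compact_part:
  assumes W: "\<And>w i. w \<in> W \<Longrightarrow> i \<ge> n \<Longrightarrow> w i = 0"
    and I: "\<And>I. I \<subseteq> {..<n} \<Longrightarrow> card I = Suc d \<Longrightarrow> interior (proj I W) = {}"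
  shows "small d W"
  unfolding small_def
proof (intro allI impI)
  fix I :: "nat set" assume card: "finite I \<and> card I = Suc d"
  show "interior (proj I W) = {}"
  proof (cases "I \<subseteq> {..<n}")
    case False
    then obtain i where i: "i \<in> I" "n \<le> i" by (auto simp: subset_iff not_less)
    then have zero: "v i = 0" if "v \<in> proj I W" for v
      using that W unfolding proj_def by force
    show ?thesis
    proof (rule ccontr)
      assume "interior (proj I W) \<noteq> {}"
      then obtain g where g: "g \<in> interior (proj I W)" by blast
      have "open ((\<lambda>t. g(i := t)) -` interior (proj I W))"
        by (rule open_vimage[OF open_interior continuous_on_coordinate_update])
      moreover have "(\<lambda>t. g(i := t)) -` interior (proj I W) \<subseteq> {0}"
      proof
        fix t assume "t \<in> (\<lambda>t. g(i := t)) -` interior (proj I W)"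
        then have "g(i := t) \<in> proj I W" using interior_subset by blast
        from zero[OF this] show "t \<in> {0}" by simp
      qed
      ultimately have "(\<lambda>t. g(i := t)) -` interior (proj I W) = {}"
        using interior_maximal interior_singleton by blast
      moreover have "g i \<in> (\<lambda>t. g(i := t)) -` interior (proj I W)" using g by simp
      ultimately show False by blast
    qed
  qed (use I card in blast)
qed

text \<open>To the closed witness \<open>Y\<close> a further coordinate \<open>Suc n\<close> is
  added that bounds all others from above. Its sublevel sets are compact and definable, and the
  projection is unchanged since every point has such a bound.\<close>

lemma D_Sigma_exhaustion:
  assumes "D_Sigma R n X"
  obtains Z where "closed Z" "dset R (Suc (Suc n)) Z" "\<And>w i. w \<in> Z \<Longrightarrow> \<bar>w i\<bar> \<le> w (Suc n)" "X = trunc n ` Z"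
proof -
  obtain Y where Y: "definable R (Suc n) Y" "closedin (Euclidean_space (Suc n)) Y" "(\<lambda>y. y(n := 0)) ` Y = X"
    using assms unfolding D_Sigma_def by blast
  have Y_supp: "y i = 0" if "y \<in> Y" "i \<ge> Suc n" for y i using dfn_definable(2)[OF Y(1)] that by blast
  have tr: "trunc n y = y(n := 0)" if "y \<in> Y" for y
    using Y_supp[OF that] by (auto simp: trunc_def fun_eq_iff not_less less_Suc_eq_le dest: order_neq_le_trans)
  have "closed {x :: nat \<Rightarrow> real. \<forall>i\<ge>Suc n. x i = 0}"
  proof -
    have "{x :: nat \<Rightarrow> real. \<forall>i\<ge>Suc n. x i = 0} = (\<Inter>i\<in>{Suc n..}. {x. x i = 0})" by auto
    then show ?thesis by (auto intro!: closed_INT closed_Collect_eq continuous_intros)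
  qed
  then have "closed Y"
    using Y(2) closedin_closed_trans unfolding Euclidean_space_def euclidean_product_topology by blast
  define Z where "Z = {w. \<forall>i\<ge>Suc (Suc n). w i = 0} \<inter> (trunc (Suc n) -` Y \<inter> (\<Inter>i\<in>{..n}. {w. \<bar>w i\<bar> \<le> w (Suc n)}))"
  show thesis
  proof (rule that[of Z])
    have "{w :: nat \<Rightarrow> real. \<forall>i\<ge>Suc (Suc n). w i = 0} = (\<Inter>i\<in>{Suc (Suc n)..}. {x. x i = 0})" by auto
    then have "closed {w :: nat \<Rightarrow> real. \<forall>i\<ge>Suc (Suc n). w i = 0}"
      by (auto intro!: closed_INT closed_Collect_eq continuous_intros)
    then show "closed Z" unfolding Z_def
      by (intro closed_Int closed_INT ballI closed_Collect_le continuous_intros closed_vimage[OF \<open>closed Y\<close> continuous_on_trunc])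
    have "dfn R (\<lambda>v. trunc (Suc n) v \<in> Y \<and> (\<forall>i\<in>{..n}. \<bar>v i\<bar> \<le> v (Suc n)))"
      by (intro dfn.conj dfn_definable(1)[OF Y(1)] dfn_ball_finite dfn_abs_le tm.var) simp
    moreover have "(trunc (Suc n) v \<in> Y \<and> (\<forall>i\<in>{..n}. \<bar>v i\<bar> \<le> v (Suc n))) = (trunc (Suc (Suc n)) v \<in> Z)" for v
    proof -
      have "trunc (Suc n) (trunc (Suc (Suc n)) v) = trunc (Suc n) v" by (auto simp: trunc_def)
      then show ?thesis by (auto simp: Z_def) (auto simp: trunc_def)
    qed
    ultimately have "dfn R (\<lambda>v. trunc (Suc (Suc n)) v \<in> Z)" by (rule dfn_cong)
    then show "dset R (Suc (Suc n)) Z" by (auto simp: dset_def Z_def)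
    show "\<bar>w i\<bar> \<le> w (Suc n)" if "w \<in> Z" for w i
    proof -
      have b: "\<bar>w j\<bar> \<le> w (Suc n)" if "j \<le> n" for j using \<open>w \<in> Z\<close> that by (auto simp: Z_def)
      then have pos: "0 \<le> w (Suc n)" using b[of 0] by linarith
      consider "i \<le> n" | "i = Suc n" | "i \<ge> Suc (Suc n)" by linarith
      then show ?thesis using b pos that by cases (auto simp: Z_def)
    qed
    show "X = trunc n ` Z"
    proof
      show "X \<subseteq> trunc n ` Z"
      proof
        fix x assume "x \<in> X"
        then obtain y where y: "y \<in> Y" "x = y(n := 0)" using Y(3) by blast
        let ?w = "y(Suc n := \<Sum>i\<le>n. \<bar>y i\<bar>)"
        have "trunc (Suc n) ?w = y" using Y_supp[OF y(1)] by (auto simp: trunc_def)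
        moreover have "\<bar>y i\<bar> \<le> (\<Sum>i\<le>n. \<bar>y i\<bar>)" if "i \<le> n" for i
          using that by (intro member_le_sum) auto
        ultimately have "?w \<in> Z" using y(1) Y_supp[OF y(1)] by (auto simp: Z_def)
        moreover have "trunc n ?w = trunc n y" by (auto simp: trunc_def)
        ultimately show "x \<in> trunc n ` Z" using tr[OF y(1)] y(2) by (metis image_eqI)
      qed
      show "trunc n ` Z \<subseteq> X"
      proof clarify
        fix w assume "w \<in> Z"
        then have "trunc (Suc n) w \<in> Y" by (simp add: Z_def)
        moreover have "trunc n w = (trunc (Suc n) w)(n := 0)" by (auto simp: trunc_def)
        ultimately show "trunc n w \<in> X" using Y(3) by blast
      qed
    qed
  qed
qed

lemma dset_trunc_part:
  assumes Z: "dset R N Z"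
  shows "dset R n (trunc n ` (Z \<inter> {w. w \<rho> \<le> r}))"
  unfolding dset_def
proof
  show "\<forall>w\<in>trunc n ` (Z \<inter> {w. w \<rho> \<le> r}). \<forall>i\<ge>n. w i = 0" by (auto simp: trunc_def)
  have "dfn R (\<lambda>v. \<exists>w\<in>Z. w \<rho> \<le> r \<and> (\<forall>i\<in>{..<n}. w i = v i))"
    by (rule dset_ex[OF Z])
      (intro dfn.conj dfn_le dfn_ball_finite[OF finite_lessThan] dfn.eq tm_trunc tm.var tm.const)
  moreover have "(\<exists>w\<in>Z. w \<rho> \<le> r \<and> (\<forall>i\<in>{..<n}. w i = v i)) = (trunc n v \<in> trunc n ` (Z \<inter> {w. w \<rho> \<le> r}))" for v
  proof -
    have "(\<forall>i\<in>{..<n}. w i = v i) \<longleftrightarrow> trunc n v = trunc n w" for w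
      by (auto simp: trunc_def fun_eq_iff)
    then show ?thesis by auto
  qed
  ultimately show "dfn R (\<lambda>v. trunc n v \<in> trunc n ` (Z \<inter> {w. w \<rho> \<le> r}))" by (rule dfn_cong)
qed

theorem theorem1p10:
  fixes R :: "('f, 'r) expansion" and n :: nat and D :: "(nat \<Rightarrow> real) set"
  assumes "restrained R"
    and "D_Sigma R n D"
    and "D \<noteq> {}"
  shows "(Euclidean_space n interior_of D = {} \<longleftrightarrow> nowhere_dense_in (Euclidean_space n) D)
       \<and> (nowhere_dense_in (Euclidean_space n) D \<longleftrightarrow> lebesgue_null n D)
       \<and> hausdorff_dim n D = of_nat (top_dim n D)"
proof -
  note R = assms(1)
  obtain Z where Z: "closed Z" "dset R (Suc (Suc n)) Z" "\<And>w i. w \<in> Z \<Longrightarrow> \<bar>w i\<bar> \<le> w (Suc n)" "D = trunc n ` Z"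
    using D_Sigma_exhaustion[OF assms(2)] by blast
  have D: "D \<subseteq> {x. \<forall>i\<ge>n. x i = 0}" unfolding Z(4) by (auto simp: trunc_def)
  have DZ: "proj {..<n} D = proj {..<n} Z" unfolding Z(4) proj_def by (auto simp: trunc_def)
  \<comment> \<open>A countable exhaustion of \<open>D\<close> by compact definable sets, to which
    the results on compact sets apply.\<close>
  define K where "K r = trunc n ` (Z \<inter> {w. w (Suc n) \<le> real r})" for r :: nat
  have DK: "D = (\<Union>r. K r)"
  proof -
    have "\<exists>r. w (Suc n) \<le> real r" for w :: "nat \<Rightarrow> real" by (rule real_arch_simple)
    then show ?thesis unfolding Z(4) K_def by blast
  qed
  have K_dset: "dset R n (K r)" for r unfolding K_def by (rule dset_trunc_part[OF Z(2)])
  have K_supp: "x i = 0" if "x \<in> K r" "i \<ge> n" for x i r using that by (auto simp: K_def trunc_def)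
  have K_compact: "compact (K r)" for r
    unfolding K_def by (intro compact_continuous_image continuous_on_trunc compact_sublevel Z)
  have K_sub: "interior (proj I (K r)) \<subseteq> interior (proj I D)" for I r
    by (intro interior_mono proj_mono) (auto simp: DK)
  have traceD: "(\<lambda>x. restrict x {..<n}) ` D = (\<Union>r. trace_on {..<n} (K r))"
    by (auto simp: DK trace_on_def)
  let ?M = "Pi\<^sub>M {..<n} (\<lambda>_. lborel :: real measure)"
  have nd: "nowhere_dense_in (Euclidean_space n) D" if "interior (proj {..<n} D) = {}"
    using strong_Baire[OF R finite_lessThan Z(1,2,3), of n] that DZ by (intro nowhere_dense_in_Euclidean D) simp
  have null: "lebesgue_null n D" if empty: "interior (proj {..<n} D) = {}"
  proof -
    have "trace_on {..<n} (K r) \<in> null_sets ?M" for r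
      using K_sub[of "{..<n}" r] empty by (intro restrained_null[OF R _ K_compact K_dset]) auto
    then have "(\<Union>r. trace_on {..<n} (K r)) \<in> null_sets ?M" by (rule null_sets_UN)
    then show ?thesis unfolding lebesgue_null_def traceD by (rule null_sets_completionI)
  qed
  have nd_int: "interior (proj {..<n} D) = {}" if "nowhere_dense_in (Euclidean_space n) D"
  proof -
    have "D \<subseteq> topspace (Euclidean_space n)" using D by (simp only: topspace_Euclidean_space)
    then have "Euclidean_space n interior_of D \<subseteq> Euclidean_space n interior_of (Euclidean_space n closure_of D)"
      by (intro interior_of_mono closure_of_subset)
    then show ?thesis
      using that interior_of_Euclidean_eq_empty[OF D] unfolding nowhere_dense_in_def by blast
  qed
  have null_int: "interior (proj {..<n} D) = {}" if null: "lebesgue_null n D"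
  proof (rule ccontr)
    assume "interior (proj {..<n} D) \<noteq> {}"
    then obtain p e where e: "0 < e" "(\<Pi>\<^sub>E i\<in>{..<n}. {p i - e..p i + e}) \<subseteq> trace_on {..<n} D"
      by (rule interior_proj_contains_box)
    obtain N' where N': "N' \<in> null_sets ?M" "trace_on {..<n} D \<subseteq> N'"
      using null unfolding lebesgue_null_def null_sets_completion_iff2 trace_on_def by blast
    note box = emeasure_coordinate_box[OF finite_lessThan less_imp_le[OF e(1)], of n p]
    have "(\<Pi>\<^sub>E i\<in>{..<n}. {p i - e..p i + e}) \<in> null_sets ?M"
      by (rule null_sets_subset[OF N'(1) box(1) order_trans[OF e(2) N'(2)]])
    then have "ennreal ((2 * e) ^ n) = 0"
      using box(2) by (simp only: null_setsD1 card_lessThan)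
    then have "(2 * e) ^ n \<le> 0" by (simp only: ennreal_eq_0_iff)
    moreover have "0 < (2 * e) ^ n" using e(1) by simp
    ultimately show False by linarith
  qed
  define d where "d = top_dim n D"
  let ?S = "{card I |I. I \<subseteq> {..<n} \<and> interior (proj I D) \<noteq> {}}"
  have d: "d = Max ?S"
  proof -
    have "{card I |I. I \<subseteq> {..<n} \<and>
      subtopology (Euclidean_space n) (coord_subspace I) interior_of (coord_proj I ` D) \<noteq> {}} = ?S"
      using interior_of_projection_eq_empty[of _ n D] by auto
    then show ?thesis unfolding d_def top_dim_def by simp
  qed
  have fin: "finite ?S" by (rule finite_subset[of _ "card ` Pow {..<n}"]) auto
  \<comment> \<open>As \<open>D\<close> is nonempty, I = {} makes the set of cardinalities nonempty,
    so its maximum is attained.\<close>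
  have "proj {} D = UNIV" using assms(3) by (auto simp: proj_def)
  then have "card ({} :: nat set) \<in> ?S" by (intro CollectI exI[of _ "{}"]) simp
  then have "d \<in> ?S" unfolding d using fin by (intro Max_in) auto
  then obtain I where I: "I \<subseteq> {..<n}" "interior (proj I D) \<noteq> {}" "card I = d" by blast
  have K_small: "small d (K r)" for r
  proof (rule small_compact_part)
    show "w i = 0" if "w \<in> K r" "i \<ge> n" for w i using that by (rule K_supp)
    show "interior (proj J (K r)) = {}" if J: "J \<subseteq> {..<n}" "card J = Suc d" for J
    proof (rule ccontr)
      assume "interior (proj J (K r)) \<noteq> {}"
      then have "interior (proj J D) \<noteq> {}" using K_sub[of J r] by blast
      then have "Suc d \<in> ?S" using J by auto
      then have "Suc d \<le> d" unfolding d using fin by (intro Max_ge)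
      then show False by simp
    qed
  qed
  have upper: "hausdorff_measure n s D = 0" if s: "real d < s" for s
    unfolding DK
  proof (rule hausdorff_null_UN)
    fix r
    obtain b where b: "\<And>x j. x \<in> K r \<Longrightarrow> \<bar>x j\<bar> \<le> b"
      by (rule compact_bounded_coordinates[of "K r" n]) (use K_compact K_supp in blast)+
    show "hausdorff_measure n s (K r) = 0"
    proof (rule hausdorff_null_of_not_frostman)
      show "\<bar>x j\<bar> \<le> b" if "x \<in> K r" for x j using that by (rule b)
      show "x j = 0" if "x \<in> K r" "j \<ge> n" for x j using that by (rule K_supp)
      show "0 < s" using s by linarith
      show "\<not> frostman s (K r)" by (rule small_not_frostman[OF R K_dset K_compact K_small s])
    qed
  qed
  have "hausdorff_dim n D = of_nat d"
  proof (rule antisym)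
    show "hausdorff_dim n D \<le> of_nat d"
    proof (rule ennreal_le_epsilon)
      fix \<epsilon> :: real assume "0 < \<epsilon>"
      then have "hausdorff_measure n (real d + \<epsilon>) D = 0" by (intro upper) simp
      then have "hausdorff_dim n D \<le> ennreal (real d + \<epsilon>)"
        unfolding hausdorff_dim_def using \<open>0 < \<epsilon>\<close>
        by (intro Inf_lower CollectI exI[of _ "real d + \<epsilon>"]) simp
      then show "hausdorff_dim n D \<le> of_nat d + ennreal \<epsilon>"
        using \<open>0 < \<epsilon>\<close> by (simp add: ennreal_plus ennreal_of_nat_eq_real_of_nat)
    qed
    show "of_nat d \<le> hausdorff_dim n D"
      unfolding hausdorff_dim_def
    proof (rule Inf_greatest, clarify)
      fix s :: real assume s: "0 \<le> s" "hausdorff_measure n s D = 0"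
      then have "real d \<le> s" using hausdorff_positive_of_projection[OF I(1,2) s(1)] I(3) by force
      then show "of_nat d \<le> ennreal s" by (simp add: ennreal_of_nat_eq_real_of_nat ennreal_leI)
    qed
  qed
  then show ?thesis
    using nd null nd_int null_int interior_of_Euclidean_eq_empty[OF D] unfolding d_def by blast
qed

end
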